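(* Let $f\in\mathcal{B}$ be a transcendental entire function and $r'>0$. Suppose that the inverse of $f$ has a direct singularity $a\in\mathbb{C}$. Suppose furthermore that $$\log\log M(r,f)\leq A(r)\log r\quad\text{for } r\geq r',$$ where $A:[r',\infty)\to\mathbb{R}$ is continuous and increasing, satisfies $A(r)<\log r$ for large $r$, and $$\sum_{k=1}^{\infty}\frac{1}{A\left(E^k(0)\right)}=\infty.$$ Then the escaping set $\mathcal{I}(f)$ has Lebesgue measure zero.
   Context: $E(x)=e^x$, $E^k$ its $k$-th iterate; $M(r,f)=\max_{|z|=r}|f(z)|$. $\mathcal{B}$ is the class of transcendental entire functions whose set of singular values (closure in $\mathbb{C}$ of the critical and asymptotic values) is bounded. A singular value $a$ (critical or asymptotic value) is a direct singularity of $f^{-1}$ if there is a spherical disk $D_\chi(a,r)$, $r>0$, and a component $V$ of $f^{-1}(D_\chi(a,r))$ on which $f$ omits the value $a$. $\mathcal{I}(f)=\{z: f^n(z)\to\infty\}$. *)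

theory Defs
  imports "HOL-Complex_Analysis.Complex_Analysis"
begin

definition entire :: "(complex \<Rightarrow> complex) \<Rightarrow> bool" where
  "entire f \<longleftrightarrow> f holomorphic_on UNIV"

definition is_polynomial_fun :: "(complex \<Rightarrow> complex) \<Rightarrow> bool" where
  "is_polynomial_fun f \<longleftrightarrow> (\<exists>n c. \<forall>z. f z = (\<Sum>k\<le>n. c k * z ^ k))"

definition transcendental_entire :: "(complex \<Rightarrow> complex) \<Rightarrow> bool" where
  "transcendental_entire f \<longleftrightarrow> entire f \<and> \<not> is_polynomial_fun f"

definition critical_values :: "(complex \<Rightarrow> complex) \<Rightarrow> complex set" where
  "critical_values f = {f z | z. deriv f z = 0}"

definition asymptotic_values :: "(complex \<Rightarrow> complex) \<Rightarrow> complex set" where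
  "asymptotic_values f = {a. \<exists>\<gamma> :: real \<Rightarrow> complex.
      continuous_on {0..<1} \<gamma> \<and>
      filterlim \<gamma> at_infinity (at_left 1) \<and>
      ((\<lambda>t. f (\<gamma> t)) \<longlongrightarrow> a) (at_left 1)}"

definition singular_values :: "(complex \<Rightarrow> complex) \<Rightarrow> complex set" where
  "singular_values f = closure (critical_values f \<union> asymptotic_values f)"

definition class_B :: "(complex \<Rightarrow> complex) \<Rightarrow> bool" where
  "class_B f \<longleftrightarrow> transcendental_entire f \<and> bounded (singular_values f)"

definition chordal_dist :: "complex \<Rightarrow> complex \<Rightarrow> real" where
  "chordal_dist z w = 2 * cmod (z - w) / (sqrt (1 + (cmod z)\<^sup>2) * sqrt (1 + (cmod w)\<^sup>2))"

definition spherical_disk :: "complex \<Rightarrow> real \<Rightarrow> complex set" where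
  "spherical_disk a r = {z. chordal_dist z a < r}"

definition direct_singularity :: "(complex \<Rightarrow> complex) \<Rightarrow> complex \<Rightarrow> bool" where
  "direct_singularity f a \<longleftrightarrow>
     a \<in> critical_values f \<union> asymptotic_values f \<and>
     (\<exists>r>0. \<exists>V \<in> components (f -` spherical_disk a r). a \<notin> f ` V)"

definition max_modulus :: "(complex \<Rightarrow> complex) \<Rightarrow> real \<Rightarrow> real" where
  "max_modulus f r = Sup {cmod (f z) | z. cmod z = r}"

definition escaping_set :: "(complex \<Rightarrow> complex) \<Rightarrow> complex set" where
  "escaping_set f = {z. filterlim (\<lambda>n. (f ^^ n) z) at_infinity sequentially}"

end

theory Submission
  imports Defs
begin

text \<open>
  In logarithmic coordinates the inverse branches of \<open>f\<close> in the class of Eremenko and Lyubich are univalent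
  on a half-plane, and by Bloch's theorem they contract at a rate comparable to the real part. Hence a disk
  of radius comparable to \<open>Re \<zeta>\<close> around a logarithm \<open>\<zeta>\<close> of \<open>f\<^sup>n z\<close> pulls back along the orbit with
  bounded distortion. The direct singularity gives an open set \<open>V\<close> on which \<open>f\<close> is bounded and
  \<open>u = ln (\<rho> / \<bar>f - a\<bar>)\<close> is positive and harmonic with zero boundary values. The growth of \<open>u\<close> is at most that of
  \<open>ln (max_modulus f r)\<close>, whereas \<open>u\<close> doubles whenever the logarithm of \<open>V\<close> is thin at scale \<open>l\<close> over a length \<open>l\<close>;
  comparing the two with \<open>l\<close> of order \<open>1 / A\<close>, the logarithm of \<open>V\<close> fills a proportion of order \<open>1 / A\<close> of
  large disks. So at each step a proportion of order \<open>1 / A (E\<^sup>k 0)\<close> of the points near those that stay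
  large forever drops to bounded modulus at the next iterate. These sets of dropping points are disjoint
  for different steps and lie in a bounded region, so divergence of the series leaves measure zero for the survivors.
\<close>

section \<open>Nonnegative functions that are harmonic where they are positive\<close>

text \<open>The potential is handled on circles: \<open>pos_harmonic\<close> asks for a local real
  part where the function is positive, and Stone-Weierstrass approximates its values on a circle by
  real parts of polynomials, which bring their own harmonic extension. The sub-mean value property
  and the growth bound both rest on this comparison. The regions pulled back along an orbit have
  bounded size, but the size need not tend to zero; therefore a Vitali covering compares the whole
  set of survivors with the points that drop at a given step. The hypothesis
  \<open>A r < ln r\<close> controls the time scale: it gives
  \<open>ln (max_modulus f r) \<le> exp ((ln r)\<^sup>2)\<close>, so an orbit is dominated by the
  iterated exponential started a fixed number of steps ahead. As \<open>A\<close> is increasing, its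
  value along the orbit is at most its value at that iterate, and the loss at each step is at least
  a constant times a term of the series with shifted index. Transcendence enters through the lift of
  \<open>exp\<close>: a period of the lift would make \<open>f\<close> a polynomial.\<close>

definition pos_harmonic :: "(complex \<Rightarrow> real) \<Rightarrow> bool" where
  "pos_harmonic v \<longleftrightarrow> continuous_on UNIV v \<and> (\<forall>z. 0 \<le> v z) \<and>
     (\<forall>z. v z > 0 \<longrightarrow> (\<exists>e>0. \<exists>h. h holomorphic_on ball z e \<and> (\<forall>w\<in>ball z e. v w = Re (h w))))"

lemma Re_local_max_constant:
  assumes "h holomorphic_on ball z e" "e > 0" and "\<And>w. w \<in> ball z e \<Longrightarrow> Re (h w) \<le> Re (h z)"
    and "w \<in> ball z e"
  shows "Re (h w) = Re (h z)"
proof -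
  have "(\<lambda>w. exp (h w)) constant_on ball z e"
  proof (rule maximum_modulus_principle)
    show "(\<lambda>w. exp (h w)) holomorphic_on ball z e"
      by (intro holomorphic_intros assms)
    show "open (ball z e)" "connected (ball z e)" "open (ball z e)" "ball z e \<subseteq> ball z e" "z \<in> ball z e"
      using assms by auto
  qed (use assms in auto)
  then have "exp (h w) = exp (h z)"
    using assms by (metis centre_in_ball constant_on_def)
  then show ?thesis
    by (metis exp_le_cancel_iff norm_exp_eq_Re order_antisym order_refl)
qed

text \<open>Where \<open>v - Re P\<close> is positive, so is \<open>v\<close>, because
  \<open>Re P\<close> is nonnegative; there the difference is locally the real part of a holomorphic
  function. If its maximum were positive, it would be constant near each interior maximum point, and
  the maximum point farthest from the centre could still be moved outwards.\<close>

lemma pos_harmonic_le_Re: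
  assumes v: "pos_harmonic v" and P: "P holomorphic_on UNIV" and r: "r > 0"
    and le: "\<And>z. z \<in> sphere c r \<Longrightarrow> v z \<le> Re (P z)"
    and pos: "\<And>z. z \<in> cball c r \<Longrightarrow> 0 \<le> Re (P z)"
    and z: "z \<in> cball c r"
  shows "v z \<le> Re (P z)"
proof (rule ccontr)
  assume "\<not> v z \<le> Re (P z)"
  define D where "D = (\<lambda>z. v z - Re (P z))"
  have contD: "continuous_on UNIV D"
    unfolding D_def using v P
    by (intro continuous_intros holomorphic_on_imp_continuous_on) (auto simp: pos_harmonic_def)
  obtain q where q: "q \<in> cball c r" "\<And>w. w \<in> cball c r \<Longrightarrow> D w \<le> D q"
    using continuous_attains_sup[of "cball c r" D] contD r
    by (metis compact_cball continuous_on_subset subset_UNIV z empty_iff)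
  have Dq: "D q > 0"
    using q(2)[OF z] \<open>\<not> v z \<le> Re (P z)\<close> by (simp add: D_def)
  define Z where "Z = cball c r \<inter> D -` {D q}"
  have "closed Z"
    unfolding Z_def using contD
    by (intro continuous_closed_preimage) (auto intro: continuous_on_subset)
  then have compZ: "compact Z"
    using compact_cball[of c r] by (metis Z_def Int_lower1 bounded_cball bounded_subset compact_eq_bounded_closed)
  have "q \<in> Z" using q(1) by (simp add: Z_def)
  moreover have "continuous_on Z (dist c)" by (intro continuous_intros)
  ultimately obtain m where m: "m \<in> Z" "\<And>w. w \<in> Z \<Longrightarrow> dist c w \<le> dist c m"
    using continuous_attains_sup[OF compZ] by blast
  have mD: "D m = D q" "dist c m \<le> r" using m by (auto simp: Z_def)
  have "dist c m \<noteq> r"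
    using le[of m] mD Dq by (auto simp: D_def)
  then have lt: "dist c m < r" using mD by simp
  have "v m > 0"
    using mD Dq pos[of m] by (auto simp: D_def)
  then obtain e h where e: "e > 0" and h: "h holomorphic_on ball m e" "\<And>w. w \<in> ball m e \<Longrightarrow> v w = Re (h w)"
    using v unfolding pos_harmonic_def by metis
  define d where "d = min e (r - dist c m)"
  have d: "d > 0" "d \<le> e" "ball m d \<subseteq> cball c r"
  proof -
    show "ball m d \<subseteq> cball c r"
      unfolding d_def using lt by (auto simp: dist_commute) (smt (verit) dist_triangle dist_commute)
  qed (use e lt in \<open>simp_all add: d_def\<close>)
  have const: "Re (h w - P w) = Re (h m - P m)" if "w \<in> ball m d" for w
  proof (rule Re_local_max_constant[OF _ d(1) _ that])
    show "(\<lambda>w. h w - P w) holomorphic_on ball m d"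
      by (intro holomorphic_intros holomorphic_on_subset[OF h(1)] holomorphic_on_subset[OF P]) (use d in auto)
    show "Re (h w - P w) \<le> Re (h m - P m)" if "w \<in> ball m d" for w
      using q(2)[of w] that d(2,3) h(2)[of w] h(2)[of m] mD e by (auto simp: D_def subset_iff)
  qed
  \<comment> \<open>Unit vector pointing away from \<open>c\<close>; for \<open>m = c\<close> any
    direction serves.\<close>
  define u where "u = (if m = c then 1 else (m - c) /\<^sub>R norm (m - c))"
  have nu: "norm u = 1" by (auto simp: u_def)
  define w where "w = m + (d/2) *\<^sub>R u"
  have wb: "w \<in> ball m d" using d(1) nu by (auto simp: w_def dist_norm)
  have "D w = D q"
    using const[OF wb] h(2)[of w] h(2)[of m] wb d(2) mD e by (auto simp: D_def)
  then have "w \<in> Z" using wb d(3) by (auto simp: Z_def)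
  then have "dist c w \<le> dist c m" using m by blast
  moreover have "dist c w = dist c m + d/2"
  proof -
    have "w - c = (norm (m - c) + d/2) *\<^sub>R u"
      by (auto simp: w_def u_def scaleR_left_distrib)
    then have "norm (w - c) = norm (m - c) + d/2"
      using nu d(1) by simp
    then show ?thesis by (simp add: dist_norm norm_minus_commute)
  qed
  ultimately show False using d(1) by simp
qed

lemma Re_nonneg_cball:
  assumes P: "P holomorphic_on UNIV" and r: "r > 0"
    and le: "\<And>z. z \<in> sphere c r \<Longrightarrow> 0 \<le> Re (P z)" and z: "z \<in> cball c r"
  shows "0 \<le> Re (P z)"
proof -
  have "cmod (exp (- P z)) \<le> 1"
  proof (rule maximum_modulus_frontier[where f = "\<lambda>z. exp (- P z)" and S = "cball c r" and B = 1])
    show "(\<lambda>z. exp (- P z)) holomorphic_on interior (cball c r)"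
      by (intro holomorphic_intros holomorphic_on_subset[OF P]) auto
    show "continuous_on (closure (cball c r)) (\<lambda>z. exp (- P z))"
      by (intro continuous_intros holomorphic_on_imp_continuous_on holomorphic_on_subset[OF P]) auto
  qed (use le z r in auto)
  then show ?thesis by simp
qed

lemma pos_harmonic_le_Re_sphere:
  assumes v: "pos_harmonic v" and P: "P holomorphic_on UNIV" and r: "r > 0"
    and le: "\<And>z. z \<in> sphere c r \<Longrightarrow> v z \<le> Re (P z)"
    and z: "z \<in> cball c r"
  shows "v z \<le> Re (P z)" "0 \<le> Re (P z)"
proof -
  have 0: "0 \<le> Re (P z)" if "z \<in> cball c r" for z
    using Re_nonneg_cball[OF P r _ that] le v unfolding pos_harmonic_def by (meson order_trans)
  show "v z \<le> Re (P z)"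
    by (rule pos_harmonic_le_Re[OF v P r le 0 z])
  show "0 \<le> Re (P z)" by (rule 0[OF z])
qed

lemma pos_harmonic_max_sphere:
  assumes v: "pos_harmonic v" and r: "r > 0"
  obtains z where "z \<in> sphere c r" "\<And>w. w \<in> cball c r \<Longrightarrow> v w \<le> v z"
proof -
  have "continuous_on (sphere c r) v"
    using v unfolding pos_harmonic_def by (auto intro: continuous_on_subset)
  then obtain z where z: "z \<in> sphere c r" "\<And>w. w \<in> sphere c r \<Longrightarrow> v w \<le> v z"
    using continuous_attains_sup[of "sphere c r" v] r
    by (metis compact_sphere sphere_eq_empty not_less_iff_gr_or_eq)
  have "v w \<le> v z" if "w \<in> cball c r" for w
    using pos_harmonic_le_Re_sphere(1)[OF v, of "\<lambda>_. of_real (v z)" r c w] z that r by auto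
  with z that show ?thesis by blast
qed

lemma pos_harmonic_compose:
  assumes v: "pos_harmonic v" and g: "g holomorphic_on UNIV"
  shows "pos_harmonic (\<lambda>z. v (g z))"
  unfolding pos_harmonic_def
proof (intro conjI allI impI)
  have cg: "continuous_on UNIV g" using g by (rule holomorphic_on_imp_continuous_on)
  show "continuous_on UNIV (\<lambda>z. v (g z))"
    using v cg unfolding pos_harmonic_def by (metis continuous_on_compose2 subset_UNIV)
  show "0 \<le> v (g z)" for z using v by (simp add: pos_harmonic_def)
  fix z assume "0 < v (g z)"
  then obtain e h where e: "e > 0" and h: "h holomorphic_on ball (g z) e" "\<And>w. w \<in> ball (g z) e \<Longrightarrow> v w = Re (h w)"
    using v unfolding pos_harmonic_def by metis
  have "open (g -` ball (g z) e)"
    using cg by (simp add: open_vimage continuous_on_eq_continuous_at)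
  then obtain d where d: "d > 0" "ball z d \<subseteq> g -` ball (g z) e"
    using e by (metis centre_in_ball open_contains_ball vimageI)
  have "(\<lambda>w. h (g w)) holomorphic_on ball z d"
    using d by (intro holomorphic_on_compose_gen[OF holomorphic_on_subset[OF g] h(1), unfolded o_def]) auto
  then show "\<exists>e>0. \<exists>h. h holomorphic_on ball z e \<and> (\<forall>w\<in>ball z e. v (g w) = Re (h w))"
    using d h(2) by (intro exI[of _ d] conjI exI[of _ "\<lambda>w. h (g w)"]) auto
qed

text \<open>This is the algebra for Stone-Weierstrass. Its members are boundary values of real parts
  of polynomials, so an approximant comes with its extension to the disk.\<close>

definition Re_poly_on_circle :: "(complex \<Rightarrow> real) \<Rightarrow> bool" where
  "Re_poly_on_circle g \<longleftrightarrow> (\<exists>p. \<forall>z\<in>sphere 0 1. g z = Re (poly p z))"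

lemma Re_poly_on_circle_add:
  "Re_poly_on_circle f \<Longrightarrow> Re_poly_on_circle g \<Longrightarrow> Re_poly_on_circle (\<lambda>x. f x + g x)"
  unfolding Re_poly_on_circle_def by (metis poly_add plus_complex.sel(1))

lemma Re_poly_on_circle_sum:
  "finite A \<Longrightarrow> (\<And>i. i \<in> A \<Longrightarrow> Re_poly_on_circle (f i)) \<Longrightarrow> Re_poly_on_circle (\<lambda>x. \<Sum>i\<in>A. f i x)"
proof (induction A rule: finite_induct)
  case empty
  then show ?case unfolding Re_poly_on_circle_def by (intro exI[of _ 0]) auto
qed (auto intro: Re_poly_on_circle_add)

text \<open>On the unit circle \<open>z\<^sup>j * cnj (z\<^sup>k)\<close> is again a power of \<open>z\<close> or of \<open>cnj z\<close>.\<close>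
lemma Re_poly_on_circle_monom_mult:
  "Re_poly_on_circle (\<lambda>z. Re (a * z ^ j) * Re (b * z ^ k))"
proof -
  have *: "\<exists>p. \<forall>z\<in>sphere 0 1. Re (a * z ^ j) * Re (b * z ^ k) = Re (poly p z)" if "k \<le> j" for a b j k
  proof (intro exI ballI)
    fix z :: complex assume "z \<in> sphere 0 1"
    then have z: "z * cnj z = 1" by (simp add: complex_norm_square[symmetric])
    have "z ^ j * cnj (z ^ k) = z ^ (j - k)"
    proof -
      have "z ^ j = z ^ (j - k) * z ^ k" using that by (simp flip: power_add)
      then show ?thesis by (simp add: mult.assoc flip: power_mult_distrib) (simp add: z)
    qed
    moreover have "Re A * Re B = Re (A * B + A * cnj B) / 2" for A B
      by (simp add: algebra_simps)
    then have "Re (a * z ^ j) * Re (b * z ^ k) =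
        Re ((a * z ^ j) * (b * z ^ k) + (a * z ^ j) * cnj (b * z ^ k)) / 2" .
    moreover have "(a * z ^ j) * cnj (b * z ^ k) = a * cnj b * (z ^ j * cnj (z ^ k))"
      by simp
    moreover have "poly (monom (a * b / 2) (j + k) + monom (a * cnj b / 2) (j - k)) z =
        ((a * z ^ j) * (b * z ^ k) + a * cnj b * z ^ (j - k)) / 2"
      by (simp add: poly_monom power_add field_simps)
    ultimately show "Re (a * z ^ j) * Re (b * z ^ k) =
        Re (poly (monom (a * b / 2) (j + k) + monom (a * cnj b / 2) (j - k)) z)"
      by (metis Re_divide_numeral)
  qed
  show ?thesis
    unfolding Re_poly_on_circle_def
    using *[of k j a b] *[of j k b a] by (cases "k \<le> j") (auto simp: mult.commute)
qed

lemma Re_poly_on_circle_mult: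
  assumes "Re_poly_on_circle f" "Re_poly_on_circle g"
  shows "Re_poly_on_circle (\<lambda>x. f x * g x)"
proof -
  obtain p q where p: "\<And>z. z \<in> sphere 0 1 \<Longrightarrow> f z = Re (poly p z)" and q: "\<And>z. z \<in> sphere 0 1 \<Longrightarrow> g z = Re (poly q z)"
    using assms unfolding Re_poly_on_circle_def by metis
  have "Re_poly_on_circle (\<lambda>z. \<Sum>i\<le>degree p. \<Sum>j\<le>degree q. Re (coeff p i * z ^ i) * Re (coeff q j * z ^ j))"
    by (intro Re_poly_on_circle_sum Re_poly_on_circle_monom_mult) auto
  moreover have "f z * g z = (\<Sum>i\<le>degree p. \<Sum>j\<le>degree q. Re (coeff p i * z ^ i) * Re (coeff q j * z ^ j))"
    if "z \<in> sphere 0 1" for z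
    using p[OF that] q[OF that] by (simp add: poly_altdef Re_sum sum_product)
  ultimately show ?thesis unfolding Re_poly_on_circle_def by auto
qed

lemma Re_poly_approx_sphere:
  fixes v :: "complex \<Rightarrow> real"
  assumes v: "continuous_on (sphere c r) v" and r: "r > 0" and e: "e > 0"
  obtains P where "P holomorphic_on UNIV" "\<And>z. z \<in> sphere c r \<Longrightarrow> \<bar>v z - Re (P z)\<bar> < e"
proof -
  define v' where "v' = (\<lambda>w. v (c + of_real r * w))"
  have "continuous_on (sphere 0 1) v'"
    unfolding v'_def using r
    by (intro continuous_on_compose2[OF v] continuous_intros) (auto simp: dist_norm norm_mult)
  moreover have "\<exists>f. Re_poly_on_circle f \<and> f x \<noteq> f y" if "x \<noteq> y" for x y
  proof -
    have "Re_poly_on_circle Re"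
      unfolding Re_poly_on_circle_def by (intro exI[of _ "[:0,1:]"]) simp
    moreover have "Re_poly_on_circle Im"
      unfolding Re_poly_on_circle_def by (intro exI[of _ "[:0,-\<i>:]"]) simp
    ultimately show ?thesis using that complex_eq_iff by blast
  qed
  moreover have "Re_poly_on_circle (\<lambda>_. k)" for k
    unfolding Re_poly_on_circle_def by (intro exI[of _ "[:of_real k:]"]) simp
  moreover have "continuous_on (sphere 0 1) f" if f: "Re_poly_on_circle f" for f
  proof -
    obtain p where p: "\<And>z. z \<in> sphere 0 1 \<Longrightarrow> f z = Re (poly p z)"
      using f unfolding Re_poly_on_circle_def by metis
    show ?thesis by (subst continuous_on_cong[OF refl p]) (auto intro!: continuous_intros)
  qed
  ultimately have "\<exists>g. Re_poly_on_circle g \<and> (\<forall>x\<in>sphere 0 1. \<bar>v' x - g x\<bar> < e)"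
    using e by (intro Stone_Weierstrass_HOL[of "sphere 0 1" Re_poly_on_circle v' e])
      (auto intro: Re_poly_on_circle_add Re_poly_on_circle_mult)
  then obtain p where p: "\<And>x. x \<in> sphere 0 1 \<Longrightarrow> \<bar>v' x - Re (poly p x)\<bar> < e"
    unfolding Re_poly_on_circle_def by metis
  show thesis
  proof
    show "(\<lambda>z. poly p ((z - c) / of_real r)) holomorphic_on UNIV"
      using r by (intro holomorphic_intros) auto
    fix z assume z: "z \<in> sphere c r"
    have "(z - c) / of_real r \<in> sphere 0 1"
      using z r by (simp add: norm_divide dist_norm norm_minus_commute)
    from p[OF this] show "\<bar>v z - Re (poly p ((z - c) / of_real r))\<bar> < e"
      using r by (simp add: v'_def)
  qed
qed

section \<open>Mean values and the Harnack inequality\<close>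

lemma mean_value_Re:
  assumes P: "P holomorphic_on UNIV" and r: "r > 0"
  shows "((\<lambda>t. Re (P (c + of_real r * cis t))) has_integral 2 * pi * Re (P c)) {0..2*pi}"
proof -
  have "((\<lambda>u. P u / (u - c)) has_contour_integral (2 * of_real pi * \<i> * P c)) (circlepath c r)"
    by (rule Cauchy_integral_circlepath)
      (use r in \<open>auto intro: holomorphic_on_imp_continuous_on holomorphic_on_subset[OF P]\<close>)
  then have "((\<lambda>t. P (c + of_real r * cis t) / (of_real r * cis t) * of_real r * \<i> * cis t) has_integral
      (2 * of_real pi * \<i> * P c)) {0..2*pi}"
    unfolding circlepath_def by (subst (asm) has_contour_integral_part_circlepath_iff) auto
  then have "((\<lambda>t. (P (c + of_real r * cis t) / (of_real r * cis t) * of_real r * \<i> * cis t) * (-\<i>)) has_integral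
      (2 * of_real pi * \<i> * P c) * (- \<i>)) {0..2*pi}"
    by (rule has_integral_mult_left)
  then have "((\<lambda>t. P (c + of_real r * cis t)) has_integral (2 * of_real pi * P c)) {0..2*pi}"
    using r by (simp add: field_simps)
  then have "((\<lambda>t. Re (P (c + of_real r * cis t))) has_integral Re (2 * of_real pi * P c)) {0..2*pi}"
    using has_integral_linear[OF _ bounded_linear_Re] unfolding o_def by blast
  moreover have "Re (2 * of_real pi * P c) = 2 * pi * Re (P c)"
    by simp
  ultimately show ?thesis by metis
qed

lemma pos_harmonic_submean:
  assumes v: "pos_harmonic v" and r: "r > 0"
  shows "2 * pi * v c \<le> integral {0..2*pi} (\<lambda>t. v (c + of_real r * cis t))"
proof (rule field_le_epsilon)
  fix e :: real assume e: "e > 0"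
  \<comment> \<open>On the circle \<open>Re Q\<close> lies between \<open>v\<close> and
    \<open>v + 2 * d\<close>; over an interval of length \<open>2 * pi\<close> the excess adds up to
    \<open>4 * pi * d = e\<close>.\<close>
  define d where "d = e / (4 * pi)"
  have d: "d > 0" using e by (simp add: d_def)
  have cv: "continuous_on A v" for A using v unfolding pos_harmonic_def by (auto intro: continuous_on_subset)
  obtain P where P: "P holomorphic_on UNIV" "\<And>z. z \<in> sphere c r \<Longrightarrow> \<bar>v z - Re (P z)\<bar> < d"
    using Re_poly_approx_sphere[OF cv r d] by metis
  define Q where "Q = (\<lambda>z. P z + of_real d)"
  have Q: "Q holomorphic_on UNIV" unfolding Q_def by (intro holomorphic_intros P)
  have vQ: "v z \<le> Re (Q z)" "Re (Q z) \<le> v z + 2 * d" if "z \<in> sphere c r" for z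
    using P(2)[OF that] by (auto simp: Q_def)
  have "v c \<le> Re (Q c)"
    using pos_harmonic_le_Re_sphere(1)[OF v Q r vQ(1)] r by auto
  then have "2 * pi * v c \<le> 2 * pi * Re (Q c)" by simp
  also have "\<dots> = integral {0..2*pi} (\<lambda>t. Re (Q (c + of_real r * cis t)))"
    using mean_value_Re[OF Q r] by (metis integral_unique)
  also have "\<dots> \<le> integral {0..2*pi} (\<lambda>t. v (c + of_real r * cis t) + 2 * d)"
  proof (rule integral_le)
    show "(\<lambda>t. Re (Q (c + of_real r * cis t))) integrable_on {0..2*pi}"
      using mean_value_Re[OF Q r] by (rule has_integral_integrable)
    show "(\<lambda>t. v (c + of_real r * cis t) + 2 * d) integrable_on {0..2*pi}"
      by (intro integrable_continuous_real continuous_intros continuous_on_compose2[OF cv[of UNIV]]) auto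
    show "Re (Q (c + of_real r * cis t)) \<le> v (c + of_real r * cis t) + 2 * d" for t
      using r by (intro vQ) (auto simp: dist_norm norm_mult)
  qed
  also have "\<dots> = integral {0..2*pi} (\<lambda>t. v (c + of_real r * cis t)) + 2 * d * (2 * pi)"
    by (subst integral_add)
      (auto intro!: integrable_continuous_real continuous_intros continuous_on_compose2[OF cv[of UNIV]])
  also have "2 * d * (2 * pi) = e" by (simp add: d_def)
  finally show "2 * pi * v c \<le> integral {0..2*pi} (\<lambda>t. v (c + of_real r * cis t)) + e" .
qed

text \<open>Harnack: \<open>(P - P c) / (P + cnj (P c))\<close> maps the disk into the unit disk, so the Schwarz lemma applies.\<close>
lemma Harnack_Re:
  assumes P: "P holomorphic_on UNIV" and r: "r > 0"
    and pos: "\<And>z. z \<in> ball c (2 * r) \<Longrightarrow> 0 < Re (P z)" and z: "z \<in> cball c r"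
  shows "Re (P z) \<le> 3 * Re (P c)"
proof -
  define h where "h = (\<lambda>w. (P (c + of_real (2 * r) * w) - P c) / (P (c + of_real (2 * r) * w) + cnj (P c)))"
  have inb: "c + of_real (2 * r) * w \<in> ball c (2 * r)" if "norm w < 1" for w
    using that r by (simp add: dist_norm norm_mult)
  have pc: "0 < Re (P c)" using pos[of c] r by simp
  have nz: "P (c + of_real (2 * r) * w) + cnj (P c) \<noteq> 0" if "norm w < 1" for w
    using pos[OF inb[OF that]] pc by (auto simp: complex_eq_iff)
  have sq: "(norm (x + cnj (P c)))\<^sup>2 - (norm (x - P c))\<^sup>2 = 4 * Re x * Re (P c)" for x
    by (simp add: cmod_power2) (simp add: power2_eq_square algebra_simps)
  have hh: "h holomorphic_on ball 0 1"
    unfolding h_def using nz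
    by (intro holomorphic_intros holomorphic_on_compose_gen[OF _ P, unfolded o_def]) auto
  have h0: "h 0 = 0" by (simp add: h_def)
  have h1: "norm (h w) < 1" if "norm w < 1" for w
  proof -
    let ?x = "P (c + of_real (2 * r) * w)"
    have "(norm (?x - P c))\<^sup>2 < (norm (?x + cnj (P c)))\<^sup>2"
      using sq[of ?x] pos[OF inb[OF that]] pc by (smt (verit) mult_pos_pos)
    then have "norm (?x - P c) < norm (?x + cnj (P c))"
      by (rule power_less_imp_less_base) simp
    then show ?thesis using nz[OF that] by (simp add: h_def norm_divide)
  qed
  define w where "w = (z - c) / of_real (2 * r)"
  \<comment> \<open>A point of the half-size disk has modulus at most \<open>1/2\<close> in the
    coordinate of the disk of radius \<open>2 * r\<close>. The resulting bound of
    \<open>norm (P z - P c)\<close> by half of \<open>norm (P z + cnj (P c))\<close> yields the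
    factor 3.\<close>
  have w: "norm w \<le> 1/2" using z r by (simp add: w_def norm_divide dist_norm norm_minus_commute)
  have zw: "c + of_real (2 * r) * w = z" using r by (simp add: w_def)
  have w1: "norm w < 1" using w by simp
  have "norm (h w) \<le> norm w"
    by (rule Schwarz_Lemma(1)[OF hh h0 h1 w1])
  then have "norm (h w) \<le> 1/2" using w by simp
  then have le: "norm (P z - P c) \<le> norm (P z + cnj (P c)) / 2"
    using nz[OF w1] by (simp add: h_def norm_divide field_simps flip: zw) 
  define xx yy a b where "xx = Re (P z)" and "yy = Im (P z)" and "a = Re (P c)" and "b = Im (P c)"
  have "(norm (P z - P c))\<^sup>2 \<le> (norm (P z + cnj (P c)) / 2)\<^sup>2"
    using le by (rule power_mono) simp
  then have "4 * ((xx - a)\<^sup>2 + (yy - b)\<^sup>2) \<le> (xx + a)\<^sup>2 + (yy - b)\<^sup>2"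
    by (simp add: cmod_power2 power_divide xx_def yy_def a_def b_def)
  moreover have "\<And>X Y C. 4 * (X + Y) \<le> C + Y \<Longrightarrow> 0 \<le> Y \<Longrightarrow> 4 * X \<le> (C::real)"
    by simp
  ultimately have "4 * (xx - a)\<^sup>2 \<le> (xx + a)\<^sup>2"
    using zero_le_power2 by blast
  moreover have "(2 * (xx - a))\<^sup>2 = 4 * (xx - a)\<^sup>2" by (simp only: power_mult_distrib) simp
  ultimately have sq: "(2 * (xx - a))\<^sup>2 \<le> (xx + a)\<^sup>2" by simp
  have "0 \<le> xx + a"
    using pos[OF inb[OF w1]] zw pc by (simp add: xx_def a_def)
  with sq have "2 * (xx - a) \<le> xx + a" by (rule power2_le_imp_le)
  then show ?thesis by (simp add: xx_def a_def)
qed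

section \<open>The tract over a direct singularity and its potential\<close>

text \<open>The function \<open>(h z / k) ^ n / (z - b)\<close> decays on large circles because
  \<open>h\<close> is bounded, and on the frontier it is at most \<open>1 / \<eta>\<close> because
  the disk around \<open>b\<close> misses \<open>V\<close>. The maximum principle thus bounds
  \<open>(norm (h z0) / k) ^ n\<close> by a number independent of \<open>n\<close>.\<close>

lemma Phragmen_Lindelof_bounded:
  assumes V: "open V" and b: "\<eta> > 0" "V \<inter> ball b \<eta> = {}"
    and h: "h holomorphic_on V" "continuous_on (closure V) h"
    and H: "\<And>z. z \<in> V \<Longrightarrow> norm (h z) \<le> H"
    and k: "k > 0" "\<And>z. z \<in> frontier V \<Longrightarrow> norm (h z) \<le> k"
    and z0: "z0 \<in> V"
  shows "norm (h z0) \<le> k"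
proof (rule ccontr)
  assume "\<not> norm (h z0) \<le> k"
  then have q: "norm (h z0) / k > 1" using k by simp
  have Hc: "norm (h z) \<le> H" if "z \<in> closure V" for z
    using continuous_le_on_closure[of V "\<lambda>z. norm (h z)" z H] h(2) that H
    by (auto intro: continuous_on_norm)
  have bV: "b \<notin> closure V"
    using b by (metis Int_commute centre_in_ball disjoint_iff open_Int_closure_eq_empty open_ball)
  have far: "\<eta> \<le> norm (z - b)" if "z \<in> closure V" for z
  proof (rule ccontr)
    assume "\<not> \<eta> \<le> norm (z - b)"
    then have "z \<in> ball b \<eta>" by (simp add: dist_norm norm_minus_commute)
    then show False using that b by (metis Int_commute disjoint_iff open_Int_closure_eq_empty open_ball)
  qed
  have bound: "(norm (h z0) / k) ^ n \<le> norm (z0 - b) / \<eta>" for n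
  proof -
    \<comment> \<open>The first entry puts \<open>z0\<close> inside the truncated domain; the second
      makes \<open>(H / k) ^ n / S\<close> at most \<open>1 / \<eta>\<close> on the cutting
      circle.\<close>
    define S where "S = max (norm (z0 - b) + 1) (\<eta> * (H / k) ^ n)"
    have S: "norm (z0 - b) < S" "\<eta> * (H / k) ^ n \<le> S" "S > 0"
      using b by (auto simp: S_def) (smt (verit) norm_ge_zero)
    define W where "W = V \<inter> ball b S"
    have "W \<subseteq> V" "W \<subseteq> cball b S" by (auto simp: W_def)
    then have clW: "closure W \<subseteq> closure V \<inter> cball b S"
      by (simp add: closure_mono closure_minimal)
    define g where "g = (\<lambda>z. (h z / of_real k) ^ n / (z - b))"
    have nz: "z - b \<noteq> 0" if "z \<in> closure V" for z using that bV by auto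
    have "norm (g z0) \<le> 1 / \<eta>"
    proof (rule maximum_modulus_frontier[of g W])
      have "open W" unfolding W_def using V by auto
      then have "interior W = W" by (rule interior_open)
      then show "g holomorphic_on interior W"
        unfolding g_def using nz k closure_subset[of V] holomorphic_on_subset[OF h(1), of W]
        by (intro holomorphic_intros) (auto simp: W_def)
      show "continuous_on (closure W) g"
        unfolding g_def using nz k clW
        by (intro continuous_intros continuous_on_subset[OF h(2)]) auto
      show "bounded W" unfolding W_def by (simp add: bounded_Int)
      show "z0 \<in> W" using z0 S by (simp add: W_def dist_norm norm_minus_commute)
      fix z assume z: "z \<in> frontier W"
      then have "z \<in> closure V" using clW by (auto simp: frontier_def)
      have "z \<in> frontier V \<or> (z \<in> closure V \<and> z \<in> sphere b S)"
        using z clW \<open>interior W = W\<close> V by (auto simp: frontier_def W_def interior_open)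
      then show "norm (g z) \<le> 1 / \<eta>"
      proof
        assume fr: "z \<in> frontier V"
        have "norm (g z) = (norm (h z) / k) ^ n / norm (z - b)"
          using k by (simp add: g_def norm_divide norm_power)
        also have "\<dots> \<le> 1 / \<eta>"
          using k(2)[OF fr] k(1) far[OF \<open>z \<in> closure V\<close>] b
          by (intro frac_le power_le_one) auto
        finally show ?thesis .
      next
        assume sp: "z \<in> closure V \<and> z \<in> sphere b S"
        have "norm (g z) = (norm (h z) / k) ^ n / S"
          using k sp by (simp add: g_def norm_divide norm_power dist_norm norm_minus_commute)
        also have "\<dots> \<le> (H / k) ^ n / S"
          using k(1) Hc sp S by (intro divide_right_mono power_mono) auto
        also have "\<dots> \<le> 1 / \<eta>"
          using S b by (simp add: pos_divide_le_eq pos_le_divide_eq mult.commute)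
        finally show ?thesis .
      qed
    qed
    moreover have "norm (g z0) = (norm (h z0) / k) ^ n / norm (z0 - b)"
      using k by (simp add: g_def norm_divide norm_power)
    moreover have "norm (z0 - b) > 0" using nz z0 closure_subset by force
    ultimately have "(norm (h z0) / k) ^ n \<le> 1 / \<eta> * norm (z0 - b)"
      by (simp only: pos_divide_le_eq)
    then show ?thesis by simp
  qed
  obtain n where "norm (z0 - b) / \<eta> < (norm (h z0) / k) ^ n"
    using real_arch_pow[OF q] by blast
  then show False using bound[of n] by simp
qed

lemma entire_dense_image:
  assumes f: "f holomorphic_on UNIV" and nc: "\<not> f constant_on UNIV" and U: "open U" "U \<noteq> {}"
  obtains z where "f z \<in> U"
proof (rule ccontr)
  assume "\<not> thesis"
  then have no: "f z \<notin> U" for z using that by blast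
  obtain w e where w: "e > 0" "ball w e \<subseteq> U" using U by (metis all_not_in_conv openE)
  have far: "e \<le> norm (f z - w)" for z
    using no[of z] w by (metis dist_commute dist_norm mem_ball not_le subsetD)
  have nz: "f z - w \<noteq> 0" for z using far[of z] w by auto
  have "(\<lambda>z. 1 / (f z - w)) holomorphic_on UNIV"
    using f nz by (intro holomorphic_intros) auto
  moreover have "bounded (range (\<lambda>z. 1 / (f z - w)))"
  proof (rule boundedI[of _ "1/e"])
    fix x assume "x \<in> range (\<lambda>z. 1 / (f z - w))"
    then obtain z where "x = 1 / (f z - w)" by blast
    then show "norm x \<le> 1 / e" using far[of z] w by (simp add: norm_divide frac_le)
  qed
  ultimately obtain c where c: "\<And>z. 1 / (f z - w) = c"
    using Liouville_theorem[of "\<lambda>z. 1 / (f z - w)"] unfolding constant_on_def by auto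
  have "f z = w + 1 / c" for z
  proof -
    have "f z - w = 1 / c" using c[of z] nz[of z] by (metis nonzero_eq_divide_eq div_by_1 divide_divide_eq_right mult_1)
    then show ?thesis by (simp add: algebra_simps)
  qed
  then show False using nc by (auto simp: constant_on_def)
qed

lemma transcendental_not_constant:
  assumes "transcendental_entire f" shows "\<not> f constant_on UNIV"
proof
  assume "f constant_on UNIV"
  then obtain c where "\<And>z. f z = c" by (auto simp: constant_on_def)
  then have "\<forall>z. f z = (\<Sum>k\<le>0. (\<lambda>_. c) k * z ^ k)" by simp
  then have "is_polynomial_fun f" unfolding is_polynomial_fun_def by (intro exI)
  then show False using assms by (simp add: transcendental_entire_def)
qed

section \<open>Chordal distance and the Moebius map that sends \<open>a\<close> to infinity\<close>

lemma chordal_identity: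
  "(cmod (1 + cnj a * w))\<^sup>2 + (cmod (w - a))\<^sup>2 = (1 + (cmod w)\<^sup>2) * (1 + (cmod a)\<^sup>2)"
  by (simp add: cmod_power2) (simp add: power2_eq_square algebra_simps)

lemma chordal_dist_sq:
  "(chordal_dist w a)\<^sup>2 * ((cmod (1 + cnj a * w))\<^sup>2 + (cmod (w - a))\<^sup>2) = 4 * (cmod (w - a))\<^sup>2"
proof -
  have "1 + (cmod w)\<^sup>2 > 0" "1 + (cmod a)\<^sup>2 > 0" by (auto simp: add_pos_nonneg)
  then show ?thesis
    unfolding chordal_identity chordal_dist_def
    by (simp add: power_divide power_mult_distrib)
qed

lemma chordal_dist_nonneg: "0 \<le> chordal_dist w a"
  by (simp add: chordal_dist_def)

text \<open>The Moebius map \<open>(1 + cnj a * w) / (w - a)\<close> is a rotation of the sphere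
  taking \<open>a\<close> to infinity. A chordal disk around \<open>a\<close> with
  \<open>r < 2\<close> therefore becomes the outside of a circle around \<open>0\<close>, of squared
  radius \<open>4 / r\<^sup>2 - 1\<close>.\<close>

lemma chordal_less_iff:
  assumes "0 < r" "w \<noteq> a"
  shows "chordal_dist w a < r \<longleftrightarrow> 4 / r\<^sup>2 < (cmod ((1 + cnj a * w) / (w - a)))\<^sup>2 + 1"
proof -
  define B where "B = (cmod (w - a))\<^sup>2"
  define C where "C = (cmod (1 + cnj a * w))\<^sup>2"
  have B: "B > 0" using assms by (simp add: B_def)
  have C: "C \<ge> 0" by (simp add: C_def)
  have "(chordal_dist w a)\<^sup>2 * (C + B) = 4 * B"
    unfolding B_def C_def by (rule chordal_dist_sq)
  then have e: "(chordal_dist w a)\<^sup>2 = 4 * B / (C + B)"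
    using B C by (simp add: field_simps)
  have "chordal_dist w a < r \<longleftrightarrow> (chordal_dist w a)\<^sup>2 < r\<^sup>2"
    using assms chordal_dist_nonneg[of w a] by (auto intro: power_strict_mono power2_less_imp_less)
  also have "\<dots> \<longleftrightarrow> 4 / r\<^sup>2 < C / B + 1"
    unfolding e using assms B C by (simp add: field_simps)
  finally show ?thesis by (simp add: B_def C_def norm_divide power_divide)
qed

lemma chordal_dist_le: "chordal_dist w a \<le> 2 * cmod (w - a)"
proof -
  have "1 \<le> sqrt (1 + (cmod w)\<^sup>2) * sqrt (1 + (cmod a)\<^sup>2)"
    using mult_mono[of 1 "sqrt (1 + (cmod w)\<^sup>2)" 1 "sqrt (1 + (cmod a)\<^sup>2)"] by simp
  then show ?thesis
    unfolding chordal_dist_def by (simp add: divide_le_eq mult_le_cancel_left1)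
qed

lemma open_spherical_disk: "open (spherical_disk a r)"
proof -
  have "sqrt (1 + (cmod z)\<^sup>2) \<noteq> 0" for z by (metis add_pos_nonneg less_irrefl real_sqrt_eq_0_iff zero_le_power2 zero_less_one)
  then have "continuous_on UNIV (\<lambda>z. chordal_dist z a)"
    unfolding chordal_dist_def by (intro continuous_intros) auto
  then show ?thesis
    unfolding spherical_disk_def by (intro open_Collect_less) auto
qed

text \<open>The definition of a direct singularity does not say that \<open>f\<close> comes close to \<open>a\<close> on the component \<open>V\<close>.
  This follows from the Phragmen-Lindelof principle for the Moebius image
  \<open>(1 + cnj a * f) / (f - a)\<close> whose modulus is a function of the chordal distance to \<open>a\<close>.\<close>
lemma component_approaches_value:
  assumes f: "f holomorphic_on UNIV" and nc: "\<not> f constant_on UNIV"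
    and r: "r > 0" and V: "V \<in> components (f -` spherical_disk a r)" and om: "a \<notin> f ` V"
    and \<rho>: "0 < \<rho>" "\<rho> \<le> r / 2"
  obtains z where "z \<in> V" "cmod (f z - a) < \<rho>"
proof (rule ccontr)
  assume "\<not> thesis"
  with that have "\<And>z. z \<in> V \<Longrightarrow> \<not> cmod (f z - a) < \<rho>" by blast
  then have far: "\<rho> \<le> cmod (f z - a)" if "z \<in> V" for z using that by force
  have contf: "continuous_on A f" for A using f by (meson continuous_on_subset holomorphic_on_imp_continuous_on subset_UNIV)
  define X where "X = f -` spherical_disk a r"
  have openX: "open X" unfolding X_def using open_vimage[OF open_spherical_disk] contf by auto
  have openV: "open V" using V openX open_components X_def by blast
  have VX: "V \<subseteq> X" "V \<noteq> {}" using V X_def in_components_subset in_components_nonempty by blast+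
  have frV: "z \<notin> X" if z: "z \<in> frontier V" for z
  proof
    assume "z \<in> X"
    then obtain e where e: "e > 0" "ball z e \<subseteq> X" using openX openE by blast
    have "z \<in> closure V" "z \<notin> V" using z openV by (auto simp: frontier_def interior_open)
    then have "V \<inter> ball z e \<noteq> {}"
      using e by (metis Int_commute centre_in_ball disjoint_iff open_Int_closure_eq_empty open_ball)
    then have "ball z e \<subseteq> V"
      using components_maximal[OF V, of "ball z e"] e X_def by auto
    then show False using \<open>z \<notin> V\<close> e by (meson centre_in_ball subsetD)
  qed
  show False
  proof (cases "r < 2")
    case True
    define k where "k = sqrt (4 / r\<^sup>2 - 1)"
    have "r\<^sup>2 < 2\<^sup>2" using True r by (intro power_strict_mono) auto
    then have k: "k > 0" "k\<^sup>2 = 4 / r\<^sup>2 - 1" using r by (auto simp: k_def field_simps)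
    have inX: "z \<in> X \<longleftrightarrow> k < cmod ((1 + cnj a * f z) / (f z - a))" if "f z \<noteq> a" for z
    proof -
      have "z \<in> X \<longleftrightarrow> k\<^sup>2 < (cmod ((1 + cnj a * f z) / (f z - a)))\<^sup>2"
        using chordal_less_iff[OF r that] k(2) by (auto simp: X_def spherical_disk_def)
      also have "\<dots> \<longleftrightarrow> k < cmod ((1 + cnj a * f z) / (f z - a))"
        using k(1) by (meson norm_ge_zero less_le not_le power_mono power_strict_mono pos2)
      finally show ?thesis .
    qed
    define h where "h = (\<lambda>z. (1 + cnj a * f z) / (f z - a))"
    have farc: "\<rho> \<le> cmod (f z - a)" if "z \<in> closure V" for z
      by (rule continuous_ge_on_closure[of V "\<lambda>z. cmod (f z - a)" z \<rho>])
        (use far that in \<open>auto intro!: continuous_intros contf\<close>)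
    \<comment> \<open>\<open>U\<close> is the complement of the closed chordal disk around
      \<open>a\<close>. It contains the antipode \<open>- 1 / cnj a\<close>, which the Moebius map
      sends to \<open>0\<close>; for \<open>a = 0\<close> the antipode is infinity, so a large real
      number is taken. A disk mapped into \<open>U\<close> is the hole outside \<open>V\<close> that
      the Phragmen-Lindelof argument asks for.\<close>
    define U where "U = {w. cmod (1 + cnj a * w) < k * cmod (w - a)}"
    have "open U" unfolding U_def by (intro open_Collect_less continuous_intros)
    moreover have "U \<noteq> {}"
    proof (cases "a = 0")
      case True
      then have "of_real (2 / k) \<in> U" using k by (simp add: U_def norm_divide)
      then show ?thesis by blast
    next
      case False
      have "cnj a * (- 1 / cnj a) = -1" using False by simp
      moreover have "- 1 / cnj a \<noteq> a"
      proof
        assume "- 1 / cnj a = a"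
        then have "a * cnj a = -1" using False by (simp add: field_simps)
        then have "(cmod a)\<^sup>2 = -1" by (metis complex_norm_square of_real_eq_iff of_real_minus of_real_1)
        then show False by (metis zero_le_power2 not_one_le_zero neg_0_le_iff_le)
      qed
      ultimately have "- 1 / cnj a \<in> U" using k by (simp add: U_def)
      then show ?thesis by blast
    qed
    ultimately obtain b where b: "f b \<in> U" using entire_dense_image[OF f nc] by metis
    have "open (f -` U)" using \<open>open U\<close> contf open_vimage by blast
    then obtain \<eta> where \<eta>: "\<eta> > 0" "ball b \<eta> \<subseteq> f -` U" using b by (meson openE vimageI)
    have disj: "V \<inter> ball b \<eta> = {}"
    proof (rule ccontr)
      assume "V \<inter> ball b \<eta> \<noteq> {}"
      then obtain z where z: "z \<in> V" "f z \<in> U" using \<eta> by auto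
      then have "f z \<noteq> a" "z \<in> X" using om VX by auto
      then show False using inX[of z] z(2) by (auto simp: U_def norm_divide field_simps)
    qed
    have cl0: "f z - a \<noteq> 0" if "z \<in> closure V" for z using farc[OF that] \<rho> by auto
    obtain z0 where z0: "z0 \<in> V" using VX by blast
    have "norm (h z0) \<le> k"
    proof (rule Phragmen_Lindelof_bounded[OF openV \<eta>(1) disj _ _ _ k(1) _ z0])
      show "h holomorphic_on V"
        unfolding h_def using cl0 closure_subset
        by (intro holomorphic_intros holomorphic_on_subset[OF f]) auto
      show "continuous_on (closure V) h"
        unfolding h_def using cl0 by (intro continuous_intros contf) auto
      show "norm (h z) \<le> (1 + (cmod a)\<^sup>2) / \<rho> + cmod a" if "z \<in> V" for z
      proof -
        have nz: "f z - a \<noteq> 0" using cl0 closure_subset that by blast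
        have "1 + cnj a * f z = (1 + of_real ((cmod a)\<^sup>2)) + cnj a * (f z - a)"
          using complex_norm_square[of a] by (simp add: algebra_simps)
        then have "h z = (1 + of_real ((cmod a)\<^sup>2)) / (f z - a) + cnj a"
          using nz by (simp add: h_def add_divide_distrib)
        then have "norm (h z) \<le> norm ((1 + of_real ((cmod a)\<^sup>2)) / (f z - a)) + norm (cnj a)"
          by (simp only: norm_triangle_ineq)
        moreover have "norm (1 + complex_of_real ((cmod a)\<^sup>2)) = 1 + (cmod a)\<^sup>2"
          by (metis abs_of_nonneg add_nonneg_nonneg norm_of_real of_real_1 of_real_add zero_le_one zero_le_power2)
        then have "norm ((1 + complex_of_real ((cmod a)\<^sup>2)) / (f z - a)) \<le> (1 + (cmod a)\<^sup>2) / \<rho>"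
          using far[OF that] \<rho> by (simp add: norm_divide frac_le)
        ultimately show ?thesis by simp
      qed
      show "norm (h z) \<le> k" if "z \<in> frontier V" for z
        using inX[of z] frV[OF that] cl0[of z] that by (auto simp: h_def frontier_def)
    qed
    then show False using inX[of z0] z0 VX om by (auto simp: h_def)
  next
    case False
    \<comment> \<open>The sphere has chordal diameter 2, so here the disk omits at most the antipode
      of \<open>a\<close>. Its preimage is the plane minus a countable set, hence connected and
      equal to \<open>V\<close>; since \<open>f\<close> has dense image, it enters
      \<open>ball a \<rho>\<close> there.\<close>
    have sub: "z \<in> X" if "1 + cnj a * f z \<noteq> 0" for z
    proof (cases "f z = a")
      case True
      then show ?thesis using r by (simp add: X_def spherical_disk_def chordal_dist_def)
    next
      case neq: False
      have "2\<^sup>2 \<le> r\<^sup>2" using False by (intro power_mono) auto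
      then have "4 / r\<^sup>2 \<le> 1" using r by simp
      moreover have "(cmod ((1 + cnj a * f z) / (f z - a)))\<^sup>2 > 0" using that neq by simp
      ultimately show ?thesis
        using chordal_less_iff[OF r neq] unfolding X_def spherical_disk_def
        by (simp only: vimage_eq mem_Collect_eq)
    qed
    have "countable {z \<in> UNIV. 1 + cnj a * f z = 0}"
    proof (cases "a = 0")
      case False
      show ?thesis
      proof (rule holomorphic_countable_zeros)
        show "\<not> (\<lambda>z. 1 + cnj a * f z) constant_on UNIV"
        proof
          assume "(\<lambda>z. 1 + cnj a * f z) constant_on UNIV"
          then obtain c where "\<And>z. 1 + cnj a * f z = c" by (auto simp: constant_on_def)
          then have "f z = (c - 1) / cnj a" for z using False by (metis add_diff_cancel_left' complex_cnj_zero_iff nonzero_mult_div_cancel_left)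
          then show False using nc by (auto simp: constant_on_def)
        qed
      qed (use f in \<open>auto intro!: holomorphic_intros\<close>)
    qed auto
    then have "countable (- X)" by (rule countable_subset[rotated]) (use sub in auto)
    then have "connected X"
      using path_connected_complement_countable[of "- X"] path_connected_imp_connected by auto
    then have "components X = {X}" using VX by (metis components_eq_sing_iff subset_empty)
    then have "V = X" using V unfolding X_def by blast
    obtain z where z: "f z \<in> ball a \<rho>"
      using entire_dense_image[OF f nc, of "ball a \<rho>"] \<rho> by auto
    then have "z \<in> X"
      using chordal_dist_le[of "f z" a] \<rho> by (auto simp: X_def spherical_disk_def dist_norm norm_minus_commute)
    then show False using far[of z] z \<open>V = X\<close> by (auto simp: dist_norm norm_minus_commute)
  qed
qed

text \<open>The tract is cut out by a Euclidean disk around \<open>a\<close>; it need not be connected.\<close>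
definition omitting_tract :: "(complex \<Rightarrow> complex) \<Rightarrow> complex \<Rightarrow> real \<Rightarrow> complex set \<Rightarrow> bool" where
  "omitting_tract f a \<rho> V \<longleftrightarrow> open V \<and> V \<noteq> {} \<and> 0 < \<rho> \<and> (\<forall>z\<in>V. f z \<noteq> a \<and> cmod (f z - a) < \<rho>) \<and>
     (\<forall>z\<in>frontier V. cmod (f z - a) = \<rho>)"

text \<open>The chordal distance is at most twice the Euclidean one, so
  \<open>\<rho> = r / 2\<close> puts the Euclidean disk inside the spherical one. A frontier point
  with \<open>cmod (f z - a) < \<rho>\<close> would then lie in the component \<open>W\<close>,
  hence in the open set \<open>V\<close> itself.\<close>

lemma direct_singularity_tract:
  assumes f: "f holomorphic_on UNIV" and nc: "\<not> f constant_on UNIV" and d: "direct_singularity f a"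
  obtains \<rho> V where "omitting_tract f a \<rho> V"
proof -
  obtain r W where r: "r > 0" and W: "W \<in> components (f -` spherical_disk a r)" "a \<notin> f ` W"
    using d unfolding direct_singularity_def by blast
  define \<rho> where "\<rho> = r / 2"
  have \<rho>: "0 < \<rho>" "\<rho> \<le> r / 2" using r by (auto simp: \<rho>_def)
  have contf: "continuous_on A f" for A using f by (meson continuous_on_subset holomorphic_on_imp_continuous_on subset_UNIV)
  define X where "X = f -` spherical_disk a r"
  have openX: "open X" unfolding X_def using open_vimage[OF open_spherical_disk] contf by auto
  have openW: "open W" using W openX open_components X_def by blast
  define V where "V = W \<inter> {z. cmod (f z - a) < \<rho>}"
  have openV: "open V"
    unfolding V_def by (intro open_Int openW open_Collect_less continuous_intros contf)
  have "V \<noteq> {}"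
    using component_approaches_value[OF f nc r W \<rho>] by (auto simp: V_def)
  moreover have "cmod (f z - a) = \<rho>" if z: "z \<in> frontier V" for z
  proof -
    have zc: "z \<in> closure V" "z \<notin> V" using z openV by (auto simp: frontier_def interior_open)
    have le: "cmod (f z - a) \<le> \<rho>"
      by (rule continuous_le_on_closure[of V "\<lambda>z. cmod (f z - a)" z \<rho>])
        (use zc in \<open>auto intro!: continuous_intros contf simp: V_def\<close>)
    have inW: "z \<in> W" if lt: "cmod (f z - a) < \<rho>"
    proof -
      have "z \<in> X" using chordal_dist_le[of "f z" a] lt \<rho> by (auto simp: X_def spherical_disk_def)
      then obtain e where e: "e > 0" "ball z e \<subseteq> X" using openX openE by blast
      have "z \<in> closure W" using zc closure_mono[of V W] by (auto simp: V_def)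
      then have "W \<inter> ball z e \<noteq> {}"
        using e by (metis Int_commute centre_in_ball disjoint_iff open_Int_closure_eq_empty open_ball)
      then have "ball z e \<subseteq> W"
        using components_maximal[OF W(1), of "ball z e"] e X_def by auto
      then show ?thesis using e by auto
    qed
    have "\<not> cmod (f z - a) < \<rho>" using inW zc(2) by (auto simp: V_def)
    then show ?thesis using le by simp
  qed
  ultimately have "omitting_tract f a \<rho> V"
    unfolding omitting_tract_def using openV \<rho> W(2) by (auto simp: V_def)
  then show thesis by (rule that)
qed

definition tract_potential :: "(complex \<Rightarrow> complex) \<Rightarrow> complex \<Rightarrow> real \<Rightarrow> complex set \<Rightarrow> complex \<Rightarrow> real" where
  "tract_potential f a \<rho> V z = (if z \<in> V then ln (\<rho> / cmod (f z - a)) else 0)"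

lemma tract_potential_pos_iff:
  assumes "omitting_tract f a \<rho> V"
  shows "0 < tract_potential f a \<rho> V z \<longleftrightarrow> z \<in> V" "0 \<le> tract_potential f a \<rho> V z"
proof -
  have "0 < ln (\<rho> / cmod (f z - a))" if "z \<in> V"
    using assms that by (auto simp: omitting_tract_def intro!: ln_gt_zero)
  then show "0 < tract_potential f a \<rho> V z \<longleftrightarrow> z \<in> V" "0 \<le> tract_potential f a \<rho> V z"
    by (auto simp: tract_potential_def less_imp_le)
qed

lemma pos_harmonic_tract_potential:
  assumes f: "f holomorphic_on UNIV" and t: "omitting_tract f a \<rho> V"
  shows "pos_harmonic (tract_potential f a \<rho> V)"
  unfolding pos_harmonic_def
proof (intro conjI allI impI)
  have V: "open V" "0 < \<rho>" "\<And>z. z \<in> V \<Longrightarrow> f z \<noteq> a" "\<And>z. z \<in> frontier V \<Longrightarrow> cmod (f z - a) = \<rho>"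
    using t by (auto simp: omitting_tract_def)
  have contf: "continuous_on A f" for A using f by (meson continuous_on_subset holomorphic_on_imp_continuous_on subset_UNIV)
  have nz: "f z - a \<noteq> 0" if "z \<in> closure V" for z
  proof (cases "z \<in> V")
    case False
    then have "cmod (f z - a) = \<rho>" using V that by (simp add: frontier_def interior_open)
    then show ?thesis using V(2) by force
  qed (use V in simp)
  have "continuous_on (closure V \<union> (- V)) (\<lambda>z. if z \<in> V then ln (\<rho> / cmod (f z - a)) else 0)"
  proof (rule continuous_on_cases)
    show "continuous_on (closure V) (\<lambda>z. ln (\<rho> / cmod (f z - a)))"
      using nz V(2) by (intro continuous_intros contf) auto
    show "\<forall>x. x \<in> closure V \<and> x \<notin> V \<or> x \<in> - V \<and> x \<in> V \<longrightarrow> ln (\<rho> / cmod (f x - a)) = 0"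
      using V by (auto simp: frontier_def interior_open)
  qed (use V in auto)
  moreover have "closure V \<union> (- V) = UNIV" using closure_subset by auto
  ultimately show "continuous_on UNIV (tract_potential f a \<rho> V)"
    by (simp add: tract_potential_def[abs_def])
  show "0 \<le> tract_potential f a \<rho> V z" for z using tract_potential_pos_iff[OF t] by simp
  fix z assume "0 < tract_potential f a \<rho> V z"
  then have "z \<in> V" using tract_potential_pos_iff[OF t] by simp
  then obtain e where e: "e > 0" "ball z e \<subseteq> V" using V(1) openE by blast
  have "(\<lambda>w. f w - a) holomorphic_on ball z e"
    by (intro holomorphic_intros holomorphic_on_subset[OF f]) auto
  then obtain g where g: "g holomorphic_on ball z e" "\<And>w. w \<in> ball z e \<Longrightarrow> f w - a = exp (g w)"
  proof (rule contractible_imp_holomorphic_log)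
    show "contractible (ball z e)" by (simp add: convex_imp_contractible)
    show "f w - a \<noteq> 0" if "w \<in> ball z e" for w using V(3)[of w] e(2) that by auto
  qed blast
  have "tract_potential f a \<rho> V w = Re (of_real (ln \<rho>) - g w)" if "w \<in> ball z e" for w
  proof -
    have "w \<in> V" "cmod (f w - a) = exp (Re (g w))" using that e(2) g(2)[OF that] by auto
    then show ?thesis using V(2) by (simp add: tract_potential_def ln_div)
  qed
  moreover have "(\<lambda>w. of_real (ln \<rho>) - g w) holomorphic_on ball z e"
    by (intro holomorphic_intros g)
  ultimately show "\<exists>e>0. \<exists>h. h holomorphic_on ball z e \<and> (\<forall>w\<in>ball z e. tract_potential f a \<rho> V w = Re (h w))"
    using e(1) by blast
qed

text \<open>For \<open>P\<close> with \<open>u \<le> Re P \<le> u + 1\<close> on a circle, \<open>(f - a) * exp P\<close> is bounded there by \<open>e * M\<close>, since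
  \<open>cmod (f - a) * exp u\<close> is the constant \<open>\<rho>\<close> inside the tract. The maximum principle bounds \<open>Re P\<close> at the
  centre and the Harnack inequality elsewhere; no Jensen formula is needed.\<close>
lemma tract_potential_growth:
  assumes f: "f holomorphic_on UNIV" and t: "omitting_tract f a \<rho> V"
    and c: "f c \<noteq> a" and s: "s > 0" and z: "z \<in> cball c s"
    and M: "\<rho> \<le> M" "\<And>z. z \<in> sphere c (2 * s) \<Longrightarrow> cmod (f z - a) \<le> M"
  shows "tract_potential f a \<rho> V z \<le> 3 * (1 + ln (M / cmod (f c - a)))"
proof -
  define u where "u = tract_potential f a \<rho> V"
  have u: "pos_harmonic u" unfolding u_def by (rule pos_harmonic_tract_potential[OF f t])
  have \<rho>: "\<rho> > 0" using t by (simp add: omitting_tract_def)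
  have cu: "continuous_on A u" for A using u unfolding pos_harmonic_def by (auto intro: continuous_on_subset)
  have fu: "cmod (f z - a) * exp (u z) \<le> max \<rho> (cmod (f z - a))" for z
    using t by (auto simp: u_def tract_potential_def omitting_tract_def)
  have s2: "2 * s > 0" using s by simp
  obtain P where P: "P holomorphic_on UNIV" "\<And>z. z \<in> sphere c (2 * s) \<Longrightarrow> \<bar>u z - Re (P z)\<bar> < 1/4"
    using Re_poly_approx_sphere[OF cu s2, of "1/4"] by auto
  \<comment> \<open>\<open>P1\<close> dominates \<open>u\<close> on the circle, so its real part is
    nonnegative on the disk; the further \<open>1/4\<close> in \<open>Q\<close> makes it strictly
    positive, as the Harnack inequality demands.\<close>
  define P1 where "P1 = (\<lambda>z. P z + 1/4)"
  define Q where "Q = (\<lambda>z. P z + 1/2)"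
  have P1: "P1 holomorphic_on UNIV" and Q: "Q holomorphic_on UNIV"
    unfolding Q_def P1_def by (intro holomorphic_intros P)+
  have le: "u w \<le> Re (P1 w)" "Re (Q w) \<le> u w + 1" if "w \<in> sphere c (2 * s)" for w
    using P(2)[OF that] unfolding Q_def P1_def by (simp_all; linarith)+
  have in2: "u w \<le> Re (P1 w)" "0 \<le> Re (P1 w)" if "w \<in> cball c (2 * s)" for w
    using pos_harmonic_le_Re_sphere[OF u P1 s2 le(1) that] by auto
  have QP: "Re (Q w) = Re (P1 w) + 1/4" for w by (simp add: Q_def P1_def)
  have "u z \<le> Re (Q z)" using in2(1)[of z] z s QP[of z] by auto
  also have "\<dots> \<le> 3 * Re (Q c)"
  proof (rule Harnack_Re[OF Q s _ z])
    show "0 < Re (Q w)" if "w \<in> ball c (2 * s)" for w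
      using in2(2)[of w] that QP[of w] by auto
  qed
  also have "Re (Q c) \<le> 1 + ln (M / cmod (f c - a))"
  proof -
    have "norm ((f c - a) * exp (Q c)) \<le> exp 1 * M"
    proof (rule maximum_modulus_frontier[where f = "\<lambda>z. (f z - a) * exp (Q z)" and S = "cball c (2 * s)" and B = "exp 1 * M"])
      show "(\<lambda>z. (f z - a) * exp (Q z)) holomorphic_on interior (cball c (2 * s))"
        by (intro holomorphic_intros holomorphic_on_subset[OF f] holomorphic_on_subset[OF Q]) auto
      show "continuous_on (closure (cball c (2 * s))) (\<lambda>z. (f z - a) * exp (Q z))"
        by (intro continuous_intros holomorphic_on_imp_continuous_on holomorphic_on_subset[OF f] holomorphic_on_subset[OF Q]) auto
      fix w assume "w \<in> frontier (cball c (2 * s))"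
      then have w: "w \<in> sphere c (2 * s)" using s by simp
      have "norm ((f w - a) * exp (Q w)) \<le> cmod (f w - a) * exp (u w + 1)"
        using le(2)[OF w] by (simp add: norm_mult mult_left_mono)
      also have "\<dots> \<le> exp 1 * max \<rho> (cmod (f w - a))"
        using fu[of w] by (simp add: exp_add mult.commute)
      also have "\<dots> \<le> exp 1 * M"
        using M(1) M(2)[OF w] by simp
      finally show "norm ((f w - a) * exp (Q w)) \<le> exp 1 * M" .
    qed (use s in auto)
    then have "cmod (f c - a) * exp (Re (Q c)) \<le> exp 1 * M"
      by (simp only: norm_mult norm_exp_eq_Re)
    then have "exp (Re (Q c)) \<le> exp 1 * (M / cmod (f c - a))"
      using c by (simp add: pos_le_divide_eq mult.commute)
    also have "\<dots> = exp (1 + ln (M / cmod (f c - a)))"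
      using c M(1) \<rho> by (simp add: exp_add)
    finally show ?thesis by simp
  qed
  finally show ?thesis by (simp add: u_def)
qed

section \<open>Areas and Lipschitz maps\<close>

lemma measure_ball_complex:
  fixes c :: complex
  assumes "0 \<le> r"
  shows "measure lebesgue (ball c r) = pi * r\<^sup>2"
  using content_ball[OF assms, of c] by (simp add: unit_ball_vol_2)

text \<open>Cover the preimage by countably many disjoint balls (Vitali); the Lipschitz image of what is left is negligible.\<close>
lemma measure_le_Lipschitz_preimage:
  fixes g :: "complex \<Rightarrow> complex"
  assumes lip: "\<And>x y. x \<in> T \<Longrightarrow> y \<in> T \<Longrightarrow> dist (g x) (g y) \<le> K * dist x y" and K: "K > 0"
    and T: "T \<subseteq> T'" "T' \<in> lmeasurable" and S: "S \<subseteq> g ` T" "S \<in> lmeasurable"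
  shows "measure lebesgue S \<le> K\<^sup>2 * measure lebesgue T'"
proof (rule field_le_epsilon)
  fix e :: real assume e: "e > 0"
  define d where "d = e / K\<^sup>2"
  have d: "d > 0" using e K by (simp add: d_def)
  obtain U where U: "open U" "T' \<subseteq> U" "U - T' \<in> lmeasurable" "emeasure lebesgue (U - T') < ennreal d"
    by (rule sets_lebesgue_outer_open[OF fmeasurableD[OF T(2)] d])
  have "T' \<union> (U - T') = U" using U(2) by auto
  then have Um: "U \<in> lmeasurable"
    using fmeasurable.Un[OF T(2) U(3)] by simp
  have "measure lebesgue (U - T') < d"
    using U(3,4) by (simp add: emeasure_eq_measure2 ennreal_less_iff)
  moreover have "measure lebesgue U \<le> measure lebesgue T' + measure lebesgue (U - T')"
    using measure_Un_le[of T' lebesgue "U - T'"] U(2,3) T(2) by (simp add: Un_absorb1 fmeasurableD)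
  ultimately have mU: "measure lebesgue U \<le> measure lebesgue T' + d" by simp
  \<comment> \<open>All balls lie in \<open>U\<close>, whose measure exceeds that of
    \<open>T'\<close> by less than \<open>d\<close>, so disjoint ones have total area at most that
    of \<open>U\<close>. Their centres lie in \<open>T\<close>, where the Lipschitz bound
    holds.\<close>
  define I where "I = {(x, r). x \<in> T \<and> 0 < r \<and> ball x r \<subseteq> U}"
  obtain C where C: "countable C" "C \<subseteq> I"
     "pairwise (\<lambda>i j. disjnt (ball (fst i) (snd i)) (ball (fst j) (snd j))) C"
     "negligible (T - (\<Union>i\<in>C. ball (fst i) (snd i)))"
  proof (rule Vitali_covering_theorem_balls[of T I fst snd])
    fix x and s :: real assume x: "x \<in> T" and s: "0 < s"
    then obtain r where "r > 0" "ball x r \<subseteq> U" using U T by (meson openE subsetD)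
    then show "\<exists>i. i \<in> I \<and> x \<in> ball (fst i) (snd i) \<and> snd i < s"
      using x s by (intro exI[of _ "(x, min r (s/2))"]) (auto simp: I_def)
  qed blast
  define N where "N = T - (\<Union>i\<in>C. ball (fst i) (snd i))"
  define B where "B = (\<lambda>i. ball (g (fst i)) (K * snd i))"
  have I: "fst i \<in> T" "0 < snd i" "ball (fst i) (snd i) \<subseteq> U" if "i \<in> C" for i
  proof -
    have "i \<in> I" using that C(2) by blast
    then show "fst i \<in> T" "0 < snd i" "ball (fst i) (snd i) \<subseteq> U" by (auto simp: I_def case_prod_beta)
  qed
  have negN: "negligible (g ` N)"
  proof (rule negligible_locally_Lipschitz_image)
    show "negligible N" using C by (simp add: N_def)
    show "\<exists>T B. open T \<and> x \<in> T \<and> (\<forall>y\<in>N \<inter> T. norm (g y - g x) \<le> B * norm (y - x))" if "x \<in> N" for x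
      using lip[of _ x] that by (intro exI[of _ UNIV] exI[of _ K]) (auto simp: N_def dist_norm)
  qed simp
  have bound: "measure lebesgue (\<Union>i\<in>I'. B i) \<le> K\<^sup>2 * measure lebesgue U" if I': "I' \<subseteq> C" "finite I'" for I'
  proof -
    have "measure lebesgue (\<Union>i\<in>I'. B i) \<le> (\<Sum>i\<in>I'. measure lebesgue (B i))"
      using I'(2) by (intro measure_UNION_le) (auto simp: B_def)
    also have "\<dots> = K\<^sup>2 * (\<Sum>i\<in>I'. measure lebesgue (ball (fst i) (snd i)))"
      unfolding sum_distrib_left
    proof (rule sum.cong[OF refl])
      fix i assume "i \<in> I'"
      then have "0 < snd i" using I I' by blast
      then show "measure lebesgue (B i) = K\<^sup>2 * measure lebesgue (ball (fst i) (snd i))"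
        using K unfolding B_def by (subst (1 2) measure_ball_complex) (auto simp: power_mult_distrib)
    qed
    also have "(\<Sum>i\<in>I'. measure lebesgue (ball (fst i) (snd i))) = measure lebesgue (\<Union>i\<in>I'. ball (fst i) (snd i))"
    proof (rule measure_negligible_finite_Union_image[symmetric])
      show "pairwise (\<lambda>x y. negligible (ball (fst x) (snd x) \<inter> ball (fst y) (snd y))) I'"
        using C(3) I'(1) unfolding pairwise_def disjnt_def by (metis negligible_empty subsetD)
    qed (use I' in auto)
    also have "\<dots> \<le> measure lebesgue U"
    proof (rule measure_mono_fmeasurable)
      show "(\<Union>i\<in>I'. ball (fst i) (snd i)) \<subseteq> U" using I(3) I'(1) by (meson UN_least subsetD)
    qed (use I' Um in auto)
    finally show ?thesis using K by (simp add: mult_left_mono)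
  qed
  have Bm: "(\<Union>i\<in>C. B i) \<in> lmeasurable"
    by (rule fmeasurable_UN_bound[OF C(1) _ bound]) (auto simp: B_def)
  have Bb: "measure lebesgue (\<Union>i\<in>C. B i) \<le> K\<^sup>2 * measure lebesgue U"
    by (rule measure_UN_bound[OF C(1) _ bound]) (auto simp: B_def)
  have sub: "S \<subseteq> (\<Union>i\<in>C. B i) \<union> g ` N"
  proof
    fix y assume "y \<in> S"
    then obtain x where x: "x \<in> T" "y = g x" using S by blast
    show "y \<in> (\<Union>i\<in>C. B i) \<union> g ` N"
    proof (cases "x \<in> N")
      case False
      then obtain i where i: "i \<in> C" "x \<in> ball (fst i) (snd i)" using x by (auto simp: N_def)
      have "dist (g (fst i)) (g x) \<le> K * dist (fst i) x" using lip I(1)[OF i(1)] x by blast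
      also have "\<dots> < K * snd i" using i K by simp
      finally show ?thesis using i x by (auto simp: B_def)
    qed (use x in auto)
  qed
  have gN: "g ` N \<in> lmeasurable" "measure lebesgue (g ` N) = 0"
    using negN by (auto simp: negligible_iff_measure)
  have "measure lebesgue S \<le> measure lebesgue ((\<Union>i\<in>C. B i) \<union> g ` N)"
    using S sub Bm gN by (intro measure_mono_fmeasurable) auto
  also have "\<dots> \<le> K\<^sup>2 * measure lebesgue U"
    using measure_Un_le[of "\<Union>i\<in>C. B i" lebesgue "g ` N"] Bm Bb gN by (simp add: fmeasurableD)
  also have "\<dots> \<le> K\<^sup>2 * (measure lebesgue T' + d)"
    using mU by (intro mult_left_mono) auto
  also have "\<dots> = K\<^sup>2 * measure lebesgue T' + e"
    using K by (simp add: d_def distrib_left)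
  finally show "measure lebesgue S \<le> K\<^sup>2 * measure lebesgue T' + e" .
qed

section \<open>Plane area from the lengths of vertical slices, and halving at the centre of a thin
  disk\<close>

lemma lborel_complex_eq:
  "(lborel :: complex measure) = distr (lborel \<Otimes>\<^sub>M lborel) borel (\<lambda>(x, y). Complex x y)"
proof (rule lborel_eqI)
  have meas: "(\<lambda>(x, y). Complex x y) \<in> borel_measurable (lborel \<Otimes>\<^sub>M (lborel :: real measure))"
    unfolding lborel_prod case_prod_beta' Complex_eq
    by (simp, intro borel_measurable_continuous_onI continuous_intros)
  fix l u :: complex
  assume lu: "\<And>b. b \<in> Basis \<Longrightarrow> l \<bullet> b \<le> u \<bullet> b"
  have le: "Re l \<le> Re u" "Im l \<le> Im u"
    using lu[of 1] lu[of \<i>] by (auto simp: Basis_complex_def inner_complex_def)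
  have vim: "(\<lambda>(x, y). Complex x y) -` box l u \<inter> space (lborel \<Otimes>\<^sub>M lborel) = {Re l<..<Re u} \<times> {Im l<..<Im u}"
    by (auto simp: box_def Basis_complex_def inner_complex_def space_pair_measure)
  show "emeasure (distr (lborel \<Otimes>\<^sub>M lborel) borel (\<lambda>(x, y). Complex x y)) (box l u) = (\<Prod>b\<in>Basis. (u - l) \<bullet> b)"
    using le by (subst emeasure_distr[OF meas])
      (auto simp: vim lborel.emeasure_pair_measure_Times Basis_complex_def inner_complex_def ennreal_mult)
qed simp

lemma measure_ge_by_slices:
  fixes S :: "complex set"
  assumes S: "S \<in> sets borel" "bounded S" and ab: "a \<le> b" and \<delta>: "0 \<le> \<delta>"
    and sl: "\<And>t. t \<in> {a..<b} \<Longrightarrow> \<delta> \<le> measure lebesgue {s. Complex t s \<in> S}"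
  shows "\<delta> * (b - a) \<le> measure lebesgue S"
proof -
  have meas: "(\<lambda>(x, y). Complex x y) \<in> borel_measurable (lborel \<Otimes>\<^sub>M (lborel :: real measure))"
    unfolding lborel_prod case_prod_beta' Complex_eq
    by (simp, intro borel_measurable_continuous_onI continuous_intros)
  define X where "X = (\<lambda>(x, y). Complex x y) -` S \<inter> space (lborel \<Otimes>\<^sub>M lborel)"
  have X: "X \<in> sets (lborel \<Otimes>\<^sub>M lborel)"
    unfolding X_def by (rule measurable_sets[OF meas]) (use S in simp)
  have slice: "Pair t -` X = {s. Complex t s \<in> S}" for t
    by (auto simp: X_def space_pair_measure)
  have slm: "{s. Complex t s \<in> S} \<in> sets borel" for t
    using sets_Pair1[OF X, of t] slice by simp
  obtain R where R: "\<And>z. z \<in> S \<Longrightarrow> norm z \<le> R" using S(2) bounded_iff by blast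
  have slf: "{s. Complex t s \<in> S} \<in> lmeasurable" for t
  proof (rule bounded_set_imp_lmeasurable)
    show "bounded {s. Complex t s \<in> S}"
      by (rule boundedI[of _ R]) (use R abs_Im_le_cmod order_trans in fastforce)
    show "{s. Complex t s \<in> S} \<in> sets lebesgue" using slm by simp
  qed
  have "ennreal (\<delta> * (b - a)) = (\<integral>\<^sup>+t. ennreal \<delta> * indicator {a..<b} t \<partial>lborel)"
    using ab \<delta> by (simp add: nn_integral_cmult_indicator ennreal_mult)
  also have "\<dots> \<le> (\<integral>\<^sup>+t. emeasure lborel (Pair t -` X) \<partial>lborel)"
  proof (rule nn_integral_mono)
    fix t :: real
    have em: "ennreal (measure lebesgue {s. Complex t s \<in> S}) = emeasure lborel (Pair t -` X)"
      using emeasure_eq_measure2[OF slf[of t]] slm[of t] by (simp add: slice)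
    then show "ennreal \<delta> * indicator {a..<b} t \<le> emeasure lborel (Pair t -` X)"
      using sl[of t] by (auto simp: indicator_def ennreal_leI simp flip: em)
  qed
  also have "\<dots> = emeasure (lborel \<Otimes>\<^sub>M lborel) X"
    by (rule lborel.emeasure_pair_measure_alt[OF X, symmetric])
  also have "\<dots> = emeasure lborel S"
    unfolding lborel_complex_eq X_def using S meas by (subst emeasure_distr) auto
  also have "\<dots> = ennreal (measure lebesgue S)"
  proof -
    have "S \<in> lmeasurable" using S by (intro bounded_set_imp_lmeasurable) auto
    then show ?thesis using emeasure_eq_measure2[of S lebesgue] S by simp
  qed
  finally show ?thesis by (simp add: ennreal_le_iff)
qed

text \<open>With \<open>d = x - y\<close>, the remainder of \<open>exp d\<close> after
  \<open>1 + d\<close> is at most \<open>3/2 * (norm d)\<^sup>2\<close>, hence at most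
  \<open>3/4 * norm d\<close>; a quarter of \<open>norm d\<close> is left for
  \<open>exp d - 1\<close>.\<close>

lemma exp_dist_lower:
  fixes x y :: complex
  assumes "norm (x - y) \<le> 1/2" "\<bar>Re (x - y)\<bar> \<le> 1/4"
  shows "exp (Re y) * norm (x - y) / 4 \<le> norm (exp x - exp y)"
proof -
  define d where "d = x - y"
  have "norm (exp d - (1 + d)) \<le> exp \<bar>Re d\<bar> * norm d ^ 2"
    using Taylor_exp[of d 1] by (simp add: numeral_2_eq_2 power2_eq_square)
  also have "\<dots> \<le> (1 + 2 * (1/4)) * norm d ^ 2"
  proof (intro mult_right_mono)
    have "exp \<bar>Re d\<bar> \<le> exp (1/4)" using assms(2) unfolding d_def by auto
    also have "\<dots> \<le> 1 + 2 * (1/4::real)" using exp_bound[of "1/4::real"] by (simp add: power2_eq_square)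
    finally show "exp \<bar>Re d\<bar> \<le> 1 + 2 * (1/4)" .
  qed auto
  also have "\<dots> = 3/2 * norm d * norm d" by (simp add: power2_eq_square)
  also have "\<dots> \<le> 3/2 * (1/2) * norm d"
    using assms by (intro mult_right_mono mult_left_mono) (auto simp: d_def)
  finally have 1: "norm (exp d - (1 + d)) \<le> 3/4 * norm d" by simp
  have "norm d = norm ((exp d - 1) - (exp d - (1 + d)))" by (simp add: algebra_simps)
  also have "\<dots> \<le> norm (exp d - 1) + norm (exp d - (1 + d))" by (rule norm_triangle_ineq4)
  finally have 2: "norm d / 4 \<le> norm (exp d - 1)" using 1 by simp
  have "exp x - exp y = exp y * (exp d - 1)"
    by (simp add: d_def exp_diff field_simps)
  then have "norm (exp x - exp y) = exp (Re y) * norm (exp d - 1)" by (simp add: norm_mult)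
  then show ?thesis using 2 by (simp add: d_def mult_left_mono)
qed

text \<open>On the circle \<open>v\<close> is at most \<open>M\<close>, and it vanishes off the set
  in question. By the sub-mean value property \<open>2 * pi * v p\<close> is at most
  \<open>M\<close> times the measure of this set of angles, so \<open>v p > M / 2\<close> forces at
  least half of the circle.\<close>

lemma pos_harmonic_slice:
  assumes v: "pos_harmonic v" and r: "r > 0" and M: "\<And>z. z \<in> sphere p r \<Longrightarrow> v z \<le> M"
    and big: "M / 2 < v p"
  shows "pi \<le> measure lebesgue {s \<in> {0..2*pi}. 0 < v (p + of_real r * cis s)}"
proof -
  define A where "A = {s \<in> {0..2*pi}. 0 < v (p + of_real r * cis s)}"
  have cv: "continuous_on UNIV v" using v by (simp add: pos_harmonic_def)
  have cvs: "continuous_on B (\<lambda>s. v (p + of_real r * cis s))" for B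
    by (intro continuous_on_compose2[OF cv] continuous_intros) auto
  have "A = {0..2*pi} \<inter> {s. 0 < v (p + of_real r * cis s)}" by (auto simp: A_def)
  moreover have "open {s. 0 < v (p + of_real r * cis s)}"
    by (intro open_Collect_less continuous_intros cvs)
  ultimately have "A \<in> sets borel" by auto
  moreover have "bounded A" by (rule bounded_subset[OF bounded_closed_interval]) (auto simp: A_def)
  ultimately have Am: "A \<in> lmeasurable" by (intro bounded_set_imp_lmeasurable) auto
  have vM: "v (p + of_real r * cis s) \<le> M" for s
    using r by (intro M) (simp add: dist_norm norm_mult)
  have v0: "0 \<le> v z" for z using v by (simp add: pos_harmonic_def)
  have M0: "0 \<le> M" using v0 vM order_trans by blast
  have "2 * pi * v p \<le> integral {0..2*pi} (\<lambda>s. v (p + of_real r * cis s))"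
    by (rule pos_harmonic_submean[OF v r])
  also have "\<dots> \<le> integral {0..2*pi} (\<lambda>s. M * indicator A s)"
  proof (rule integral_le)
    show "(\<lambda>s. v (p + of_real r * cis s)) integrable_on {0..2*pi}"
      by (intro integrable_continuous_real cvs)
    have "A \<inter> {0..2*pi} = A" by (auto simp: A_def)
    then have "(indicat_real A) integrable_on {0..2*pi}"
      using Am by (metis integrable_integral integrable_on_indicator)
    then show "(\<lambda>s. M * indicator A s) integrable_on {0..2*pi}"
      by (intro integrable_on_mult_right)
    show "v (p + of_real r * cis s) \<le> M * indicator A s" if "s \<in> {0..2*pi}" for s
      using that vM[of s] v0[of "p + of_real r * cis s"] by (auto simp: A_def indicator_def)
  qed
  also have "\<dots> = M * measure lebesgue A"
  proof -
    have "A \<inter> {0..2*pi} = A" by (auto simp: A_def)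
    then show ?thesis using Am by (simp add: integral_indicator)
  qed
  finally have le: "2 * pi * v p \<le> M * measure lebesgue A" .
  show ?thesis
  proof (rule ccontr)
    assume "\<not> ?thesis"
    then have "measure lebesgue A \<le> pi" by (simp add: A_def)
    then have "M * measure lebesgue A \<le> M * pi" using M0 by (intro mult_left_mono)
    then have "pi * (2 * v p) \<le> pi * M" using le by (simp only: mult_ac)
    then have "2 * v p \<le> M" by (rule mult_left_le_imp_le) simp
    then show False using big by simp
  qed
qed

text \<open>The logarithmic polar coordinates \<open>p + exp \<eta>\<close> are bi-Lipschitz on rectangles of size \<open>1/4 \<times> pi/16\<close>;
  32 of these make up a full annulus.\<close>
lemma pos_harmonic_half:
  assumes v: "pos_harmonic v" and \<tau>: "\<tau> > 0" and M: "\<And>z. z \<in> ball p \<tau> \<Longrightarrow> v z \<le> M"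
    and small: "measure lebesgue {z \<in> ball p \<tau>. 0 < v z} \<le> \<tau>\<^sup>2 / 4096"
  shows "v p \<le> M / 2"
proof (rule ccontr)
  assume "\<not> v p \<le> M / 2"
  then have big: "M / 2 < v p" by simp
  have cv: "continuous_on UNIV v" using v by (simp add: pos_harmonic_def)
  define T where "T = {z \<in> ball p \<tau>. 0 < v z}"
  have "T = ball p \<tau> \<inter> {z. 0 < v z}" by (auto simp: T_def)
  moreover have "open {z. 0 < v z}" by (intro open_Collect_less continuous_intros cv)
  ultimately have oT: "open T" by (metis open_Int open_ball)
  have "bounded T" by (rule bounded_subset[OF bounded_ball]) (auto simp: T_def)
  then have Tm: "T \<in> lmeasurable"
    using oT by (intro bounded_set_imp_lmeasurable) auto
  define a where "a = ln \<tau> - 1/4"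
  define E where "E = (\<lambda>\<eta>. p + exp \<eta>)"
  define S where "S = {\<eta>. Re \<eta> \<in> {a..<ln \<tau>} \<and> Im \<eta> \<in> {0..2*pi} \<and> 0 < v (E \<eta>)}"
  have expa: "exp a \<ge> \<tau> / 2"
  proof -
    have "exp (1/4) \<le> (2::real)" using exp_bound_half[of "1/4::real"] by simp
    then have "\<tau> / 2 \<le> \<tau> / exp (1/4)" using \<tau> by (intro divide_left_mono) auto
    then show ?thesis using \<tau> by (simp add: a_def exp_diff)
  qed
  have cE: "continuous_on UNIV E" unfolding E_def by (intro continuous_intros)
  have S_eq: "S = (Re -` {a..<ln \<tau>} \<inter> Im -` {0..2*pi}) \<inter> {\<eta>. 0 < v (E \<eta>)}" by (auto simp: S_def)
  have "open {\<eta>. 0 < v (E \<eta>)}"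
    by (intro open_Collect_less continuous_intros continuous_on_compose2[OF cv cE]) auto
  moreover have "Re -` {a..<ln \<tau>} \<in> sets borel" "Im -` {0..2*pi} \<in> sets borel"
    using measurable_sets[of Re borel borel "{a..<ln \<tau>}"] measurable_sets[of Im borel borel "{0..2*pi}"] by auto
  ultimately have Sb: "S \<in> sets borel" unfolding S_eq by auto
  have Sbd: "bounded S"
  proof (rule boundedI)
    fix \<eta> assume "\<eta> \<in> S"
    then have "\<bar>Re \<eta>\<bar> \<le> \<bar>a\<bar> + \<bar>ln \<tau>\<bar>" "\<bar>Im \<eta>\<bar> \<le> 2 * pi" by (auto simp: S_def)
    then show "norm \<eta> \<le> (\<bar>a\<bar> + \<bar>ln \<tau>\<bar>) + 2 * pi" using cmod_le[of \<eta>] by linarith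
  qed
  have "pi * (ln \<tau> - a) \<le> measure lebesgue S"
  proof (rule measure_ge_by_slices[OF Sb Sbd])
    fix t assume t: "t \<in> {a..<ln \<tau>}"
    have "exp t < \<tau>" using t \<tau> by (metis atLeastLessThan_iff exp_less_mono exp_ln)
    then have sp: "v z \<le> M" if "z \<in> sphere p (exp t)" for z using that by (intro M) auto
    have "{s. Complex t s \<in> S} = {s \<in> {0..2*pi}. 0 < v (p + of_real (exp t) * cis s)}"
      using t by (auto simp: S_def E_def Complex_eq exp_add cis_conv_exp exp_of_real)
    then show "pi \<le> measure lebesgue {s. Complex t s \<in> S}"
      using pos_harmonic_slice[OF v _ sp big] by simp
  qed (auto simp: a_def)
  then have Sbig: "pi / 4 \<le> measure lebesgue S" by (simp add: a_def)
  define Sj where "Sj = (\<lambda>j::nat. S \<inter> Im -` {real j * pi / 16..real (Suc j) * pi / 16})"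
  have Sjb: "Sj j \<in> sets borel" for j
    unfolding Sj_def using Sb measurable_sets[of Im borel borel] by auto
  have Sjm: "Sj j \<in> lmeasurable" for j
    using Sjb Sbd by (intro bounded_set_imp_lmeasurable) (auto simp: Sj_def bounded_Int)
  have close: "norm (x - y) \<le> 1/2" "\<bar>Re (x - y)\<bar> \<le> 1/4" if "x \<in> Sj j" "y \<in> Sj j" for x y j
  proof -
    have "ln \<tau> - 1/4 \<le> Re x" "Re x < ln \<tau>" "ln \<tau> - 1/4 \<le> Re y" "Re y < ln \<tau>"
      using that by (auto simp: Sj_def S_def a_def)
    then show r: "\<bar>Re (x - y)\<bar> \<le> 1/4" by (simp only: minus_complex.sel)
    have "real j * pi / 16 \<le> Im x" "Im x \<le> real j * pi / 16 + pi / 16"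
      "real j * pi / 16 \<le> Im y" "Im y \<le> real j * pi / 16 + pi / 16"
      using that by (auto simp: Sj_def field_simps)
    then have "\<bar>Im (x - y)\<bar> \<le> pi / 16" by (simp only: minus_complex.sel)
    also have "\<dots> \<le> 1/4" using pi_less_4 by simp
    finally show "norm (x - y) \<le> 1/2" using r cmod_le[of "x - y"] by simp
  qed
  have low: "\<tau> / 8 * dist x y \<le> dist (E x) (E y)" if "x \<in> Sj j" "y \<in> Sj j" for x y j
  proof -
    have "a \<le> Re y" using that by (auto simp: Sj_def S_def)
    then have "\<tau> / 2 \<le> exp (Re y)" using expa by (meson exp_le_cancel_iff order_trans)
    then have "\<tau> / 2 * norm (x - y) / 4 \<le> exp (Re y) * norm (x - y) / 4"
      by (intro divide_right_mono mult_right_mono) auto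
    also have "\<dots> \<le> norm (exp x - exp y)" by (rule exp_dist_lower[OF close[OF that]])
    finally show ?thesis by (simp add: E_def dist_norm)
  qed
  \<comment> \<open>On a piece \<open>E\<close> multiplies distances by at least
    \<open>\<tau> / 8\<close>, so its area is at most
    \<open>(8 / \<tau>)\<^sup>2 * (\<tau>\<^sup>2 / 4096) = 1/64\<close>. The 32 pieces together
    have area at most \<open>1/2\<close>, below the lower bound \<open>pi / 4\<close> from the
    slices; this fixes the constant 4096.\<close>
  have Sj_le: "measure lebesgue (Sj j) \<le> 1/64" for j
  proof -
    have inj: "inj_on E (Sj j)"
    proof (rule inj_onI)
      fix x y assume "x \<in> Sj j" "y \<in> Sj j" "E x = E y"
      then have "\<tau> / 8 * dist x y \<le> 0" using low by fastforce
      then show "x = y" using \<tau> by (simp add: mult_le_0_iff)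
    qed
    have "measure lebesgue (Sj j) \<le> (8 / \<tau>)\<^sup>2 * measure lebesgue T"
    proof (rule measure_le_Lipschitz_preimage[where g = "the_inv_into (Sj j) E" and T = "E ` Sj j"])
      fix x y assume "x \<in> E ` Sj j" "y \<in> E ` Sj j"
      then obtain x' y' where xy: "x' \<in> Sj j" "y' \<in> Sj j" "x = E x'" "y = E y'" by blast
      have "dist x' y' \<le> 8 / \<tau> * dist (E x') (E y')"
        using low[OF xy(1,2)] \<tau> by (simp add: field_simps)
      then show "dist (the_inv_into (Sj j) E x) (the_inv_into (Sj j) E y) \<le> 8 / \<tau> * dist x y"
        using xy by (simp add: the_inv_into_f_f[OF inj])
    next
      show "E ` Sj j \<subseteq> T"
      proof
        fix z assume "z \<in> E ` Sj j"
        then obtain x where x: "x \<in> Sj j" "z = E x" by blast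
        have "exp (Re x) < exp (ln \<tau>)" using x by (simp add: Sj_def S_def)
        then show "z \<in> T" using x \<tau> by (auto simp: T_def Sj_def S_def E_def dist_norm)
      qed
      show "Sj j \<subseteq> the_inv_into (Sj j) E ` E ` Sj j"
        using the_inv_into_onto[OF inj] by simp
    qed (use \<tau> Tm Sjm in auto)
    also have "\<dots> \<le> (8 / \<tau>)\<^sup>2 * (\<tau>\<^sup>2 / 4096)"
      using small by (intro mult_left_mono) (auto simp: T_def)
    also have "\<dots> = 1/64" using \<tau> by (simp add: power_divide)
    finally show ?thesis .
  qed
  have "S \<subseteq> (\<Union>j\<in>{..<32}. Sj j)"
  proof
    fix x assume x: "x \<in> S"
    define q where "q = Im x * 16 / pi"
    have q: "0 \<le> q" "q \<le> 32" using x by (auto simp: q_def S_def field_simps)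
    \<comment> \<open>The value \<open>q = 32\<close>, that is the angle \<open>2 * pi\<close>, is
      assigned to the last piece.\<close>
    define j where "j = (if q = 32 then 31 else nat \<lfloor>q\<rfloor>)"
    have j: "real j \<le> q" "q \<le> real (Suc j)" "j < 32"
      using q by (auto simp: j_def) linarith+
    have "Im x = q * pi / 16" by (simp add: q_def)
    then have "x \<in> Sj j" using x j by (auto simp: Sj_def divide_right_mono)
    then show "x \<in> (\<Union>j\<in>{..<32}. Sj j)" using j by auto
  qed
  then have "measure lebesgue S \<le> measure lebesgue (\<Union>j\<in>{..<32}. Sj j)"
    using Sb Sjm by (intro measure_mono_fmeasurable fmeasurable.finite_UN) auto
  also have "\<dots> \<le> (\<Sum>j<32. measure lebesgue (Sj j))"
    using Sjm by (intro measure_UNION_le) (auto simp: fmeasurableD)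
  also have "\<dots> \<le> (\<Sum>j<32::nat. 1/64)" by (intro sum_mono Sj_le)
  also have "\<dots> = 1/2" by simp
  finally show False using Sbig pi_gt3 by simp
qed

section \<open>Area of the tract in logarithmic coordinates\<close>

definition disk_sup :: "(complex \<Rightarrow> real) \<Rightarrow> real \<Rightarrow> real" where
  "disk_sup u s = Sup (u ` cball 0 (exp s))"

lemma disk_sup_upper:
  assumes "pos_harmonic u" "norm z \<le> exp s"
  shows "u z \<le> disk_sup u s"
proof -
  have "compact (u ` cball 0 (exp s))"
    using assms by (intro compact_continuous_image) (auto simp: pos_harmonic_def intro: continuous_on_subset)
  then have "bdd_above (u ` cball 0 (exp s))"
    by (intro bounded_imp_bdd_above compact_imp_bounded)
  then show ?thesis
    unfolding disk_sup_def using assms by (intro cSup_upper) auto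
qed

lemma disk_sup_least:
  assumes "\<And>z. norm z \<le> exp s \<Longrightarrow> u z \<le> K"
  shows "disk_sup u s \<le> K"
  unfolding disk_sup_def by (rule cSup_least) (use assms in auto)

lemma disk_sup_mono:
  assumes "pos_harmonic u" "s \<le> t"
  shows "disk_sup u s \<le> disk_sup u t"
proof (rule disk_sup_least)
  fix z :: complex assume "norm z \<le> exp s"
  then show "u z \<le> disk_sup u t" using assms by (intro disk_sup_upper) (auto intro: order_trans)
qed

lemma exists_log_in_strip:
  assumes "z \<noteq> 0"
  obtains p where "exp p = z" "y \<le> Im p" "Im p \<le> y + 2 * pi"
proof -
  define k where "k = \<lceil>(y - Im (Ln z)) / (2 * pi)\<rceil>"
  define p where "p = Ln z + of_int k * (2 * pi) * \<i>"
  have "exp p = exp (Ln z)" unfolding exp_eq by (intro exI[of _ k]) (simp add: p_def)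
  then have "exp p = z" using assms by simp
  moreover have "(y - Im (Ln z)) / (2 * pi) \<le> of_int k" "of_int k \<le> (y - Im (Ln z)) / (2 * pi) + 1"
    unfolding k_def by linarith+
  then have "y - Im (Ln z) \<le> of_int k * (2 * pi)" "of_int k * (2 * pi) \<le> y - Im (Ln z) + 2 * pi"
    by (auto simp: field_simps)
  then have "y \<le> Im p" "Im p \<le> y + 2 * pi" by (auto simp: p_def)
  ultimately show ?thesis using that by blast
qed

text \<open>The height 10 exceeds \<open>2 * pi + 1\<close>, so every point of modulus \<open>exp x\<close> has a logarithm whose disk of radius
  \<open>1 / 2\<close> has its imaginary parts in \<open>{y..y + 10}\<close>.\<close>
definition log_strip :: "(complex \<Rightarrow> real) \<Rightarrow> real \<Rightarrow> real \<Rightarrow> real \<Rightarrow> complex set" where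
  "log_strip u s t y = {\<zeta>. 0 < u (exp \<zeta>) \<and> Re \<zeta> \<in> {s..<t} \<and> Im \<zeta> \<in> {y..y + 10}}"

lemma log_strip_measurable:
  assumes u: "pos_harmonic u"
  shows "log_strip u s t y \<in> lmeasurable" "log_strip u s t y \<in> sets borel"
proof -
  have cu: "continuous_on UNIV u" using u by (simp add: pos_harmonic_def)
  have "open {\<zeta>. 0 < u (exp \<zeta>)}"
    by (intro open_Collect_less continuous_intros continuous_on_compose2[OF cu]) auto
  moreover have "Re -` {s..<t} \<in> sets borel" "Im -` {y..y + 10} \<in> sets borel"
    using measurable_sets[of Re borel borel "{s..<t}"] measurable_sets[of Im borel borel "{y..y + 10}"] by auto
  moreover have eq: "log_strip u s t y = {\<zeta>. 0 < u (exp \<zeta>)} \<inter> (Re -` {s..<t} \<inter> Im -` {y..y + 10})"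
    by (auto simp: log_strip_def)
  ultimately show b: "log_strip u s t y \<in> sets borel" unfolding eq by (metis borel_open sets.Int)
  have "bounded (log_strip u s t y)"
  proof (rule boundedI)
    fix \<eta> assume "\<eta> \<in> log_strip u s t y"
    then have "\<bar>Re \<eta>\<bar> \<le> \<bar>s\<bar> + \<bar>t\<bar>" "\<bar>Im \<eta>\<bar> \<le> \<bar>y\<bar> + 10" by (auto simp: log_strip_def)
    then show "norm \<eta> \<le> (\<bar>s\<bar> + \<bar>t\<bar>) + (\<bar>y\<bar> + 10)" using cmod_le[of \<eta>] by linarith
  qed
  then show "log_strip u s t y \<in> lmeasurable" using b by (intro bounded_set_imp_lmeasurable) auto
qed

text \<open>The maximum of \<open>u\<close> over \<open>cball 0 (exp (s + l / 2))\<close> is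
  attained at some \<open>z\<close> on its boundary circle. A suitable logarithm of \<open>z\<close>
  is the centre of a disk of radius \<open>l / 2\<close> inside the strip, and thinness there makes
  \<open>u z\<close> at most half of the supremum at \<open>s + l\<close>. The constant is
  \<open>4 * 4096\<close> because the radius is \<open>l / 2\<close>.\<close>

lemma disk_sup_doubling:
  assumes u: "pos_harmonic u" and l: "0 < l" "l \<le> 1"
    and small: "measure lebesgue (log_strip u s (s + l) y) \<le> l\<^sup>2 / 16384"
  shows "2 * disk_sup u s \<le> disk_sup u (s + l)"
proof -
  have "0 < exp (s + l / 2)" by simp
  then obtain z where z: "z \<in> sphere 0 (exp (s + l / 2))" "\<And>w. w \<in> cball 0 (exp (s + l / 2)) \<Longrightarrow> u w \<le> u z"
    using pos_harmonic_max_sphere[OF u] by blast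
  have nz: "norm z = exp (s + l / 2)" using z by simp
  then have "z \<noteq> 0" by (metis exp_not_eq_zero norm_zero)
  then obtain p where p: "exp p = z" "y + 1 \<le> Im p" "Im p \<le> y + 1 + 2 * pi"
    using exists_log_in_strip by blast
  have Rep: "Re p = s + l / 2" using nz p(1) by (metis exp_inj_iff norm_exp_eq_Re)
  have U: "pos_harmonic (\<lambda>\<zeta>. u (exp \<zeta>))" by (intro pos_harmonic_compose[OF u] holomorphic_intros)
  have inball: "Re \<zeta> \<in> {s..<s + l}" "Im \<zeta> \<in> {y..y + 10}" if "\<zeta> \<in> ball p (l / 2)" for \<zeta>
  proof -
    have "\<bar>Re (p - \<zeta>)\<bar> < l / 2" "\<bar>Im (p - \<zeta>)\<bar> < l / 2"
      using that abs_Re_le_cmod[of "p - \<zeta>"] abs_Im_le_cmod[of "p - \<zeta>"] by (auto simp: dist_norm)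
    then have "Re p - Re \<zeta> < l / 2" "Re \<zeta> - Re p < l / 2" "Im p - Im \<zeta> < l / 2" "Im \<zeta> - Im p < l / 2"
      by (simp_all only: minus_complex.sel abs_less_iff) auto
    then show "Re \<zeta> \<in> {s..<s + l}" "Im \<zeta> \<in> {y..y + 10}"
      using Rep p(2,3) l pi_less_4 by auto
  qed
  have "u (exp p) \<le> disk_sup u (s + l) / 2"
  proof (rule pos_harmonic_half[OF U, of "l / 2"])
    show "u (exp \<zeta>) \<le> disk_sup u (s + l)" if "\<zeta> \<in> ball p (l / 2)" for \<zeta>
      using inball(1)[OF that] by (intro disk_sup_upper u) auto
    have "{\<zeta> \<in> ball p (l / 2). 0 < u (exp \<zeta>)} \<subseteq> log_strip u s (s + l) y"
      using inball by (auto simp: log_strip_def)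
    moreover have "open {\<zeta>. 0 < u (exp \<zeta>)}"
      using U by (intro open_Collect_less continuous_intros) (auto simp: pos_harmonic_def)
    then have "open (ball p (l / 2) \<inter> {\<zeta>. 0 < u (exp \<zeta>)})" by (intro open_Int open_ball)
    moreover have "ball p (l / 2) \<inter> {\<zeta>. 0 < u (exp \<zeta>)} = {\<zeta> \<in> ball p (l / 2). 0 < u (exp \<zeta>)}" by auto
    ultimately have "measure lebesgue {\<zeta> \<in> ball p (l / 2). 0 < u (exp \<zeta>)} \<le> measure lebesgue (log_strip u s (s + l) y)"
      using log_strip_measurable[OF u] by (intro measure_mono_fmeasurable) auto
    also have "\<dots> \<le> (l / 2)\<^sup>2 / 4096" using small by (simp add: power_divide)
    finally show "measure lebesgue {\<zeta> \<in> ball p (l / 2). 0 < u (exp \<zeta>)} \<le> (l / 2)\<^sup>2 / 4096" .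
  qed (use l in auto)
  moreover have "disk_sup u s \<le> u z"
  proof (rule disk_sup_least)
    fix w :: complex assume "norm w \<le> exp s"
    moreover have "exp s \<le> exp (s + l / 2)" using l by simp
    ultimately have "norm w \<le> exp (s + l / 2)" by (rule order_trans)
    then show "u w \<le> u z" by (intro z(2)) simp
  qed
  ultimately show ?thesis using p by simp
qed

text \<open>Cut \<open>[t1, t2)\<close> into \<open>N\<close> equal intervals. Either half of them carry area of order \<open>l\<^sup>2\<close>, or the
  supremum doubles on half of them.\<close>
lemma log_strip_area_or_growth:
  assumes u: "pos_harmonic u" and N: "N > 0" and l: "l = (t2 - t1) / real N" "0 < l" "l \<le> 1"
    and B: "disk_sup u t1 > 0" and growth: "disk_sup u t2 < 2 powr (real N / 2) * disk_sup u t1"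
  shows "(t2 - t1) * l / 32768 \<le> measure lebesgue (log_strip u t1 t2 y)"
proof -
  define I where "I = (\<lambda>j::nat. log_strip u (t1 + real j * l) (t1 + real (Suc j) * l) y)"
  \<comment> \<open>These are the thin intervals. Each doubles the supremum, so
    \<open>growth\<close> allows fewer than \<open>N / 2\<close> of them; every remaining one
    carries area above \<open>l\<^sup>2 / 16384\<close>, and keeping half of the intervals turns
    16384 into 32768.\<close>
  define G where "G = {j. j < N \<and> measure lebesgue (I j) \<le> l\<^sup>2 / 16384}"
  have step: "2 ^ card (G \<inter> {..<j}) * disk_sup u t1 \<le> disk_sup u (t1 + real j * l)" if "j \<le> N" for j
    using that
  proof (induction j)
    case (Suc j)
    have IH: "2 ^ card (G \<inter> {..<j}) * disk_sup u t1 \<le> disk_sup u (t1 + real j * l)" using Suc by simp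
    show ?case
    proof (cases "j \<in> G")
      case True
      then have "G \<inter> {..<Suc j} = insert j (G \<inter> {..<j})" by auto
      then have "card (G \<inter> {..<Suc j}) = Suc (card (G \<inter> {..<j}))" by simp
      moreover have e: "t1 + real j * l + l = t1 + real (Suc j) * l" by (simp add: algebra_simps)
      have "2 * disk_sup u (t1 + real j * l) \<le> disk_sup u (t1 + real j * l + l)"
        by (rule disk_sup_doubling[OF u l(2,3), of _ y]) (use True in \<open>simp add: G_def I_def algebra_simps\<close>)
      ultimately show ?thesis using IH unfolding e by simp
    next
      case False
      then have "G \<inter> {..<Suc j} = G \<inter> {..<j}" by (auto simp: less_Suc_eq)
      moreover have "disk_sup u (t1 + real j * l) \<le> disk_sup u (t1 + real (Suc j) * l)"
        using l(2) by (intro disk_sup_mono u) (simp add: distrib_right)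
      ultimately show ?thesis using IH by simp
    qed
  qed simp
  have GN: "G \<subseteq> {..<N}" by (auto simp: G_def)
  have t2: "t1 + real N * l = t2" using N l(1) by simp
  have "2 ^ card G * disk_sup u t1 \<le> disk_sup u t2"
    using step[of N] GN by (simp add: Int_absorb2 t2)
  then have "2 ^ card G * disk_sup u t1 < 2 powr (real N / 2) * disk_sup u t1" using growth by linarith
  then have "2 powr real (card G) < 2 powr (real N / 2)" using B by (simp add: powr_realpow)
  then have cG: "real (card G) < real N / 2" by simp
  define H where "H = {..<N} - G"
  have "card H = N - card G" using GN by (simp add: H_def card_Diff_subset finite_subset[OF GN])
  then have cH: "real N / 2 \<le> real (card H)" using cG by linarith
  have "real (card H) * (l\<^sup>2 / 16384) \<le> (\<Sum>j\<in>H. measure lebesgue (I j))"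
    by (rule sum_bounded_below) (auto simp: H_def G_def)
  also have "\<dots> = measure lebesgue (\<Union>j\<in>H. I j)"
  proof (rule measure_negligible_finite_Union_image[symmetric])
    show "pairwise (\<lambda>i j. negligible (I i \<inter> I j)) H"
    proof (rule pairwiseI)
      fix i j :: nat assume "i \<noteq> j"
      have "I i \<inter> I j = {}" if "i < j" for i j :: nat
      proof -
        have "real (Suc i) * l \<le> real j * l" using that l by (intro mult_right_mono) auto
        then show ?thesis by (auto simp: I_def log_strip_def)
      qed
      then show "negligible (I i \<inter> I j)" using \<open>i \<noteq> j\<close> by (metis Int_commute linorder_neqE_nat negligible_empty)
    qed
  qed (use u in \<open>auto simp: H_def I_def log_strip_measurable\<close>)
  also have "\<dots> \<le> measure lebesgue (log_strip u t1 t2 y)"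
  proof (rule measure_mono_fmeasurable)
    show "(\<Union>j\<in>H. I j) \<subseteq> log_strip u t1 t2 y"
    proof
      fix \<zeta> assume "\<zeta> \<in> (\<Union>j\<in>H. I j)"
      then obtain j where j: "j < N" "\<zeta> \<in> I j" by (auto simp: H_def)
      have "0 \<le> real j * l" "real (Suc j) * l \<le> real N * l" using j(1) l(2) by (auto intro!: mult_right_mono simp del: of_nat_Suc)
      then show "\<zeta> \<in> log_strip u t1 t2 y" using j t2 by (auto simp: I_def log_strip_def)
    qed
    show "(\<Union>j\<in>H. I j) \<in> sets lebesgue"
      using u by (auto simp: H_def I_def log_strip_measurable intro!: sets.finite_UN fmeasurableD)
  qed (rule log_strip_measurable[OF u])
  finally have "real (card H) * (l\<^sup>2 / 16384) \<le> measure lebesgue (log_strip u t1 t2 y)" .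
  moreover have "real N / 2 * (l\<^sup>2 / 16384) \<le> real (card H) * (l\<^sup>2 / 16384)"
    by (rule mult_right_mono[OF cH]) simp
  moreover have "real N / 2 * (l\<^sup>2 / 16384) = (t2 - t1) * l / 32768"
    using t2 by (simp add: power2_eq_square flip: t2)
  ultimately show ?thesis by linarith
qed

section \<open>Maximum modulus and consequences of the growth hypothesis\<close>

lemma norm_le_max_modulus:
  assumes f: "f holomorphic_on UNIV" and r: "norm z \<le> r"
  shows "norm (f z) \<le> max_modulus f r"
proof -
  have bdd: "norm (f w) \<le> max_modulus f (norm w)" for w
  proof -
    have "compact ((\<lambda>z. norm (f z)) ` sphere 0 (norm w))"
      using f by (intro compact_continuous_image continuous_intros holomorphic_on_imp_continuous_on)
        (auto intro: holomorphic_on_subset)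
    moreover have "(\<lambda>z. norm (f z)) ` sphere 0 (norm w) = {norm (f z) | z. norm z = norm w}"
      by (auto simp: image_def)
    ultimately have "bdd_above {norm (f z) | z. norm z = norm w}"
      by (metis bounded_imp_bdd_above compact_imp_bounded)
    then show ?thesis unfolding max_modulus_def by (intro cSup_upper) auto
  qed
  show ?thesis
  proof (cases "r = 0")
    case True
    then show ?thesis using bdd[of z] r by simp
  next
    case False
    then have "r > 0" using r norm_ge_zero[of z] by linarith
    show ?thesis
    proof (rule maximum_modulus_frontier[where f = f and S = "cball 0 r"])
      show "f holomorphic_on interior (cball 0 r)" using f by (rule holomorphic_on_subset) simp
      show "continuous_on (closure (cball 0 r)) f"
        using f by (intro holomorphic_on_imp_continuous_on) (auto intro: holomorphic_on_subset)
      show "norm (f w) \<le> max_modulus f r" if "w \<in> frontier (cball 0 r)" for w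
        using that \<open>r > 0\<close> bdd[of w] by simp
    qed (use r in auto)
  qed
qed

lemma max_modulus_unbounded:
  assumes f: "f holomorphic_on UNIV" and nc: "\<not> f constant_on UNIV"
  obtains R where "R > 0" "\<And>r. r \<ge> R \<Longrightarrow> K \<le> max_modulus f r"
proof -
  have "\<not> bounded (range f)" using Liouville_theorem[OF f] nc by blast
  then obtain z where z: "K < norm (f z)" unfolding bounded_iff by (metis not_le rangeE)
  show thesis
  proof
    show "max 1 (norm z) > 0" by simp
    fix r assume "r \<ge> max 1 (norm z)"
    then have "norm (f z) \<le> max_modulus f r" by (intro norm_le_max_modulus f) auto
    then show "K \<le> max_modulus f r" using z by simp
  qed
qed

text \<open>Once the maximum modulus reaches \<open>exp (exp 1)\<close>, its iterated logarithm is
  at least 1 while \<open>ln R\<close> is positive, so \<open>A R\<close> must be positive;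
  monotonicity carries this lower bound to all larger \<open>r\<close>.\<close>

lemma eventually_A_pos:
  assumes f: "f holomorphic_on UNIV" and nc: "\<not> f constant_on UNIV"
    and growth: "\<forall>r\<ge>r'. ln (ln (max_modulus f r)) \<le> A r * ln r" and A: "mono_on {r'..} A"
  obtains \<alpha> R where "\<alpha> > 0" "R \<ge> r'" "R > 1" "\<And>r. r \<ge> R \<Longrightarrow> \<alpha> \<le> A r"
proof -
  obtain R0 where R0: "\<And>r. r \<ge> R0 \<Longrightarrow> exp (exp 1) \<le> max_modulus f r"
    using max_modulus_unbounded[OF f nc] by blast
  define R where "R = max R0 (max r' 2)"
  have R: "R \<ge> R0" "R \<ge> r'" "R \<ge> 2" by (auto simp: R_def)
  have "ln (exp (exp 1)) \<le> ln (max_modulus f R)"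
    using R0[OF R(1)] by (intro ln_mono) (auto intro: less_le_trans[OF exp_gt_zero])
  then have "exp 1 \<le> ln (max_modulus f R)" by simp
  then have "ln (exp 1) \<le> ln (ln (max_modulus f R))"
    by (intro ln_mono) (auto intro: less_le_trans[OF exp_gt_zero])
  then have "1 \<le> A R * ln R" using growth R(2) by force
  moreover have "ln R > 0" using R by simp
  ultimately have AR: "A R > 0" by (metis mult_nonpos_nonneg not_less less_imp_le not_one_le_zero order_trans)
  show thesis
  proof
    show "A R > 0" by (rule AR)
    show "A R \<le> A r" if "r \<ge> R" for r using mono_onD[OF A] R that by auto
  qed (use R in auto)
qed

text \<open>The window of width \<open>\<eta> * x\<close> is cut into about \<open>K * q * x\<close>
  pieces with \<open>q = A (exp (2 * x))\<close>, each of width of order \<open>1 / q\<close>.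
  Doubling on half of them would enlarge the supremum of the potential by more than
  \<open>exp (3 * q * x)\<close>, against the growth hypothesis; so the area is at least of order
  \<open>x / q\<close>. The argument \<open>exp (2 * x)\<close> covers the radius
  \<open>exp (x + 1)\<close> at which the maximum modulus is taken.\<close>

lemma tract_area:
  assumes f: "f holomorphic_on UNIV" and nc: "\<not> f constant_on UNIV" and t: "omitting_tract f a \<rho> V"
    and growth: "\<forall>r\<ge>r'. ln (ln (max_modulus f r)) \<le> A r * ln r" and A: "mono_on {r'..} A"
    and \<eta>: "0 < \<eta>" "\<eta> < 1"
  obtains c x0 where "c > 0" "x0 > 0" "exp x0 \<ge> r'" "\<And>x. x \<ge> x0 \<Longrightarrow> 0 < A (exp x)"
    "\<And>x y. x \<ge> x0 \<Longrightarrow>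
       c * x / A (exp (2 * x)) \<le> measure lebesgue (log_strip (tract_potential f a \<rho> V) ((1 - \<eta>) * x) x y)"
proof -
  define u where "u = tract_potential f a \<rho> V"
  have u: "pos_harmonic u" unfolding u_def by (rule pos_harmonic_tract_potential[OF f t])
  have \<rho>: "\<rho> > 0" using t by (simp add: omitting_tract_def)
  obtain c0 where c0: "f c0 \<noteq> a" using nc by (auto simp: constant_on_def)
  define \<delta> where "\<delta> = cmod (f c0 - a)"
  have \<delta>: "\<delta> > 0" using c0 by (simp add: \<delta>_def)
  obtain z0 where z0: "z0 \<in> V" using t by (auto simp: omitting_tract_def)
  have uz0: "u z0 > 0" using tract_potential_pos_iff[OF t] z0 by (simp add: u_def)
  obtain \<alpha> R where \<alpha>: "\<alpha> > 0" "R \<ge> r'" "R > 1" "\<And>r. r \<ge> R \<Longrightarrow> \<alpha> \<le> A r"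
    using eventually_A_pos[OF f nc growth A] by blast
  \<comment> \<open>A maximum modulus \<open>M\<close> above \<open>L\<close> absorbs the additive
    constants: it gives \<open>ln M \<ge> 1\<close>, the bound \<open>2 * M\<close> for
    \<open>f - a\<close>, and \<open>1 + ln (2 * M / \<delta>) \<le> 2 * ln M\<close>.\<close>
  define L where "L = max (exp 1) (max (cmod a + \<rho>) (exp 1 * 2 / \<delta>))"
  obtain R1 where R1: "\<And>r. r \<ge> R1 \<Longrightarrow> L \<le> max_modulus f r"
    using max_modulus_unbounded[OF f nc] by blast
  define x0 where "x0 = Max {1, ln R, ln (max 1 R1), ln (max 1 (cmod z0)) / (1 - \<eta>), ln (max 1 (6 * cmod c0)), (ln 6 - ln (u z0)) / \<alpha>, 1 / \<alpha>}"
  have x0: "1 \<le> x0" "ln R \<le> x0" "ln (max 1 R1) \<le> x0" "ln (max 1 (cmod z0)) / (1 - \<eta>) \<le> x0" "ln (max 1 (6 * cmod c0)) \<le> x0"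
    "(ln 6 - ln (u z0)) / \<alpha> \<le> x0" "1 / \<alpha> \<le> x0"
    unfolding x0_def by (rule Max_ge; simp)+
  \<comment> \<open>Since \<open>ln 2 \<ge> 1/2\<close>, the 14 gives
    \<open>real N / 2 * ln 2 \<ge> 7/2 * q * x\<close>, which exceeds \<open>3 * q * x\<close>; the
    summand \<open>1 / \<alpha>\<close> makes \<open>K * q \<ge> 1\<close>, so that the pieces have
    width \<open>l \<le> 1\<close>.\<close>
  define K where "K = 14 + 1 / \<alpha>"
  have K: "K \<ge> 14" "K * \<alpha> \<ge> 1" using \<alpha> by (auto simp: K_def field_simps)
  define c where "c = \<eta>\<^sup>2 / (32768 * (K + 1))"
  have c: "c > 0" using \<eta> K by (auto simp: c_def intro!: divide_pos_pos)
  have le_exp: "max 1 r \<le> exp y" if "ln (max 1 r) \<le> y" for r y :: real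
  proof -
    have "exp (ln (max 1 r)) \<le> exp y" using that by (simp only: exp_le_cancel_iff)
    moreover have "exp (ln (max 1 r)) = max 1 r" by (rule exp_ln) simp
    ultimately show ?thesis by (simp only:)
  qed
  have expR: "exp x \<ge> R" if "x \<ge> x0" for x
    using le_exp[of R x] x0(2) that \<alpha>(3) by simp
  have main: "c * x / A (exp (2 * x)) \<le> measure lebesgue (log_strip u ((1 - \<eta>) * x) x y)" if x: "x \<ge> x0" for x y
  proof -
    have x1: "x \<ge> 1" using x0 x by linarith
    define q where "q = A (exp (2 * x))"
    have "exp (2 * x) \<ge> R" using expR[of "2 * x"] x x1 by simp
    then have q: "q \<ge> \<alpha>" "q > 0" using \<alpha> by (auto simp: q_def intro: less_le_trans)
    have qx: "q * x \<ge> 1" "q * x \<ge> ln 6 - ln (u z0)"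
    proof -
      have "1 \<le> \<alpha> * x0" "ln 6 - ln (u z0) \<le> \<alpha> * x0" using x0(6,7) \<alpha>(1) by (auto simp: field_simps)
      moreover have "\<alpha> * x0 \<le> q * x" using q x \<alpha>(1) x0(1) by (intro mult_mono) auto
      ultimately show "q * x \<ge> 1" "q * x \<ge> ln 6 - ln (u z0)" by linarith+
    qed
    define M where "M = max_modulus f (exp (x + 1))"
    have "R1 \<le> exp (x + 1)"
    proof -
      have "max 1 R1 \<le> exp x" using x0(3) x by (intro le_exp) simp
      also have "\<dots> \<le> exp (x + 1)" by simp
      finally show ?thesis by simp
    qed
    then have LM: "L \<le> M" unfolding M_def by (rule R1)
    then have M: "exp 1 \<le> M" "cmod a + \<rho> \<le> M" "exp 1 * 2 / \<delta> \<le> M" using LM by (auto simp: L_def)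
    have Mpos: "M > 0" using M(1) by (meson exp_gt_zero less_le_trans)
    have lnM: "ln M \<ge> 1" using M(1) Mpos by (simp add: ln_ge_iff)
    have ub: "disk_sup u x \<le> 6 * ln M"
    proof (rule disk_sup_least)
      fix z :: complex assume z: "norm z \<le> exp x"
      define s where "s = exp x + cmod c0"
      have s: "s > 0" by (simp add: s_def add_pos_nonneg)
      have "u z \<le> 3 * (1 + ln (2 * M / cmod (f c0 - a)))"
        unfolding u_def
      proof (rule tract_potential_growth[OF f t c0 s])
        show "z \<in> cball c0 s" using z norm_triangle_ineq4[of c0 z] by (simp add: s_def dist_norm)
        show "\<rho> \<le> 2 * M" using M(2) \<rho> norm_ge_zero[of a] by linarith
        fix w assume "w \<in> sphere c0 (2 * s)"
        then have "cmod w \<le> 2 * s + cmod c0"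
          using norm_triangle_ineq2[of w c0] by (simp add: dist_norm norm_minus_commute)
        \<comment> \<open>The left side is \<open>2 * exp x + 3 * cmod c0\<close>; with
          \<open>6 * cmod c0 \<le> exp x\<close> it is at most \<open>5/2 * exp x\<close>, and
          \<open>5/2 \<le> exp 1\<close>.\<close>
        also have "\<dots> \<le> exp (x + 1)"
        proof -
          have "max 1 (6 * cmod c0) \<le> exp x" using x0(5) x by (intro le_exp) simp
          then have "6 * cmod c0 \<le> exp x" by simp
          moreover have "exp x * (5/2) \<le> exp x * exp 1"
            using exp_lower_Taylor_quadratic[of 1] by (intro mult_left_mono) auto
          ultimately show ?thesis unfolding s_def exp_add by argo
        qed
        finally have "cmod (f w) \<le> M" unfolding M_def by (rule norm_le_max_modulus[OF f])
        then show "cmod (f w - a) \<le> 2 * M"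
          using norm_triangle_ineq4[of "f w" a] M(2) \<rho> by linarith
      qed
      also have "1 + ln (2 * M / cmod (f c0 - a)) = ln (exp 1 * 2 / \<delta> * M)"
        using \<delta> Mpos by (simp add: \<delta>_def ln_mult ln_div)
      also have "\<dots> \<le> ln (M * M)"
        using M(3) Mpos \<delta> by (intro ln_mono mult_right_mono) auto
      also have "\<dots> = 2 * ln M" using Mpos by (simp add: ln_mult)
      finally show "u z \<le> 6 * ln M" by simp
    qed
    have t1z: "u z0 \<le> disk_sup u ((1 - \<eta>) * x)"
    proof (rule disk_sup_upper[OF u])
      have "ln (max 1 (cmod z0)) \<le> (1 - \<eta>) * x0" using x0(4) \<eta> by (simp add: field_simps)
      also have "\<dots> \<le> (1 - \<eta>) * x" using x \<eta> by (intro mult_left_mono) auto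
      finally have "max 1 (cmod z0) \<le> exp ((1 - \<eta>) * x)" by (rule le_exp)
      then show "cmod z0 \<le> exp ((1 - \<eta>) * x)" by simp
    qed
    have lnlnM: "ln (ln M) \<le> q * (2 * x)"
    proof -
      have "exp (x + 1) \<ge> R" using expR[of "x + 1"] x by simp
      then have ge: "exp (x + 1) \<ge> r'" using \<alpha>(2) by simp
      then have "ln (ln M) \<le> A (exp (x + 1)) * (x + 1)" using growth unfolding M_def by (metis ln_exp)
      also have "\<dots> \<le> q * (x + 1)"
        unfolding q_def using mono_onD[OF A] ge x1 order_trans[OF ge]
        by (intro mult_right_mono) auto
      also have "\<dots> \<le> q * (2 * x)" using q x1 by (intro mult_left_mono) auto
      finally show ?thesis .
    qed
    define N where "N = nat \<lceil>K * q * x\<rceil>"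
    have Kqx: "K * q * x \<ge> 14" using mult_mono[of 14 K 1 "q * x"] K qx by (simp add: mult.assoc)
    have N: "K * q * x \<le> real N" "real N \<le> K * q * x + 1"
      using Kqx unfolding N_def by linarith+
    have N0: "N > 0" using N Kqx by linarith
    define l where "l = (x - (1 - \<eta>) * x) / real N"
    have el: "x - (1 - \<eta>) * x = \<eta> * x" by (simp add: algebra_simps)
    have l: "l > 0" unfolding l_def el using \<eta> x1 N0 by simp
    have "\<eta> * x \<le> 1 * x" using \<eta> x1 by (intro mult_right_mono) auto
    also have "\<dots> \<le> (K * q) * x"
      using K q x1 order_trans[OF K(2) mult_left_mono[OF q(1), of K]] by (intro mult_right_mono) auto
    also have "\<dots> \<le> real N" by (rule N)
    finally have l1: "l \<le> 1" unfolding l_def el using N0 by simp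
    have "(x - (1 - \<eta>) * x) * l / 32768 \<le> measure lebesgue (log_strip u ((1 - \<eta>) * x) x y)"
    proof (rule log_strip_area_or_growth[OF u N0 l_def l l1])
      show "disk_sup u ((1 - \<eta>) * x) > 0" using t1z uz0 by linarith
      have "disk_sup u x \<le> exp (ln 6 + ln (ln M))" using ub lnM by (simp add: exp_add)
      also have "\<dots> \<le> exp (3 * (q * x) + ln (u z0))" using lnlnM qx(2) by simp
      also have "\<dots> = exp (3 * (q * x)) * u z0" using uz0 by (simp add: exp_add)
      also have "\<dots> < 2 powr (real N / 2) * u z0"
      proof (intro mult_strict_right_mono uz0)
        have "14 * (q * x) \<le> K * (q * x)" using K qx by (intro mult_right_mono) auto
        then have "7 * (q * x) \<le> real N / 2" using N(1) by (simp add: mult.assoc)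
        moreover have "1/2 \<le> ln (2::real)" using exp_bound_half[of "1/2::real"] by (subst ln_ge_iff) simp_all
        ultimately have "7 * (q * x) * (1/2) \<le> real N / 2 * ln 2" using qx by (intro mult_mono) auto
        then have "3 * (q * x) < real N / 2 * ln 2" using qx by linarith
        then show "exp (3 * (q * x)) < 2 powr (real N / 2)" by (simp add: powr_def)
      qed
      also have "\<dots> \<le> 2 powr (real N / 2) * disk_sup u ((1 - \<eta>) * x)" using t1z by (intro mult_left_mono) auto
      finally show "disk_sup u x < 2 powr (real N / 2) * disk_sup u ((1 - \<eta>) * x)" .
    qed
    moreover have "c * x / q \<le> (x - (1 - \<eta>) * x) * l / 32768"
    proof -
      have "real N \<le> (K + 1) * (q * x)" using N(2) qx(1) by (simp add: algebra_simps)
      then have "\<eta> * x / ((K + 1) * (q * x)) \<le> l"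
        unfolding l_def el using \<eta> x1 N0 by (intro divide_left_mono) auto
      then have "\<eta> * x * (\<eta> * x / ((K + 1) * (q * x))) / 32768 \<le> \<eta> * x * l / 32768"
        using \<eta> x1 by (intro divide_right_mono mult_left_mono) auto
      moreover have "\<eta> * x * (\<eta> * x / ((K + 1) * (q * x))) / 32768 = c * x / q"
      proof -
        have "\<eta> * x / ((K + 1) * (q * x)) = \<eta> / ((K + 1) * q)" using x1 by simp
        then show ?thesis by (simp add: c_def power2_eq_square mult_ac)
      qed
      ultimately show ?thesis unfolding el by simp
    qed
    ultimately show ?thesis unfolding q_def by linarith
  qed
  show thesis
  proof (rule that[OF c, of x0])
    show "x0 > 0" using x0 by simp
    show "exp x0 \<ge> r'" using expR[of x0] \<alpha> by simp
    show "0 < A (exp x)" if "x \<ge> x0" for x using \<alpha>(4)[OF expR[OF that]] \<alpha>(1) by linarith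
  qed (use main in \<open>simp add: u_def\<close>)
qed

section \<open>Inverse branches avoiding the singular values\<close>

definition inverse_branch :: "(complex \<Rightarrow> complex) \<Rightarrow> complex set \<Rightarrow> (complex \<Rightarrow> complex) \<Rightarrow> bool" where
  "inverse_branch f S g \<longleftrightarrow> g holomorphic_on S \<and> (\<forall>w\<in>S. f (g w) = w)"

lemma inverse_branch_subset: "inverse_branch f S g \<Longrightarrow> T \<subseteq> S \<Longrightarrow> inverse_branch f T g"
  unfolding inverse_branch_def by (auto intro: holomorphic_on_subset)

lemma inverse_branch_deriv_nz:
  assumes f: "f holomorphic_on UNIV" and g: "inverse_branch f S g" "open S" "w \<in> S"
  shows "deriv f (g w) \<noteq> 0"
proof
  assume 0: "deriv f (g w) = 0"
  have "(f has_field_derivative deriv f (g w)) (at (g w))"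
    using f holomorphic_derivI[of f UNIV] by auto
  moreover have "(g has_field_derivative deriv g w) (at w)"
    using g holomorphic_derivI[of g S w] by (auto simp: inverse_branch_def)
  ultimately have "((\<lambda>x. f (g x)) has_field_derivative deriv f (g w) * deriv g w) (at w)"
    by (rule DERIV_chain2)
  moreover have "((\<lambda>x. f (g x)) has_field_derivative 1) (at w)"
    using g by (intro has_field_derivative_transform_within_open[OF DERIV_ident, of S])
      (auto simp: inverse_branch_def)
  ultimately show False using 0 DERIV_unique by force
qed

lemma local_inverse_branch:
  assumes f: "f holomorphic_on UNIV" and p: "deriv f p \<noteq> 0"
  obtains r \<epsilon> h where "r > 0" "\<epsilon> > 0" "inverse_branch f (ball (f p) \<epsilon>) h" "inj_on f (ball p r)"
    "\<And>z. z \<in> ball p r \<Longrightarrow> h (f z) = z" "h ` ball (f p) \<epsilon> \<subseteq> ball p r"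
proof -
  obtain r where r: "r > 0" "inj_on f (ball p r)"
    using has_complex_derivative_locally_injective[OF f _ _ p] by auto
  have fb: "f holomorphic_on ball p r" using f by (rule holomorphic_on_subset) simp
  obtain h where h: "h holomorphic_on f ` ball p r" "\<And>z. z \<in> ball p r \<Longrightarrow> h (f z) = z"
    by (rule holomorphic_has_inverse[OF fb open_ball r(2)]) (rule that)
  have "open (f ` ball p r)" by (rule open_mapping_thm3[OF fb open_ball r(2)])
  then obtain \<epsilon> where e: "\<epsilon> > 0" "ball (f p) \<epsilon> \<subseteq> f ` ball p r"
    using r(1) by (metis centre_in_ball image_eqI openE)
  have "inverse_branch f (ball (f p) \<epsilon>) h"
    unfolding inverse_branch_def
  proof
    show "h holomorphic_on ball (f p) \<epsilon>" using h(1) e(2) by (rule holomorphic_on_subset)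
    show "\<forall>w\<in>ball (f p) \<epsilon>. f (h w) = w" using h(2) e(2) by fastforce
  qed
  moreover have "h ` ball (f p) \<epsilon> \<subseteq> ball p r" using h(2) e by fastforce
  ultimately show thesis using that r e h by blast
qed

text \<open>Injectivity of \<open>f\<close> near \<open>g w0\<close> makes the branches agree on a
  neighbourhood of \<open>w0\<close>; the identity theorem does the rest.\<close>

lemma inverse_branch_unique:
  assumes f: "f holomorphic_on UNIV" and g: "inverse_branch f S g" and h: "inverse_branch f S h"
    and S: "open S" "connected S" and w0: "w0 \<in> S" "g w0 = h w0" and w: "w \<in> S"
  shows "g w = h w"
proof -
  obtain r where r: "r > 0" "inj_on f (ball (g w0) r)"
    using has_complex_derivative_locally_injective[OF f _ _ inverse_branch_deriv_nz[OF f g S(1) w0(1)]] by auto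
  have cont: "continuous_on S g" "continuous_on S h"
    using g h by (auto simp: inverse_branch_def intro: holomorphic_on_imp_continuous_on)
  define N where "N = (S \<inter> g -` ball (g w0) r) \<inter> (S \<inter> h -` ball (g w0) r)"
  have "open N"
    unfolding N_def by (intro open_Int continuous_open_preimage cont S open_ball)
  moreover have "w0 \<in> N" using w0 r by (simp add: N_def)
  moreover have "g x = h x" if "x \<in> N" for x
  proof (rule inj_onD[OF r(2)])
    have "x \<in> S" "g x \<in> ball (g w0) r" "h x \<in> ball (g w0) r" using that by (auto simp: N_def)
    then show "f (g x) = f (h x)" "g x \<in> ball (g w0) r" "h x \<in> ball (g w0) r"
      using g h by (simp_all add: inverse_branch_def)
  qed
  moreover have "N \<subseteq> S" by (auto simp: N_def)
  ultimately show ?thesis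
    using S g h w unfolding inverse_branch_def
    by (intro analytic_continuation_open[of N S g h w]) blast+
qed

lemma ball_segment_mem:
  fixes b y :: complex
  assumes "dist b y \<le> \<rho>" "0 < t" "t \<le> 1" "\<rho> > 0"
  shows "y + of_real (1 - t) * (b - y) \<in> ball y \<rho>" "dist (y + of_real (1 - t) * (b - y)) b = t * dist b y"
proof -
  have "dist y (y + of_real (1 - t) * (b - y)) = (1 - t) * dist b y"
    using assms norm_of_real[of "1 - t", where 'a = complex] unfolding dist_norm
    by (simp add: norm_mult del: of_real_diff)
  also have "\<dots> \<le> (1 - t) * \<rho>" using assms by (intro mult_left_mono) auto
  also have "\<dots> < \<rho>" using assms by (simp add: algebra_simps)
  finally show "y + of_real (1 - t) * (b - y) \<in> ball y \<rho>" by simp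
  have "y + of_real (1 - t) * (b - y) - b = of_real (- t) * (b - y)" by (simp add: algebra_simps)
  then show "dist (y + of_real (1 - t) * (b - y)) b = t * dist b y"
    using assms by (simp only: dist_norm norm_mult norm_of_real)
qed

text \<open>Along a radius, the branch either tends to infinity, which makes the end point an asymptotic value,
  or it has a finite limit point, near which \<open>f\<close> is locally invertible.\<close>
lemma inverse_branch_extend_point:
  assumes f: "f holomorphic_on UNIV" and \<rho>: "\<rho> > 0" and g: "inverse_branch f (ball y \<rho>) g"
    and b: "b \<in> cball y \<rho>" and ns: "b \<notin> critical_values f" "b \<notin> asymptotic_values f"
  obtains \<epsilon> h where "\<epsilon> > 0" "inverse_branch f (ball b \<epsilon>) h" "\<And>w. w \<in> ball b \<epsilon> \<inter> ball y \<rho> \<Longrightarrow> h w = g w"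
proof (cases "b \<in> ball y \<rho>")
  case True
  then obtain e where "e > 0" "ball b e \<subseteq> ball y \<rho>" by (meson openE open_ball)
  then show thesis using that[of e g] inverse_branch_subset[OF g] by blast
next
  case False
  then have db: "dist b y = \<rho>" using b by (simp add: dist_commute)
  define q where "q = (\<lambda>t::real. y + of_real t * (b - y))"
  define \<gamma> where "\<gamma> = (\<lambda>t. g (q t))"
  have q_in: "q t \<in> ball y \<rho>" if "0 \<le> t" "t < 1" for t
    using ball_segment_mem(1)[of b y \<rho> "1 - t"] db \<rho> that by (simp add: q_def)
  have cq: "continuous_on A q" for A unfolding q_def by (intro continuous_intros)
  have cg: "continuous_on (ball y \<rho>) g"
    using g by (auto simp: inverse_branch_def intro: holomorphic_on_imp_continuous_on)
  have c\<gamma>: "continuous_on {0..<1} \<gamma>"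
    unfolding \<gamma>_def by (rule continuous_on_compose2[OF cg cq]) (use q_in in auto)
  have f\<gamma>: "f (\<gamma> t) = q t" if "0 \<le> t" "t < 1" for t
    using g q_in[OF that] by (simp add: \<gamma>_def inverse_branch_def)
  have ev: "eventually (\<lambda>t::real. 0 \<le> t \<and> t < 1) (at_left 1)"
    using eventually_at_left[of 0 "1::real"] by (auto intro!: exI[of _ 0])
  have "(q \<longlongrightarrow> q 1) (at_left 1)"
    unfolding q_def by (intro tendsto_intros)
  then have "((\<lambda>t. f (\<gamma> t)) \<longlongrightarrow> b) (at_left 1)"
  proof -
    assume "(q \<longlongrightarrow> q 1) (at_left 1)"
    moreover have "eventually (\<lambda>t. q t = f (\<gamma> t)) (at_left 1)"
      using ev by (rule eventually_mono) (use f\<gamma> in auto)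
    ultimately have "((\<lambda>t. f (\<gamma> t)) \<longlongrightarrow> q 1) (at_left 1)" by (rule Lim_transform_eventually)
    then show ?thesis by (simp add: q_def)
  qed
  then have "\<not> filterlim \<gamma> at_infinity (at_left 1)"
    using ns(2) c\<gamma> unfolding asymptotic_values_def by blast
  then obtain K where K: "\<not> eventually (\<lambda>t. K \<le> norm (\<gamma> t)) (at_left 1)"
    unfolding filterlim_at_infinity[OF order_refl] by blast
  have "\<exists>t. 1 - 1 / real (Suc n) < t \<and> 0 \<le> t \<and> t < 1 \<and> norm (\<gamma> t) \<le> K" for n
  proof (rule ccontr)
    assume no: "\<not> ?thesis"
    have "eventually (\<lambda>t. 1 - 1 / real (Suc n) < t \<and> t < 1) (at_left 1)"
      using eventually_at_left[of "0" "1::real"] by (auto intro!: exI[of _ "1 - 1 / real (Suc n)"])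
    then have "eventually (\<lambda>t. K \<le> norm (\<gamma> t)) (at_left 1)"
      using ev by eventually_elim (use no in \<open>auto simp: not_le intro: less_imp_le\<close>)
    then show False using K by simp
  qed
  then obtain t where t: "\<And>n. 1 - 1 / real (Suc n) < t n" "\<And>n. 0 \<le> t n" "\<And>n. t n < 1" "\<And>n. norm (\<gamma> (t n)) \<le> K"
    by metis
  have "bounded (range (\<lambda>n. \<gamma> (t n)))" by (rule boundedI[of _ K]) (use t(4) in auto)
  then obtain p s where p: "strict_mono s" "((\<lambda>n. \<gamma> (t n)) \<circ> s) \<longlonglongrightarrow> p"
    using bounded_imp_convergent_subsequence by blast
  have t1: "t \<longlonglongrightarrow> 1"
  proof (rule tendsto_sandwich[of "\<lambda>n. 1 - 1 / real (Suc n)" t sequentially "\<lambda>_. 1"])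
    show "(\<lambda>n. 1 - 1 / real (Suc n)) \<longlonglongrightarrow> 1"
      using tendsto_diff[OF tendsto_const LIMSEQ_inverse_real_of_nat, of 1] by (simp add: inverse_eq_divide)
  qed (use t in \<open>auto intro!: always_eventually less_imp_le\<close>)
  have "isCont q 1" using cq[of UNIV] by (simp add: continuous_on_eq_continuous_at)
  then have "(\<lambda>n. q (t n)) \<longlonglongrightarrow> q 1" using t1 by (rule isCont_tendsto_compose)
  then have qs: "(\<lambda>n. q (t (s n))) \<longlonglongrightarrow> b"
    using LIMSEQ_subseq_LIMSEQ[OF _ p(1)] by (fastforce simp: o_def q_def)
  have "isCont f p" using holomorphic_on_imp_continuous_on[OF f] by (simp add: continuous_on_eq_continuous_at)
  then have "(\<lambda>n. f (\<gamma> (t (s n)))) \<longlonglongrightarrow> f p"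
    using p(2) unfolding o_def by (rule isCont_tendsto_compose)
  then have "(\<lambda>n. q (t (s n))) \<longlonglongrightarrow> f p" using f\<gamma> t by simp
  then have fp: "f p = b" using qs LIMSEQ_unique by blast
  then have "deriv f p \<noteq> 0" using ns(1) by (auto simp: critical_values_def)
  then obtain r \<epsilon> h where h: "r > 0" "\<epsilon> > 0" "inverse_branch f (ball b \<epsilon>) h"
    "\<And>z. z \<in> ball p r \<Longrightarrow> h (f z) = z"
    using local_inverse_branch[OF f] fp by metis
  have "eventually (\<lambda>n. \<gamma> (t (s n)) \<in> ball p r) sequentially"
    using p(2) h(1) unfolding o_def by (intro topological_tendstoD) auto
  moreover have "eventually (\<lambda>n. q (t (s n)) \<in> ball b \<epsilon>) sequentially"
    using qs h(2) by (intro topological_tendstoD) auto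
  ultimately have "eventually (\<lambda>n. \<gamma> (t (s n)) \<in> ball p r \<and> q (t (s n)) \<in> ball b \<epsilon>) sequentially"
    by (rule eventually_conj)
  then obtain n where n: "\<gamma> (t (s n)) \<in> ball p r" "q (t (s n)) \<in> ball b \<epsilon>"
    unfolding eventually_sequentially by blast
  have agree: "g (q (t (s n))) = h (q (t (s n)))"
    using h(4)[OF n(1)] f\<gamma>[OF t(2,3)] by (simp add: \<gamma>_def)
  show thesis
  proof (rule that[OF h(2,3)])
    fix w assume w: "w \<in> ball b \<epsilon> \<inter> ball y \<rho>"
    show "h w = g w"
    proof (rule inverse_branch_unique[OF f, where S = "ball b \<epsilon> \<inter> ball y \<rho>" and g = h and h = g])
      show "q (t (s n)) \<in> ball b \<epsilon> \<inter> ball y \<rho>" using n q_in t by simp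
      show "connected (ball b \<epsilon> \<inter> ball y \<rho>)" by (intro convex_connected convex_Int convex_ball)
    qed (use inverse_branch_subset[OF h(3)] inverse_branch_subset[OF g] agree w in auto)
  qed
qed

text \<open>By compactness there is one radius \<open>e\<close> such that each point of the closed
  disk has a branch on its \<open>e\<close>-ball agreeing with \<open>g\<close>. A point slightly
  outside the disk uses the branch at its closest point; branches at neighbouring centres agree
  because both equal \<open>g\<close> at a common point of the open disk.\<close>

lemma inverse_branch_extend_ball:
  assumes f: "f holomorphic_on UNIV" and \<rho>: "\<rho> > 0" and g: "inverse_branch f (ball y \<rho>) g"
    and ns: "\<And>b. b \<in> cball y \<rho> \<Longrightarrow> b \<notin> critical_values f \<union> asymptotic_values f"
  obtains \<delta> g' where "\<delta> > 0" "inverse_branch f (ball y (\<rho> + \<delta>)) g'" "g' y = g y"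
proof -
  define good where "good = (\<lambda>b \<epsilon> h. inverse_branch f (ball b \<epsilon>) h \<and> (\<forall>w \<in> ball b \<epsilon> \<inter> ball y \<rho>. h w = g w))"
  define \<G> where "\<G> = {ball b \<epsilon> | b \<epsilon>. b \<in> cball y \<rho> \<and> \<epsilon> > 0 \<and> (\<exists>h. good b \<epsilon> h)}"
  have "cball y \<rho> \<subseteq> \<Union>\<G>"
  proof
    fix b assume b: "b \<in> cball y \<rho>"
    obtain \<epsilon> h where "\<epsilon> > 0" "inverse_branch f (ball b \<epsilon>) h" "\<And>w. w \<in> ball b \<epsilon> \<inter> ball y \<rho> \<Longrightarrow> h w = g w"
      using inverse_branch_extend_point[OF f \<rho> g b] ns[OF b] by auto
    then have "good b \<epsilon> h" unfolding good_def by blast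
    then have "ball b \<epsilon> \<in> \<G>" "b \<in> ball b \<epsilon>" using b \<open>\<epsilon> > 0\<close> unfolding \<G>_def by (blast, simp)
    then show "b \<in> \<Union>\<G>" by blast
  qed
  moreover have "open G" if "G \<in> \<G>" for G using that by (auto simp: \<G>_def)
  ultimately obtain e where e: "e > 0" "\<And>b. b \<in> cball y \<rho> \<Longrightarrow> \<exists>G\<in>\<G>. ball b e \<subseteq> G"
    using Heine_Borel_lemma[OF compact_cball, of y \<rho> \<G>] by metis
  have "\<exists>h. good b e h" if b: "b \<in> cball y \<rho>" for b
  proof -
    obtain b' \<epsilon> h where h: "good b' \<epsilon> h" "ball b e \<subseteq> ball b' \<epsilon>"
      using e(2)[OF b] unfolding \<G>_def by blast
    then show ?thesis
      unfolding good_def by (intro exI[of _ h]) (auto intro: inverse_branch_subset)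
  qed
  then obtain h where h: "\<And>b. b \<in> cball y \<rho> \<Longrightarrow> good b e (h b)" by metis
  have glue: "h b w = h b1 w"
    if b: "b \<in> cball y \<rho>" "b1 \<in> cball y \<rho>" "dist b b1 < e / 4" and w: "w \<in> ball b e" "w \<in> ball b1 e" for b b1 w
  proof (rule inverse_branch_unique[OF f, where S = "ball b e \<inter> ball b1 e" and g = "h b" and h = "h b1"])
    \<comment> \<open>\<open>p\<close> is \<open>b\<close> moved towards \<open>y\<close> by at most
      \<open>e / 4\<close>: this puts it in the open disk, where both branches equal
      \<open>g\<close>, and in both \<open>e\<close>-balls.\<close>
    define t where "t = min 1 (e / (4 * \<rho>))"
    have t: "0 < t" "t \<le> 1" "t * \<rho> \<le> e / 4" using e \<rho> by (auto simp: t_def min_def field_simps)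
    define p where "p = y + of_real (1 - t) * (b - y)"
    have d: "dist b y \<le> \<rho>" using b by (simp add: dist_commute)
    have p: "p \<in> ball y \<rho>" "dist p b = t * dist b y"
      using ball_segment_mem[OF d t(1,2) \<rho>] by (auto simp: p_def)
    have "t * dist b y \<le> t * \<rho>" using d t by (intro mult_left_mono) auto
    then have pb: "dist p b \<le> e / 4" using p t by linarith
    then have "dist b p < e" using e by (simp add: dist_commute)
    moreover have "dist b1 p < e" using pb b(3) dist_triangle[of b1 p b] e by (simp add: dist_commute)
    ultimately have pp: "p \<in> ball b e \<inter> ball b1 e" by simp
    then show "p \<in> ball b e \<inter> ball b1 e" .
    show "h b p = h b1 p"
      using h[OF b(1)] h[OF b(2)] pp p(1) by (simp add: good_def)
    show "connected (ball b e \<inter> ball b1 e)" by (intro convex_connected convex_Int convex_ball)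
    show "inverse_branch f (ball b e \<inter> ball b1 e) (h b)" "inverse_branch f (ball b e \<inter> ball b1 e) (h b1)"
      using h[OF b(1)] h[OF b(2)] by (auto simp: good_def intro: inverse_branch_subset)
  qed (use w in auto)
  \<comment> \<open>Projection to a convex set is 1-Lipschitz, so points within \<open>e / 4\<close>
    of each other have centres within \<open>e / 4\<close>, the range in which \<open>glue\<close>
    applies.\<close>
  define \<pi> where "\<pi> = closest_point (cball y \<rho>)"
  have ne: "cball y \<rho> \<noteq> {}" using \<rho> by simp
  have \<pi>_in: "\<pi> w \<in> cball y \<rho>" for w
    unfolding \<pi>_def by (rule closest_point_in_set[OF closed_cball ne])
  have \<pi>_lip: "dist (\<pi> w) (\<pi> w1) \<le> dist w w1" for w w1
    unfolding \<pi>_def by (rule closest_point_lipschitz[OF convex_cball closed_cball ne])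
  have \<pi>_near: "dist w (\<pi> w) < e / 2" if w: "w \<in> ball y (\<rho> + e / 2)" for w
  proof (cases "w \<in> cball y \<rho>")
    case True
    then show ?thesis using e by (simp add: \<pi>_def closest_point_self)
  next
    case False
    define D where "D = dist w y"
    have D: "\<rho> < D" "D < \<rho> + e / 2" using False w by (auto simp: D_def dist_commute)
    define t where "t = (D - \<rho>) / D"
    have t: "0 < t" "t \<le> 1" using D \<rho> by (auto simp: t_def)
    have D0: "D > 0" using D \<rho> by simp
    define p where "p = y + of_real (1 - t) * (w - y)"
    have "dist y p = (1 - t) * D"
      using t norm_of_real[of "1 - t", where 'a = complex] unfolding p_def D_def dist_norm
      by (simp add: norm_mult del: of_real_diff)
    also have "\<dots> = \<rho>" using D0 by (simp add: t_def field_simps)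
    finally have "p \<in> cball y \<rho>" by simp
    then have "dist w (\<pi> w) \<le> dist w p" unfolding \<pi>_def by (rule closest_point_le[OF closed_cball])
    also have "\<dots> = t * D"
      using ball_segment_mem(2)[of w y D t] t D0 by (simp add: p_def D_def dist_commute)
    also have "\<dots> = D - \<rho>" using D0 by (simp add: t_def)
    also have "\<dots> < e / 2" using D by simp
    finally show ?thesis .
  qed
  define g' where "g' = (\<lambda>w. h (\<pi> w) w)"
  have loc: "g' w = h (\<pi> w1) w" "w \<in> ball (\<pi> w1) e"
    if "w1 \<in> ball y (\<rho> + e / 2)" "w \<in> ball y (\<rho> + e / 2)" "dist w1 w < e / 4" for w1 w
  proof -
    have "dist (\<pi> w1) w < e"
      using dist_triangle[of "\<pi> w1" w w1] \<pi>_near[OF that(1)] that(3) e(1) by (simp add: dist_commute)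
    then show m: "w \<in> ball (\<pi> w1) e" by simp
    have "dist (\<pi> w) (\<pi> w1) < e / 4" using \<pi>_lip[of w w1] that(3) by (simp add: dist_commute)
    moreover have "w \<in> ball (\<pi> w) e" using \<pi>_near[OF that(2)] e by (simp add: dist_commute)
    ultimately show "g' w = h (\<pi> w1) w" unfolding g'_def using glue[OF \<pi>_in \<pi>_in] m by blast
  qed
  have "inverse_branch f (ball y (\<rho> + e / 2)) g'"
    unfolding inverse_branch_def
  proof
    show "\<forall>w\<in>ball y (\<rho> + e / 2). f (g' w) = w"
    proof
      fix w assume w: "w \<in> ball y (\<rho> + e / 2)"
      have "g' w = h (\<pi> w) w" "w \<in> ball (\<pi> w) e" using loc[OF w w] e by auto
      then show "f (g' w) = w" using h[OF \<pi>_in[of w]] by (simp add: good_def inverse_branch_def)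
    qed
    show "g' holomorphic_on ball y (\<rho> + e / 2)"
    proof (rule holomorphic_onI)
      fix w1 assume w1: "w1 \<in> ball y (\<rho> + e / 2)"
      define N where "N = ball y (\<rho> + e / 2) \<inter> ball w1 (e / 4)"
      have "h (\<pi> w1) holomorphic_on N"
        using h[OF \<pi>_in[of w1]] loc(2)[OF w1]
        by (auto simp: N_def good_def inverse_branch_def intro!: holomorphic_on_subset[of "h (\<pi> w1)" "ball (\<pi> w1) e"])
      then have "g' holomorphic_on N"
        by (rule holomorphic_transform) (use loc(1)[OF w1] in \<open>auto simp: N_def\<close>)
      moreover have "open N" "w1 \<in> N" using w1 e by (auto simp: N_def)
      ultimately have "g' field_differentiable at w1"
        by (simp add: holomorphic_on_imp_differentiable_at)
      then show "g' field_differentiable at w1 within ball y (\<rho> + e / 2)"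
        by (rule field_differentiable_at_within)
    qed
  qed
  moreover have "g' y = g y"
  proof -
    have "y \<in> cball y \<rho>" "y \<in> ball y \<rho>" using \<rho> by auto
    moreover have "\<pi> y = y" using \<rho> by (simp add: \<pi>_def closest_point_self)
    ultimately show ?thesis using h[of y] e by (simp add: g'_def good_def)
  qed
  ultimately show thesis using that[of "e / 2" g'] e by auto
qed

text \<open>A continuation argument in the radius: small radii work by local invertibility, branches
  on all radii below the supremum fit together by uniqueness, and a supremum below \<open>r\<close>
  would leave a closed disk free of singular values, past which the branch extends.\<close>

lemma inverse_branch_ball:
  assumes f: "f holomorphic_on UNIV" and r: "r > 0"
    and ns: "\<And>b. b \<in> ball (f z) r \<Longrightarrow> b \<notin> critical_values f \<union> asymptotic_values f"
  obtains g where "inverse_branch f (ball (f z) r) g" "g (f z) = z"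
proof -
  define y where "y = f z"
  define P where "P = (\<lambda>s. \<exists>g. inverse_branch f (ball y s) g \<and> g y = z)"
  define T where "T = {s. 0 < s \<and> s \<le> r \<and> P s}"
  have "deriv f z \<noteq> 0" using ns[of "f z"] r by (auto simp: critical_values_def)
  then obtain r1 \<epsilon> h where h: "r1 > 0" "\<epsilon> > 0" "inverse_branch f (ball y \<epsilon>) h" "\<And>z'. z' \<in> ball z r1 \<Longrightarrow> h (f z') = z'"
    using local_inverse_branch[OF f] y_def by metis
  have "inverse_branch f (ball y (min \<epsilon> r)) h" "h y = z"
    using h inverse_branch_subset[OF h(3) subset_ball, of "min \<epsilon> r"] by (auto simp: y_def)
  then have T0: "min \<epsilon> r \<in> T" using h r unfolding T_def P_def by auto
  have bdd: "bdd_above T" by (rule bdd_aboveI[of _ r]) (simp add: T_def)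
  define \<rho> where "\<rho> = Sup T"
  have \<rho>: "0 < \<rho>" "\<rho> \<le> r"
  proof -
    show "0 < \<rho>" unfolding \<rho>_def using cSup_upper[OF T0 bdd] h r by auto
    have "T \<noteq> {}" using T0 by blast
    then show "\<rho> \<le> r" unfolding \<rho>_def by (rule cSup_least) (simp add: T_def)
  qed
  have Pdown: "P s" if "0 < s" "s < \<rho>" for s
  proof -
    obtain t where "t \<in> T" "s < t" using \<open>s < \<rho>\<close> less_cSup_iff[of T s] T0 bdd by (auto simp: \<rho>_def)
    then obtain g where g: "inverse_branch f (ball y t) g" "g y = z" unfolding T_def P_def by blast
    have "ball y s \<subseteq> ball y t" using \<open>s < t\<close> by (intro subset_ball) simp
    then show ?thesis unfolding P_def using inverse_branch_subset[OF g(1)] g(2) by blast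
  qed
  define G where "G = (\<lambda>s. SOME g. inverse_branch f (ball y s) g \<and> g y = z)"
  have G: "inverse_branch f (ball y s) (G s)" "G s y = z" if "0 < s" "s < \<rho>" for s
    using someI_ex[of "\<lambda>g. inverse_branch f (ball y s) g \<and> g y = z"] Pdown[OF that]
    unfolding G_def P_def by auto
  have Geq: "G s w = G t w" if "0 < s" "s < \<rho>" "0 < t" "t < \<rho>" "w \<in> ball y s" "w \<in> ball y t" for s t w
  proof (rule inverse_branch_unique[OF f, where S = "ball y (min s t)" and g = "G s" and h = "G t"])
    show "y \<in> ball y (min s t)" "G s y = G t y" using that G by auto
    show "inverse_branch f (ball y (min s t)) (G s)"
      by (rule inverse_branch_subset[OF G(1)[OF that(1,2)] subset_ball]) simp
    show "inverse_branch f (ball y (min s t)) (G t)"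
      by (rule inverse_branch_subset[OF G(1)[OF that(3,4)] subset_ball]) simp
  qed (use that in auto)
  \<comment> \<open>The radius halfway between \<open>dist y w\<close> and \<open>\<rho>\<close> is
    below \<open>\<rho>\<close> and its ball contains \<open>w\<close>.\<close>
  define g where "g = (\<lambda>w. G ((dist y w + \<rho>) / 2) w)"
  have geq: "g w = G s w" if "s < \<rho>" "w \<in> ball y s" for s w
  proof -
    have "dist y w < s" using that by simp
    then have "0 < s" "dist y w < \<rho>" using that zero_le_dist[of y w] by linarith+
    then show ?thesis unfolding g_def using that \<rho>(1)
      by (intro Geq) (auto intro: add_nonneg_pos)
  qed
  have gb: "inverse_branch f (ball y \<rho>) g"
    unfolding inverse_branch_def
  proof
    have ex: "\<exists>s. 0 < s \<and> s < \<rho> \<and> w \<in> ball y s" if w: "w \<in> ball y \<rho>" for w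
      using w zero_le_dist[of y w] \<rho>(1) by (intro exI[of _ "(dist y w + \<rho>) / 2"]) (auto intro: add_nonneg_pos)
    show "\<forall>w\<in>ball y \<rho>. f (g w) = w"
    proof
      fix w assume "w \<in> ball y \<rho>"
      then obtain s where s: "0 < s" "s < \<rho>" "w \<in> ball y s" using ex by blast
      then show "f (g w) = w" using geq[OF s(2,3)] G(1)[OF s(1,2)] by (simp add: inverse_branch_def)
    qed
    show "g holomorphic_on ball y \<rho>"
    proof (rule holomorphic_onI)
      fix w assume "w \<in> ball y \<rho>"
      then obtain s where s: "0 < s" "s < \<rho>" "w \<in> ball y s" using ex by blast
      have "G s holomorphic_on ball y s" using G(1)[OF s(1,2)] by (simp add: inverse_branch_def)
      then have "g holomorphic_on ball y s" by (rule holomorphic_transform) (use geq[OF s(2)] in auto)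
      then have "g field_differentiable at w"
        using s(3) by (simp add: holomorphic_on_imp_differentiable_at)
      then show "g field_differentiable at w within ball y \<rho>" by (rule field_differentiable_at_within)
    qed
  qed
  have gy: "g y = z" using geq[of "\<rho>/2" y] G(2)[of "\<rho>/2"] \<rho> by simp
  have "\<rho> = r"
  proof (rule ccontr)
    assume "\<rho> \<noteq> r"
    then have lt: "\<rho> < r" using \<rho> by simp
    obtain \<delta> g' where g': "\<delta> > 0" "inverse_branch f (ball y (\<rho> + \<delta>)) g'" "g' y = g y"
    proof (rule inverse_branch_extend_ball[OF f \<rho>(1) gb])
      show "b \<notin> critical_values f \<union> asymptotic_values f" if "b \<in> cball y \<rho>" for b
        using that lt by (intro ns) (simp add: y_def)
    qed blast
    have "min (\<rho> + \<delta>) r \<in> T"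
      unfolding T_def P_def using g' gy \<rho> r by (auto intro!: exI[of _ g'] intro: inverse_branch_subset)
    then have "min (\<rho> + \<delta>) r \<le> \<rho>" unfolding \<rho>_def by (rule cSup_upper[OF _ bdd])
    then show False using g'(1) lt by simp
  qed
  then show thesis by (intro that[of g]) (use gb gy in \<open>simp_all add: y_def\<close>)
qed

section \<open>Logarithmic inverse branches on a half-plane\<close>

text \<open>Branches exist on every disk outside \<open>cball 0 R\<close>, and branches with a
  common value coincide, so the sheets are their images. Surjectivity comes from connectedness of
  the target: the image is open, and the disks of existence are large enough to make its complement
  in the target open as well.\<close>

lemma covering_space_outside_singular_values:
  assumes f: "f holomorphic_on UNIV" and R: "R > 0"
    and ns: "\<And>b. R < norm b \<Longrightarrow> b \<notin> critical_values f \<union> asymptotic_values f"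
    and unb: "\<exists>z. R < norm (f z)"
  shows "covering_space (f -` {w. R < norm w}) f {w. R < norm w}"
proof
  define S where "S = {w::complex. R < norm w}"
  define C where "C = f -` S"
  have br: "\<exists>g. inverse_branch f (ball (f z) r) g \<and> g (f z) = z" if "r > 0" "R + r \<le> norm (f z)" for z r
  proof -
    have "b \<notin> critical_values f \<union> asymptotic_values f" if b: "b \<in> ball (f z) r" for b
    proof (rule ns)
      have "norm (f z) - norm b \<le> dist (f z) b" unfolding dist_norm by (rule norm_triangle_ineq2)
      then show "R < norm b" using b \<open>R + r \<le> norm (f z)\<close> by simp
    qed
    then show ?thesis using inverse_branch_ball[OF f \<open>r > 0\<close>, of z] by blast
  qed
  have cf: "continuous_on A f" for A
    using f by (meson continuous_on_subset holomorphic_on_imp_continuous_on subset_UNIV)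
  then show "continuous_on (f -` {w. R < norm w}) f" .
  have oS: "open S" unfolding S_def by (intro open_Collect_less continuous_intros)
  have oC: "open C" unfolding C_def using open_vimage[OF oS] cf by blast
  have near: "y \<in> f ` C" if y: "y \<in> S" and z: "z \<in> C" "dist y (f z) < (norm y - R) / 3" for y z
  proof -
    define r where "r = norm (f z) - R"
    have "norm y - norm (f z) \<le> dist y (f z)" unfolding dist_norm by (rule norm_triangle_ineq2)
    then have r: "2 * (norm y - R) / 3 \<le> r" "0 < r" using z y by (auto simp: r_def S_def C_def)
    obtain g where g: "inverse_branch f (ball (f z) r) g" using br[of r z] r by (auto simp: r_def)
    have "y \<in> ball (f z) r" using z r y by (simp add: dist_commute S_def)
    then have "f (g y) = y" using g by (simp add: inverse_branch_def)
    moreover from this have "g y \<in> C" using y by (simp add: C_def)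
    ultimately show ?thesis by (metis imageI)
  qed
  have "connected S"
  proof -
    have "S = - cball 0 R" by (auto simp: S_def)
    then show ?thesis using connected_complement_bounded_convex[of "cball (0::complex) R"] by simp
  qed
  have fC: "f ` C \<subseteq> S" by (auto simp: C_def)
  show "f ` (f -` {w. R < norm w}) = {w. R < norm w}"
  proof (rule ccontr)
    assume ne: "\<not> ?thesis"
    define E1 where "E1 = S - f ` C"
    have "\<exists>e>0. ball y e \<subseteq> E1" if y: "y \<in> E1" for y
    proof -
      have "y \<in> S" using y by (simp add: E1_def)
      then obtain e where e: "e > 0" "ball y e \<subseteq> S" using oS openE by blast
      define d where "d = min e ((norm y - R) / 3)"
      have "d > 0" using e \<open>y \<in> S\<close> by (simp add: d_def S_def)
      moreover have "ball y d \<subseteq> E1"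
      proof
        fix w assume w: "w \<in> ball y d"
        then have "w \<in> S" using e by (auto simp: d_def)
        moreover have "w \<notin> f ` C" using near[OF \<open>y \<in> S\<close>] w y by (auto simp: E1_def d_def)
        ultimately show "w \<in> E1" by (simp add: E1_def)
      qed
      ultimately show ?thesis by blast
    qed
    then have "open E1" by (simp add: open_contains_ball)
    moreover have "open (f ` C)"
    proof (subst open_contains_ball, intro ballI)
      fix y assume "y \<in> f ` C"
      then obtain z where z: "z \<in> C" "y = f z" by blast
      define r where "r = norm y - R"
      have r: "r > 0" using z by (simp add: r_def C_def S_def)
      obtain g where g: "inverse_branch f (ball y r) g" using br[of r z] r z by (auto simp: r_def)
      have "ball y r \<subseteq> f ` C"
      proof
        fix w assume w: "w \<in> ball y r"
        have "norm y - norm w \<le> dist y w" unfolding dist_norm by (rule norm_triangle_ineq2)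
        then have "w \<in> S" using w by (simp add: r_def S_def)
        moreover have "f (g w) = w" using g w by (simp add: inverse_branch_def)
        moreover from calculation have "g w \<in> C" by (simp add: C_def)
        ultimately show "w \<in> f ` C" by (metis imageI)
      qed
      then show "\<exists>e>0. ball y e \<subseteq> f ` C" using r by blast
    qed
    moreover have "E1 \<inter> f ` C \<inter> S = {}" "S \<subseteq> E1 \<union> f ` C" by (auto simp: E1_def)
    moreover have "f ` C \<inter> S \<noteq> {}" using unb by (auto simp: C_def S_def)
    moreover have "E1 \<inter> S \<noteq> {}" using ne fC by (auto simp: E1_def S_def C_def)
    ultimately show False using \<open>connected S\<close> unfolding connected_def by blast
  qed
  fix y :: complex assume "y \<in> {w. R < norm w}"
  then have yS: "y \<in> S" by (simp add: S_def)
  \<comment> \<open>With a third of the distance from \<open>y\<close> to the circle, a value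
    \<open>f z\<close> in \<open>T\<close> still satisfies
    \<open>R + 2 * d \<le> norm (f z)\<close>, and its disk of radius \<open>2 * d\<close> contains
    all of \<open>T\<close>.\<close>
  define d where "d = (norm y - R) / 3"
  have d: "d > 0" using yS by (simp add: d_def S_def)
  define T where "T = ball y d"
  have TS: "T \<subseteq> S"
  proof
    fix w assume w: "w \<in> T"
    have "norm y - norm w \<le> dist y w" unfolding dist_norm by (rule norm_triangle_ineq2)
    then show "w \<in> S" using w yS by (simp add: T_def d_def S_def)
  qed
  have "\<exists>g. inverse_branch f T g \<and> g (f z) = z" if z: "f z \<in> T" for z
  proof -
    have "norm y - norm (f z) \<le> dist y (f z)" unfolding dist_norm by (rule norm_triangle_ineq2)
    then have "R + 2 * d \<le> norm (f z)" using z by (simp add: T_def d_def field_simps)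
    then obtain g where g: "inverse_branch f (ball (f z) (2 * d)) g" "g (f z) = z"
      using br[of "2 * d" z] d by auto
    have "T \<subseteq> ball (f z) (2 * d)"
    proof
      fix w assume "w \<in> T"
      then show "w \<in> ball (f z) (2 * d)"
        using z dist_triangle[of "f z" w y] by (simp add: T_def dist_commute)
    qed
    then show ?thesis using g inverse_branch_subset by blast
  qed
  then obtain G where G: "\<And>z. f z \<in> T \<Longrightarrow> inverse_branch f T (G z)" "\<And>z. f z \<in> T \<Longrightarrow> G z (f z) = z"
    by metis
  have uniq: "g w = h w" if "inverse_branch f T g" "inverse_branch f T h" "w0 \<in> T" "g w0 = h w0" "w \<in> T" for g h w0 w
    by (rule inverse_branch_unique[OF f that(1,2) _ _ that(3,4,5)]) (auto simp: T_def)
  define \<V> where "\<V> = (\<lambda>z. G z ` T) ` {z. f z \<in> T}"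
  show "\<exists>T. y \<in> T \<and> openin (top_of_set {w. R < norm w}) T \<and>
      (\<exists>v. \<Union>v = f -` {w. R < norm w} \<inter> f -` T \<and> (\<forall>u\<in>v. openin (top_of_set (f -` {w. R < norm w})) u) \<and>
        pairwise disjnt v \<and> (\<forall>u\<in>v. \<exists>q. homeomorphism u T f q))"
  proof (rule exI[of _ T], intro conjI exI[of _ \<V>])
    show "y \<in> T" using d by (simp add: T_def)
    show "openin (top_of_set {w. R < norm w}) T"
      using TS oS by (simp add: S_def[symmetric] T_def openin_open_eq)
    have Gf: "f (G z w) = w" if "f z \<in> T" "w \<in> T" for z w
      using G(1)[OF that(1)] that(2) by (simp add: inverse_branch_def)
    show "\<Union>\<V> = f -` {w. R < norm w} \<inter> f -` T"
    proof
      show "\<Union>\<V> \<subseteq> f -` {w. R < norm w} \<inter> f -` T"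
        using Gf TS by (auto simp: \<V>_def S_def)
      show "f -` {w. R < norm w} \<inter> f -` T \<subseteq> \<Union>\<V>"
      proof
        fix z assume "z \<in> f -` {w. R < norm w} \<inter> f -` T"
        then have "f z \<in> T" by simp
        then show "z \<in> \<Union>\<V>" using G(2)[of z] unfolding \<V>_def by (metis (mono_tags, lifting) UN_iff image_eqI mem_Collect_eq)
      qed
    qed
    have oG: "open (G z ` T)" "homeomorphism (G z ` T) T f (G z)" if "f z \<in> T" for z
    proof -
      have "G z holomorphic_on T" using G(1)[OF that] by (simp add: inverse_branch_def)
      moreover have "inj_on (G z) T" using Gf[OF that] by (metis inj_onI)
      ultimately show "open (G z ` T)" by (intro open_mapping_thm3) (auto simp: T_def)
      show "homeomorphism (G z ` T) T f (G z)"
        using \<open>G z holomorphic_on T\<close> Gf[OF that]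
        by (intro homeomorphismI cf holomorphic_on_imp_continuous_on) auto
    qed
    show "\<forall>u\<in>\<V>. openin (top_of_set (f -` {w. R < norm w})) u"
    proof
      fix u assume "u \<in> \<V>"
      then obtain z where z: "f z \<in> T" "u = G z ` T" by (auto simp: \<V>_def)
      then have "u \<subseteq> C" using Gf TS by (auto simp: C_def)
      then show "openin (top_of_set (f -` {w. R < norm w})) u"
        using oG(1)[OF z(1)] z(2) oC by (simp add: C_def S_def openin_open_eq)
    qed
    show "pairwise disjnt \<V>"
    proof (rule pairwiseI)
      fix u v assume "u \<in> \<V>" "v \<in> \<V>" and ne: "u \<noteq> v"
      then obtain z z' where z: "f z \<in> T" "u = G z ` T" "f z' \<in> T" "v = G z' ` T" by (auto simp: \<V>_def)
      show "disjnt u v"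
      proof (rule ccontr)
        assume "\<not> disjnt u v"
        then obtain w w' where w: "w \<in> T" "w' \<in> T" "G z w = G z' w'" using z by (auto simp: disjnt_def)
        then have "w = w'" using Gf z by metis
        then have "G z x = G z' x" if "x \<in> T" for x
          using uniq[OF G(1)[OF z(1)] G(1)[OF z(3)] w(1)] w that by blast
        then have "u = v" using z by auto
        then show False using ne by simp
      qed
    qed
    show "\<forall>u\<in>\<V>. \<exists>q. homeomorphism u T f q" using oG(2) by (auto simp: \<V>_def)
  qed
qed

text \<open>A lift \<open>G\<close> of \<open>exp\<close> with period \<open>2 * pi * \<i> * k\<close> would make \<open>1 / G\<close> a holomorphic function of
  \<open>\<sigma> = exp (- \<zeta> / k)\<close> near \<open>0\<close> that covers a neighbourhood of \<open>0\<close>; this bounds \<open>f\<close> by a power of the modulus.\<close>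
lemma periodic_exp_lift_imp_polynomial:
  assumes f: "f holomorphic_on UNIV" and G: "G holomorphic_on {\<zeta>. \<kappa> < Re \<zeta>}"
    and fG: "\<And>\<zeta>. \<kappa> < Re \<zeta> \<Longrightarrow> f (G \<zeta>) = exp \<zeta>" and nz: "\<And>\<zeta>. \<kappa> < Re \<zeta> \<Longrightarrow> G \<zeta> \<noteq> 0"
    and k: "k > 0" and per: "\<And>\<zeta>. \<kappa> < Re \<zeta> \<Longrightarrow> G (\<zeta> + 2 * of_real pi * \<i> * of_nat k) = G \<zeta>"
  shows "is_polynomial_fun f"
proof -
  define \<omega> where "\<omega> = 2 * of_real pi * \<i> * complex_of_nat k"
  have Re\<omega>: "Re \<omega> = 0" by (simp add: \<omega>_def)
  have pern: "G (\<zeta> + of_nat n * \<omega>) = G \<zeta>" if "\<kappa> < Re \<zeta>" for \<zeta> and n :: nat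
  proof (induction n)
    case (Suc n)
    have "G (\<zeta> + of_nat n * \<omega> + \<omega>) = G (\<zeta> + of_nat n * \<omega>)"
      unfolding \<omega>_def using that by (intro per) simp
    then show ?case using Suc by (simp add: algebra_simps)
  qed simp
  have peri: "G (\<zeta> + of_int n * \<omega>) = G \<zeta>" if "\<kappa> < Re \<zeta>" for \<zeta> and n :: int
  proof (cases "n \<ge> 0")
    case True
    then show ?thesis using pern[OF that, of "nat n"] by simp
  next
    case False
    then have "G (\<zeta> + of_int n * \<omega> + of_nat (nat (- n)) * \<omega>) = G (\<zeta> + of_int n * \<omega>)"
      by (intro pern) (use that Re\<omega> in simp)
    moreover have "\<zeta> + of_int n * \<omega> + of_nat (nat (- n)) * \<omega> = \<zeta>" using False by simp
    ultimately show ?thesis by simp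
  qed
  define r0 where "r0 = exp (- \<kappa> / real k)"
  have r0: "r0 > 0" by (simp add: r0_def)
  \<comment> \<open>\<open>q\<close> is \<open>1 / G\<close> in the coordinate
    \<open>\<sigma>\<close>. Two logarithms of \<open>\<sigma>\<close> give values of
    \<open>\<zeta>\<close> that differ by a multiple of the period, so the principal one may be
    used. \<open>Re \<zeta>\<close> tending to infinity corresponds to \<open>\<sigma>\<close>
    tending to \<open>0\<close>, where \<open>1 / G\<close> tends to \<open>0\<close>.\<close>
  define q where "q = (\<lambda>\<sigma>. if \<sigma> = 0 then 0 else 1 / G (- of_nat k * Ln \<sigma>))"
  have Re_iff: "\<kappa> < Re \<zeta>" if "norm (exp (- \<zeta> / of_nat k)) < r0" for \<zeta>
    using that k by (simp add: r0_def Re_divide_of_nat field_simps)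
  have qval: "q (exp (- \<zeta> / of_nat k)) = 1 / G \<zeta>" if "norm (exp (- \<zeta> / of_nat k)) < r0" for \<zeta>
  proof -
    define \<sigma> where "\<sigma> = exp (- \<zeta> / complex_of_nat k)"
    have "exp (Ln \<sigma>) = exp (- \<zeta> / of_nat k)" by (simp add: \<sigma>_def)
    then obtain n :: int where n: "Ln \<sigma> = - \<zeta> / of_nat k + (of_int (2 * n) * pi) * \<i>"
      unfolding exp_eq by blast
    have "- of_nat k * Ln \<sigma> = \<zeta> + of_int (- n) * \<omega>"
      using k unfolding n \<omega>_def by (simp add: field_simps)
    then show ?thesis
      using peri[OF Re_iff[OF that], of "- n"] by (simp add: q_def \<sigma>_def)
  qed
  have surj: "\<exists>\<zeta>. \<sigma> = exp (- \<zeta> / of_nat k)" if "\<sigma> \<noteq> 0" for \<sigma> :: complex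
    using that k by (intro exI[of _ "- of_nat k * Ln \<sigma>"]) simp
  have Glarge: "\<exists>c. \<forall>\<zeta>. \<kappa> < Re \<zeta> \<and> c < Re \<zeta> \<longrightarrow> K < norm (G \<zeta>)" for K
  proof -
    have "compact (f ` cball 0 K)"
      using f by (intro compact_continuous_image holomorphic_on_imp_continuous_on)
        (auto intro: holomorphic_on_subset)
    then obtain M where M: "\<And>z. norm z \<le> K \<Longrightarrow> norm (f z) \<le> M" "M > 0"
      using compact_imp_bounded bounded_pos by (metis image_eqI mem_cball_0)
    have "K < norm (G \<zeta>)" if "\<kappa> < Re \<zeta>" "ln M < Re \<zeta>" for \<zeta>
    proof (rule ccontr)
      assume "\<not> ?thesis"
      then have "norm (exp \<zeta>) \<le> M" using M(1)[of "G \<zeta>"] fG that by simp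
      moreover have "M < exp (Re \<zeta>)" using that(2) M(2) by (metis exp_less_mono exp_ln)
      ultimately show False by simp
    qed
    then show ?thesis by blast
  qed
  have hq: "q holomorphic_on ball 0 r0 - {0}"
  proof (rule holomorphic_onI)
    fix \<sigma>0 :: complex assume s0: "\<sigma>0 \<in> ball 0 r0 - {0}"
    define N where "N = ball \<sigma>0 (norm \<sigma>0) \<inter> ball 0 r0"
    \<comment> \<open>\<open>Ln (\<sigma> / \<sigma>0) + Ln \<sigma>0\<close> is a logarithm of
      \<open>\<sigma>\<close> that is holomorphic near \<open>\<sigma>0\<close>, also when
      \<open>\<sigma>0\<close> is on the cut of \<open>Ln\<close>.\<close>
    define Z where "Z = (\<lambda>\<sigma>. - of_nat k * (Ln (\<sigma> / \<sigma>0) + Ln \<sigma>0))"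
    have cut: "\<sigma> / \<sigma>0 \<notin> \<real>\<^sub>\<le>\<^sub>0" if "\<sigma> \<in> N" for \<sigma>
    proof -
      have "norm (\<sigma> / \<sigma>0 - 1) = dist \<sigma>0 \<sigma> / norm \<sigma>0"
      proof -
        have "\<sigma> / \<sigma>0 - 1 = (\<sigma> - \<sigma>0) / \<sigma>0" using s0 by (simp add: diff_divide_distrib)
        then show ?thesis by (simp only: norm_divide dist_norm norm_minus_commute)
      qed
      also have "\<dots> < 1" using that s0 by (simp add: N_def)
      finally have "\<bar>Re (\<sigma> / \<sigma>0 - 1)\<bar> < 1" using abs_Re_le_cmod le_less_trans by blast
      then have "0 < Re (\<sigma> / \<sigma>0)" by simp
      then show ?thesis by (metis complex_nonpos_Reals_iff not_le)
    qed
    have expZ: "exp (- Z \<sigma> / of_nat k) = \<sigma>" if "\<sigma> \<in> N" for \<sigma>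
    proof -
      have "\<sigma> / \<sigma>0 \<noteq> 0" using cut[OF that] by (metis complex_nonpos_Reals_iff order_refl zero_complex.sel)
      then show ?thesis using k s0 by (simp add: Z_def exp_add)
    qed
    have Zin: "\<kappa> < Re (Z \<sigma>)" if "\<sigma> \<in> N" for \<sigma>
      using expZ[OF that] that by (intro Re_iff) (simp add: N_def)
    have "(\<lambda>\<sigma>. 1 / G (Z \<sigma>)) holomorphic_on N"
    proof (intro holomorphic_intros)
      have "Z holomorphic_on N" unfolding Z_def using cut s0 by (intro holomorphic_intros) auto
      then show "(\<lambda>\<sigma>. G (Z \<sigma>)) holomorphic_on N"
        using holomorphic_on_compose_gen[OF _ G, of Z N] Zin by (auto simp: o_def)
    qed (use Zin nz in auto)
    moreover have "1 / G (Z \<sigma>) = q \<sigma>" if "\<sigma> \<in> N" for \<sigma>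
      using qval[of "Z \<sigma>", unfolded expZ[OF that]] that by (simp add: N_def)
    ultimately have "q holomorphic_on N" by (rule holomorphic_transform)
    moreover have "open N" "\<sigma>0 \<in> N" using s0 by (auto simp: N_def)
    ultimately have "q field_differentiable at \<sigma>0" by (simp add: holomorphic_on_imp_differentiable_at)
    then show "q field_differentiable at \<sigma>0 within ball 0 r0 - {0}" by (rule field_differentiable_at_within)
  qed
  have lim: "(q \<longlongrightarrow> q 0) (at 0 within ball 0 r0)"
    unfolding tendsto_iff eventually_at
  proof (intro allI impI)
    fix e :: real assume e: "e > 0"
    obtain c where c: "\<And>\<zeta>. \<kappa> < Re \<zeta> \<Longrightarrow> c < Re \<zeta> \<Longrightarrow> 1 / e < norm (G \<zeta>)" using Glarge by blast
    show "\<exists>d>0. \<forall>\<sigma>\<in>ball 0 r0. \<sigma> \<noteq> 0 \<and> dist \<sigma> 0 < d \<longrightarrow> dist (q \<sigma>) (q 0) < e"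
    proof (intro exI conjI ballI impI)
      show "0 < exp (- c / real k)" by simp
      fix \<sigma> :: complex assume s: "\<sigma> \<in> ball 0 r0" "\<sigma> \<noteq> 0 \<and> dist \<sigma> 0 < exp (- c / real k)"
      then obtain \<zeta> where z: "\<sigma> = exp (- \<zeta> / of_nat k)" using surj by blast
      have n: "norm (exp (- \<zeta> / complex_of_nat k)) < r0" using s z by simp
      have "norm (exp (- \<zeta> / complex_of_nat k)) < exp (- c / real k)" using s z by simp
      then have "c < Re \<zeta>" using k by (simp add: Re_divide_of_nat field_simps)
      then have "1 / e < norm (G \<zeta>)" using c Re_iff[OF n] by blast
      moreover have "G \<zeta> \<noteq> 0" using nz Re_iff[OF n] by blast
      ultimately have "norm (1 / G \<zeta>) < e" using e by (simp add: norm_divide field_simps)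
      then show "dist (q \<sigma>) (q 0) < e" using qval[OF n] z by (simp add: q_def)
    qed
  qed
  have hol: "q holomorphic_on ball 0 r0"
    by (rule no_isolated_singularity'[where K = "{0}"]) (use lim hq in auto)
  have "q field_differentiable at 0"
    using hol r0 by (simp add: holomorphic_on_imp_differentiable_at)
  then obtain D where "(q has_field_derivative D) (at 0)" by (auto simp: field_differentiable_def)
  then have "((\<lambda>\<sigma>. (q \<sigma> - q 0) / (\<sigma> - 0)) \<longlongrightarrow> D) (at 0)" by (simp add: has_field_derivative_iff)
  then have "eventually (\<lambda>\<sigma>. dist ((q \<sigma> - q 0) / (\<sigma> - 0)) D < 1) (at 0)" by (simp add: tendsto_iff)
  then obtain d where d: "d > 0" "\<And>\<sigma>. \<sigma> \<noteq> 0 \<Longrightarrow> dist \<sigma> 0 < d \<Longrightarrow> dist (q \<sigma> / \<sigma>) D < 1"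
    unfolding eventually_at by (auto simp: q_def)
  define s where "s = min d r0"
  have s: "s > 0" "s \<le> d" "s \<le> r0" using d r0 by (auto simp: s_def)
  define C where "C = norm D + 1"
  have C: "C > 0" by (simp add: C_def add_nonneg_pos)
  have qle: "norm (q \<sigma>) \<le> C * norm \<sigma>" if "\<sigma> \<noteq> 0" "norm \<sigma> < s" for \<sigma>
  proof -
    have "norm (q \<sigma> / \<sigma>) \<le> norm D + norm (q \<sigma> / \<sigma> - D)" by (rule norm_triangle_sub)
    also have "\<dots> \<le> C" using d(2)[of \<sigma>] that s by (simp add: C_def dist_norm)
    finally show ?thesis using that by (simp add: norm_divide field_simps)
  qed
  have qnz: "q \<sigma> \<noteq> 0" if "\<sigma> \<noteq> 0" "norm \<sigma> < r0" for \<sigma>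
  proof -
    obtain \<zeta> where z: "\<sigma> = exp (- \<zeta> / of_nat k)" using surj \<open>\<sigma> \<noteq> 0\<close> by blast
    then show ?thesis using qval[of \<zeta>] nz[OF Re_iff[of \<zeta>]] that by simp
  qed
  have "open (q ` ball 0 s)"
  proof (rule open_mapping_thm[OF hol])
    show "\<not> q constant_on ball 0 r0"
    proof
      assume "q constant_on ball 0 r0"
      then have "q (of_real (r0 / 2)) = q 0" using r0 by (auto simp: constant_on_def)
      then show False using qnz[of "of_real (r0 / 2)"] r0 by (simp add: q_def)
    qed
  qed (use s in auto)
  moreover have "0 \<in> q ` ball 0 s" using s by (auto simp: q_def image_iff intro!: bexI[of _ 0])
  ultimately obtain e where e: "e > 0" "ball 0 e \<subseteq> q ` ball 0 s" using openE by blast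
  \<comment> \<open>By openness every small \<open>1 / z\<close> is some \<open>q \<sigma>\<close>,
    so \<open>z = G \<zeta>\<close>. The linear bound on \<open>q\<close> gives
    \<open>1 / norm \<sigma> \<le> C * norm z\<close>, while
    \<open>norm (f z) = exp (Re \<zeta>) = (1 / norm \<sigma>) ^ k\<close>.\<close>
  have bound: "norm (f z) \<le> C ^ k * norm z ^ k" if z: "1 / e + 1 \<le> norm z" for z
  proof -
    have zpos: "norm z > 0" using z e by (smt (verit) divide_pos_pos)
    have "1 / e < norm z" using z by simp
    then have "norm (1 / z) < e" using e zpos by (simp add: norm_divide field_simps)
    then obtain \<sigma> where \<sigma>: "norm \<sigma> < s" "1 / z = q \<sigma>" using e(2) by (auto simp: subset_iff image_iff)
    have "\<sigma> \<noteq> 0" using \<sigma> zpos by (auto simp: q_def)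
    then obtain \<zeta> where \<zeta>: "\<sigma> = exp (- \<zeta> / of_nat k)" using surj by blast
    have n: "norm (exp (- \<zeta> / complex_of_nat k)) < r0" using \<sigma> s \<zeta> by simp
    have "1 / z = 1 / G \<zeta>" using qval[OF n] \<sigma> \<zeta> by simp
    then have "z = G \<zeta>" by simp
    then have "norm (f z) = exp (Re \<zeta>)" using fG Re_iff[OF n] by simp
    also have "\<dots> = (1 / norm \<sigma>) ^ k"
    proof -
      have "norm \<sigma> = exp (- (Re \<zeta> / real k))" by (simp add: \<zeta> Re_divide_of_nat)
      then have "1 / norm \<sigma> = exp (Re \<zeta> / real k)" by (simp add: exp_minus divide_inverse)
      then have "(1 / norm \<sigma>) ^ k = exp (real k * (Re \<zeta> / real k))" by (simp only: exp_of_nat_mult)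
      then show ?thesis using k by simp
    qed
    also have "\<dots> \<le> (C * norm z) ^ k"
    proof (rule power_mono)
      have "1 / norm z \<le> C * norm \<sigma>" using qle[OF \<open>\<sigma> \<noteq> 0\<close> \<sigma>(1)] \<sigma>(2) by (metis norm_divide norm_one)
      then show "1 / norm \<sigma> \<le> C * norm z" using zpos \<open>\<sigma> \<noteq> 0\<close> by (simp add: field_simps)
    qed simp
    finally show ?thesis by (simp add: power_mult_distrib)
  qed
  have "\<forall>\<xi>. f \<xi> = (\<Sum>j\<le>k. (deriv ^^ j) f 0 / fact j * \<xi> ^ j)"
    by (intro allI Liouville_polynomial[OF f bound])
  then show ?thesis unfolding is_polynomial_fun_def
    by (intro exI[of _ k] exI[of _ "\<lambda>j. (deriv ^^ j) f 0 / fact j"])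
qed

text \<open>\<open>L\<close> is a branch of the inverse of \<open>f\<close> in logarithmic
  coordinates, selected by one prescribed value \<open>\<omega>\<close>. The derivative bound is the
  expansion estimate of Eremenko and Lyubich read for the inverse; its constant combines the 12 of
  Bloch's theorem with half the period \<open>2 * pi\<close> of \<open>exp\<close>.\<close>

definition log_inverses :: "(complex \<Rightarrow> complex) \<Rightarrow> real \<Rightarrow> bool" where
  "log_inverses f \<kappa> \<longleftrightarrow> (\<forall>\<omega> \<zeta>0. \<kappa> < Re \<zeta>0 \<longrightarrow> f (exp \<omega>) = exp \<zeta>0 \<longrightarrow>
     (\<exists>L. L holomorphic_on {\<zeta>. \<kappa> < Re \<zeta>} \<and> inj_on L {\<zeta>. \<kappa> < Re \<zeta>} \<and> L \<zeta>0 = \<omega> \<and>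
       (\<forall>\<zeta>. \<kappa> < Re \<zeta> \<longrightarrow> f (exp (L \<zeta>)) = exp \<zeta> \<and> norm (deriv L \<zeta>) \<le> 12 * pi / (Re \<zeta> - \<kappa>))))"

text \<open>The half-plane is simply connected, so \<open>exp\<close> lifts through the covering
  \<open>f\<close>. Two points with the same lift differ by a multiple of
  \<open>2 * pi * \<i>\<close>; uniqueness of lifts turns this into a period, and \<open>f\<close>
  would be a polynomial. Hence the lift is injective, and so is its logarithm.\<close>

lemma class_B_log_inverses:
  assumes "class_B f"
  obtains \<kappa> where "log_inverses f \<kappa>"
proof -
  have tr: "transcendental_entire f" and bd: "bounded (singular_values f)"
    using assms by (auto simp: class_B_def)
  have f: "f holomorphic_on UNIV" and np: "\<not> is_polynomial_fun f"
    using tr by (auto simp: transcendental_entire_def entire_def)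
  obtain B where B: "\<And>b. b \<in> singular_values f \<Longrightarrow> norm b \<le> B" using bd bounded_iff by blast
  \<comment> \<open>\<open>norm (f 0) \<le> R\<close> keeps \<open>0\<close> out of
    \<open>C\<close>, so that the lift has a logarithm.\<close>
  define R where "R = max (max B (norm (f 0))) 2"
  have R: "B \<le> R" "norm (f 0) \<le> R" "2 \<le> R" by (auto simp: R_def)
  define \<kappa> where "\<kappa> = ln R"
  have \<kappa>: "\<kappa> > 0" "exp \<kappa> = R" using R by (auto simp: \<kappa>_def)
  have ns: "b \<notin> critical_values f \<union> asymptotic_values f" if "R < norm b" for b
  proof
    assume "b \<in> critical_values f \<union> asymptotic_values f"
    then have "b \<in> singular_values f"
      unfolding singular_values_def by (rule subsetD[OF closure_subset])
    then have "norm b \<le> B" by (rule B)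
    then show False using R(1) that by linarith
  qed
  have unb: "\<exists>z. R < norm (f z)"
  proof (rule ccontr)
    assume "\<not> ?thesis"
    then have "bounded (range f)" by (intro boundedI[of _ R]) (auto simp: not_less)
    then show False using Liouville_theorem[OF f] transcendental_not_constant[OF tr] by blast
  qed
  define S where "S = {w::complex. R < norm w}"
  define C where "C = f -` S"
  have cov: "covering_space C f S"
    unfolding C_def S_def by (rule covering_space_outside_singular_values[OF f _ ns unb]) (use R in auto)
  define H where "H = {\<zeta>. \<kappa> < Re \<zeta>}"
  have oH: "open H" and cH: "convex H"
    unfolding H_def by (simp_all add: open_halfspace_Re_gt convex_halfspace_Re_gt)
  have expH: "exp \<zeta> \<in> S" if "\<zeta> \<in> H" for \<zeta>
    using that \<kappa>(2) by (simp add: H_def S_def) (metis exp_less_mono)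
  have "\<exists>L. L holomorphic_on H \<and> inj_on L H \<and> L \<zeta>0 = \<omega> \<and>
       (\<forall>\<zeta>. \<kappa> < Re \<zeta> \<longrightarrow> f (exp (L \<zeta>)) = exp \<zeta> \<and> norm (deriv L \<zeta>) \<le> 12 * pi / (Re \<zeta> - \<kappa>))"
    if z0: "\<zeta>0 \<in> H" "f (exp \<omega>) = exp \<zeta>0" for \<omega> \<zeta>0
  proof -
    have aC: "exp \<omega> \<in> C" using z0 expH by (simp add: C_def)
    obtain G where G: "continuous_on H G" "G \<in> H \<rightarrow> C" "G \<zeta>0 = exp \<omega>" "\<And>\<zeta>. \<zeta> \<in> H \<Longrightarrow> f (G \<zeta>) = exp \<zeta>"
    proof (rule covering_space_lift_strong[OF cov aC z0(1), of exp])
      show "simply_connected H" "locally path_connected H"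
        using cH by (auto intro: convex_imp_simply_connected convex_imp_locally_path_connected)
      show "exp \<in> H \<rightarrow> S" using expH by auto
    qed (use z0 in \<open>auto intro: continuous_intros\<close>)
    have holG: "G holomorphic_on H"
    proof (rule holomorphic_onI)
      fix \<zeta> assume z: "\<zeta> \<in> H"
      have "deriv f (G \<zeta>) \<noteq> 0"
        using ns[of "f (G \<zeta>)"] expH[OF z] G(4)[OF z] by (auto simp: critical_values_def S_def)
      then obtain r \<epsilon> h where h: "r > 0" "\<epsilon> > 0" "inverse_branch f (ball (f (G \<zeta>)) \<epsilon>) h"
        "\<And>z. z \<in> ball (G \<zeta>) r \<Longrightarrow> h (f z) = z"
        using local_inverse_branch[OF f] by metis
      define N where "N = (H \<inter> G -` ball (G \<zeta>) r) \<inter> exp -` ball (f (G \<zeta>)) \<epsilon>"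
      have "open N"
        unfolding N_def
        by (intro open_Int continuous_open_preimage[OF G(1) oH] open_vimage open_ball continuous_intros)
      moreover have "\<zeta> \<in> N" using z h G(4)[OF z] by (simp add: N_def)
      moreover have "G holomorphic_on N"
      proof (rule holomorphic_transform[of "\<lambda>w. h (exp w)"])
        show "(\<lambda>w. h (exp w)) holomorphic_on N"
          using h(3) by (intro holomorphic_on_compose_gen[of exp N h, unfolded o_def] holomorphic_intros)
            (auto simp: N_def inverse_branch_def)
        show "h (exp w) = G w" if "w \<in> N" for w
          using that h(4)[of "G w"] G(4)[of w] by (simp add: N_def)
      qed
      ultimately have "G field_differentiable at \<zeta>" by (simp add: holomorphic_on_imp_differentiable_at)
      then show "G field_differentiable at \<zeta> within H" by (rule field_differentiable_at_within)
    qed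
    have Gnz: "G \<zeta> \<noteq> 0" if "\<zeta> \<in> H" for \<zeta>
      using G(4)[OF that] expH[OF that] R(2) by (auto simp: S_def)
    have nper: False if "\<zeta>1 \<in> H" "\<zeta>2 = \<zeta>1 + 2 * of_real pi * \<i> * of_nat k" "k > 0" "G \<zeta>1 = G \<zeta>2" for \<zeta>1 \<zeta>2 and k :: nat
    proof -
      define \<omega>1 where "\<omega>1 = 2 * of_real pi * \<i> * complex_of_nat k"
      have sh: "\<zeta> + \<omega>1 \<in> H" if "\<zeta> \<in> H" for \<zeta> using that by (simp add: H_def \<omega>1_def)
      have e: "exp (\<zeta> + \<omega>1) = exp \<zeta>" for \<zeta>
        unfolding exp_eq by (intro exI[of _ "int k"]) (simp add: \<omega>1_def)
      have "G (\<zeta> + \<omega>1) = G \<zeta>" if "\<zeta> \<in> H" for \<zeta>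
      proof (rule covering_space_lift_unique[OF cov, where f = exp and T = H and a = \<zeta>1 and x = \<zeta>
          and ?g1.0 = "\<lambda>\<zeta>. G (\<zeta> + \<omega>1)" and ?g2.0 = G])
        show "continuous_on H (\<lambda>\<zeta>. G (\<zeta> + \<omega>1))"
          using sh by (intro continuous_on_compose2[OF G(1)] continuous_intros) auto
        show "(\<lambda>\<zeta>. G (\<zeta> + \<omega>1)) \<in> H \<rightarrow> C" using sh G(2) by auto
        show "G (\<zeta>1 + \<omega>1) = G \<zeta>1" using that by (simp add: \<omega>1_def \<open>G \<zeta>1 = G \<zeta>2\<close> \<open>\<zeta>2 = _\<close>)
        show "connected H" using cH by (rule convex_connected)
        show "exp \<zeta> = f (G (\<zeta> + \<omega>1))" if "\<zeta> \<in> H" for \<zeta> using G(4)[OF sh[OF that]] e by simp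
      qed (use G expH that \<open>\<zeta>1 \<in> H\<close> in \<open>auto intro: continuous_intros\<close>)
      then have "is_polynomial_fun f"
        using holG G(4) Gnz \<open>k > 0\<close> unfolding H_def \<omega>1_def
        by (intro periodic_exp_lift_imp_polynomial[OF f, of G \<kappa> k]) auto
      then show False using np by simp
    qed
    have injG: "\<zeta>1 = \<zeta>2" if z: "\<zeta>1 \<in> H" "\<zeta>2 \<in> H" "G \<zeta>1 = G \<zeta>2" for \<zeta>1 \<zeta>2
    proof -
      have "exp \<zeta>2 = exp \<zeta>1" using G(4) z by metis
      then obtain n :: int where n: "\<zeta>2 = \<zeta>1 + (of_int (2 * n) * pi) * \<i>" unfolding exp_eq by blast
      consider "n = 0" | "n > 0" | "n < 0" by linarith
      then show ?thesis
      proof cases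
        case 2
        then have "\<zeta>2 = \<zeta>1 + 2 * of_real pi * \<i> * of_nat (nat n)" using n by simp
        then show ?thesis using nper[OF z(1), of \<zeta>2 "nat n"] 2 z by simp
      next
        case 3
        then have "\<zeta>1 = \<zeta>2 + 2 * of_real pi * \<i> * of_nat (nat (- n))" using n by simp
        then show ?thesis using nper[OF z(2), of \<zeta>1 "nat (- n)"] 3 z by simp
      qed (use n in simp)
    qed
    obtain L0 where L0: "L0 holomorphic_on H" "\<And>\<zeta>. \<zeta> \<in> H \<Longrightarrow> G \<zeta> = exp (L0 \<zeta>)"
      using contractible_imp_holomorphic_log[OF holG convex_imp_contractible[OF cH] Gnz] by blast
    define L where "L = (\<lambda>\<zeta>. L0 \<zeta> + (\<omega> - L0 \<zeta>0))"
    have L: "L holomorphic_on H" unfolding L_def by (intro holomorphic_intros L0)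
    have expL: "exp (L \<zeta>) = G \<zeta>" if "\<zeta> \<in> H" for \<zeta>
      using L0(2)[OF that] L0(2)[OF z0(1)] G(3) by (simp add: L_def exp_add exp_diff)
    have der: "norm (deriv L \<zeta>) \<le> 12 * pi / (Re \<zeta> - \<kappa>)" if z: "\<zeta> \<in> H" for \<zeta>
    proof (rule ccontr)
      define \<rho> where "\<rho> = Re \<zeta> - \<kappa>"
      have \<rho>: "\<rho> > 0" using z by (simp add: \<rho>_def H_def)
      assume "\<not> ?thesis"
      then have big: "pi < \<rho> * norm (deriv L \<zeta>) / 12" using \<rho> by (simp add: \<rho>_def field_simps)
      have sub: "ball \<zeta> \<rho> \<subseteq> H"
      proof
        fix w assume "w \<in> ball \<zeta> \<rho>"
        then have "\<bar>Re (\<zeta> - w)\<bar> < \<rho>" using abs_Re_le_cmod[of "\<zeta> - w"] by (simp add: dist_norm)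
        then show "w \<in> H" by (auto simp: \<rho>_def H_def)
      qed
      \<comment> \<open>Bloch's disk in the image has radius above \<open>pi\<close>, so it contains
        two points differing by \<open>2 * pi * \<i>\<close>. They have the same exponential,
        against the injectivity of \<open>G\<close>.\<close>
      obtain b where b: "ball b (\<rho> * norm (deriv L \<zeta>) / 12) \<subseteq> L ` ball \<zeta> \<rho>"
        using Bloch[OF holomorphic_on_subset[OF L sub] \<rho> order_refl] by blast
      have "b + of_real pi * \<i> \<in> L ` ball \<zeta> \<rho>" "b - of_real pi * \<i> \<in> L ` ball \<zeta> \<rho>"
        using b big by (auto simp: subset_iff dist_norm norm_mult)
      then obtain \<zeta>1 \<zeta>2 where "\<zeta>1 \<in> ball \<zeta> \<rho>" "b + of_real pi * \<i> = L \<zeta>1"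
          "\<zeta>2 \<in> ball \<zeta> \<rho>" "b - of_real pi * \<i> = L \<zeta>2"
        by (elim imageE)
      then have z12: "\<zeta>1 \<in> H" "\<zeta>2 \<in> H" "L \<zeta>1 = b + of_real pi * \<i>" "L \<zeta>2 = b - of_real pi * \<i>"
        using sub by auto
      have "exp (L \<zeta>1) = exp (L \<zeta>2)"
        unfolding exp_eq by (intro exI[of _ 1]) (simp add: z12)
      then have "\<zeta>1 = \<zeta>2" using injG z12 expL by metis
      then have "b + of_real pi * \<i> = b - of_real pi * \<i>" using z12(3,4) by simp
      then show False by (simp add: complex_eq_iff)
    qed
    show ?thesis
    proof (intro exI[of _ L] conjI allI impI)
      show "inj_on L H" using injG expL by (metis inj_onI)
      show "L \<zeta>0 = \<omega>" by (simp add: L_def)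
    qed (use L der expL G(4) in \<open>auto simp: H_def\<close>)
  qed
  then show thesis using that[of \<kappa>] unfolding log_inverses_def H_def by blast
qed

section \<open>Bounded distortion of univalent functions\<close>

text \<open>Schottky's bound for modulus at most 1 at the centre and relative radius
  \<open>1/2\<close> has the inner factor \<open>2 + 2 + 12 = 16\<close>. It bounds the square root
  \<open>q\<close>, and then \<open>g = b * (1 - q\<^sup>2)\<close> with
  \<open>norm b < 2\<close>.\<close>

definition univalent_bound :: real where
  "univalent_bound = 2 * (1 + (exp (pi * exp (pi * 16)))\<^sup>2)"

text \<open>If \<open>g\<close> omits \<open>b\<close>, a square root \<open>q\<close> of \<open>1 - g / b\<close> omits \<open>0\<close> and \<open>- q 0\<close>, so Schottky applies.\<close>
lemma normalized_univalent_bound: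
  assumes g: "g holomorphic_on ball 0 1" "inj_on g (ball 0 1)" "g 0 = 0" "deriv g 0 = 1"
    and z: "norm z \<le> 1/4"
  shows "norm (g z) \<le> univalent_bound"
proof -
  \<comment> \<open>If \<open>g\<close> covered the disk of radius 2, its rescaled inverse would map
    the unit disk into itself with derivative 2 at \<open>0\<close>, against the Schwarz
    lemma.\<close>
  have "\<exists>b. b \<notin> g ` ball 0 1 \<and> norm b < 2"
  proof (rule ccontr)
    assume "\<not> ?thesis"
    then have sub: "ball 0 2 \<subseteq> g ` ball 0 1" by auto
    obtain k where k: "k holomorphic_on g ` ball 0 1" "\<And>z. z \<in> ball 0 1 \<Longrightarrow> deriv g z * deriv k (g z) = 1"
        "\<And>z. z \<in> ball 0 1 \<Longrightarrow> k (g z) = z"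
      by (rule holomorphic_has_inverse[OF g(1) open_ball g(2)]) (rule that)
    have k0: "k 0 = 0" "deriv k 0 = 1" using k(2,3)[of 0] g(3,4) by auto
    have hk: "k holomorphic_on ball 0 2" using k(1) sub by (rule holomorphic_on_subset)
    define h where "h = (\<lambda>z. k (2 * z))"
    have "(k has_field_derivative 1) (at (2 * 0))"
      using holomorphic_derivI[OF hk open_ball, of 0] k0 by simp
    then have "(h has_field_derivative 1 * 2) (at 0)"
      unfolding h_def by (rule DERIV_chain2) (auto intro!: derivative_eq_intros)
    then have dh: "deriv h 0 = 2" by (simp add: DERIV_imp_deriv)
    have "norm (deriv h 0) \<le> 1"
    proof (rule Schwarz_Lemma(2)[where f = h and \<xi> = 0])
      show "h holomorphic_on ball 0 1"
        unfolding h_def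
        by (intro holomorphic_on_compose_gen[OF _ hk, unfolded o_def] holomorphic_intros) (auto simp: norm_mult)
      show "h 0 = 0" by (simp add: h_def k0)
      show "norm (h z) < 1" if "norm z < 1" for z
      proof -
        have "2 * z \<in> ball 0 2" using that by (simp add: norm_mult)
        then obtain w where "w \<in> ball 0 1" "2 * z = g w" using sub by blast
        then show ?thesis using k(3) by (simp add: h_def)
      qed
    qed simp
    then show False using dh by simp
  qed
  then obtain b where b: "b \<notin> g ` ball 0 1" "norm b < 2" by blast
  have b0: "b \<noteq> 0" using b(1) g(3) by (metis centre_in_ball imageI zero_less_one)
  have "(\<lambda>z. 1 - g z / b) holomorphic_on ball 0 1" using b0 by (intro holomorphic_intros g) auto
  moreover have "1 - g z / b \<noteq> 0" if "z \<in> ball 0 1" for z using b b0 that by (auto simp: field_simps)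
  ultimately obtain q where q: "q holomorphic_on ball 0 1" "\<And>z. z \<in> ball 0 1 \<Longrightarrow> 1 - g z / b = q z ^ 2"
    using contractible_imp_holomorphic_sqrt[of "\<lambda>z. 1 - g z / b" "ball 0 1"] convex_imp_contractible[OF convex_ball]
    by blast
  have q0: "q 0 ^ 2 = 1" using q(2)[of 0] g(3) by simp
  then have q0n: "q 0 \<noteq> 0" "norm (q 0) = 1" by (auto simp: power2_eq_1_iff)
  \<comment> \<open>\<open>F z = 1\<close> would mean \<open>q (z / 2) = - q 0\<close>, hence
    \<open>g (z / 2) = g 0\<close> and \<open>z = 0\<close> by injectivity, which is impossible as
    \<open>q 0 \<noteq> 0\<close>. Halving the argument makes \<open>F\<close> holomorphic on the
    closed unit disk.\<close>
  define F where "F = (\<lambda>z. - q (z / 2) / q 0)"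
  have half: "z / 2 \<in> ball 0 1" if "z \<in> cball 0 1" for z :: complex using that by (simp add: norm_divide)
  define K where "K = exp (pi * exp (pi * 16))"
  have "norm (F (2 * z)) \<le> exp (pi * exp (pi * (2 + 2 * 1 + 12 * (1/2) / (1 - 1/2))))"
  proof (rule Schottky[where f = F and z = "2 * z" and t = "1/2" and r = 1])
    show "F holomorphic_on cball 0 1"
      unfolding F_def using half q0n
      by (intro holomorphic_intros holomorphic_on_compose_gen[OF _ q(1), unfolded o_def]) auto
    show "norm (F 0) \<le> 1" using q0n by (simp add: F_def)
    show "\<not> (F z = 0 \<or> F z = 1)" if "z \<in> cball 0 1" for z
    proof
      assume "F z = 0 \<or> F z = 1"
      then show False
      proof
        assume "F z = 0"
        then have "q (z / 2) = 0" using q0n by (simp add: F_def)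
        then have "g (z / 2) = b" using q(2)[OF half[OF that]] b0 by (simp add: field_simps)
        then show False using b(1) half[OF that] by blast
      next
        assume "F z = 1"
        then have "- q (z / 2) = q 0" using q0n by (simp add: F_def field_simps)
        then have e: "q (z / 2) = - q 0" by (metis minus_minus)
        then have "g (z / 2) = g 0" using q(2)[OF half[OF that]] q0 b0 g(3) by simp
        then have "z / 2 = 0" using inj_onD[OF g(2) _ half[OF that]] by simp
        then show False using e q0n by simp
      qed
    qed
  qed (use z in \<open>auto simp: norm_mult\<close>)
  then have "norm (q z) \<le> K" using q0n by (simp add: F_def norm_divide K_def)
  then have "norm (q z ^ 2) \<le> K\<^sup>2" by (simp add: norm_power power_mono)
  moreover have "g z = b * (1 - q z ^ 2)"
    using q(2)[of z] z b0 by (simp flip: q(2))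
  moreover have "norm (1 - q z ^ 2) \<le> 1 + norm (q z ^ 2)" using norm_triangle_ineq4[of 1 "q z ^ 2"] by simp
  ultimately have "norm (g z) \<le> 2 * (1 + K\<^sup>2)"
    using b(2) unfolding norm_mult by (simp only: norm_mult) (intro mult_mono; simp)
  then show ?thesis by (simp add: univalent_bound_def K_def)
qed

text \<open>Chosen so that \<open>8 * D * distortion_radius = 1/2\<close> for
  \<open>D = 8 * univalent_bound + 2\<close>; the Schwarz lemma then keeps the derivative of a
  normalized univalent function within \<open>1/2\<close> of 1.\<close>

definition distortion_radius :: real where
  "distortion_radius = 1 / (16 * (8 * univalent_bound + 2))"

lemma distortion_radius: "0 < distortion_radius" "distortion_radius < 1/8"
proof -
  have "univalent_bound \<ge> 0" by (simp add: univalent_bound_def)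
  then show "0 < distortion_radius" "distortion_radius < 1/8"
    by (auto simp: distortion_radius_def field_simps)
qed

text \<open>Cauchy's inequality on disks of radius \<open>1/8\<close> bounds the derivative, the
  Schwarz lemma makes it close to 1 near the centre, and the mean value inequality is applied to
  \<open>g z - z\<close>.\<close>

lemma normalized_univalent_distortion:
  assumes g: "g holomorphic_on ball 0 1" "inj_on g (ball 0 1)" "g 0 = 0" "deriv g 0 = 1"
    and uv: "u \<in> ball 0 distortion_radius" "v \<in> ball 0 distortion_radius"
  shows "norm (g u - g v - (u - v)) \<le> norm (u - v) / 2"
proof -
  define M where "M = univalent_bound"
  have M: "M \<ge> 0" by (simp add: M_def univalent_bound_def)
  have d1: "norm (deriv g z) \<le> 8 * M" if "norm z < 1/8" for z
  proof -
    have sub: "cball z (1/8) \<subseteq> ball 0 1" "x \<in> cball z (1/8) \<Longrightarrow> norm x \<le> 1/4" for x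
    proof -
      have *: "norm x \<le> 1/4" if "x \<in> cball z (1/8)" for x
        using that norm_triangle_ineq2[of x z] \<open>norm z < 1/8\<close> by (simp add: dist_norm norm_minus_commute)
      then show "x \<in> cball z (1/8) \<Longrightarrow> norm x \<le> 1/4" by blast
      show "cball z (1/8) \<subseteq> ball 0 1" using * by fastforce
    qed
    have "norm ((deriv ^^ 1) g z) \<le> fact 1 * M / (1/8) ^ 1"
    proof (rule Cauchy_inequality[where f = g and \<xi> = z])
      show "g holomorphic_on ball z (1/8)"
        by (rule holomorphic_on_subset[OF g(1)]) (use sub(1) ball_subset_cball in blast)
      show "continuous_on (cball z (1/8)) g"
        by (rule holomorphic_on_imp_continuous_on, rule holomorphic_on_subset[OF g(1) sub(1)])
      show "norm (g x) \<le> M" if "norm (z - x) = 1/8" for x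
        unfolding M_def by (rule normalized_univalent_bound[OF g]) (use sub(2)[of x] that in \<open>simp add: dist_norm\<close>)
    qed simp
    then show ?thesis by simp
  qed
  define D where "D = 8 * M + 2"
  have D: "D > 0" using M by (simp add: D_def)
  define G where "G = (\<lambda>z. (deriv g (z / 8) - 1) / of_real D)"
  have hd: "deriv g holomorphic_on ball 0 1" by (rule holomorphic_deriv[OF g(1) open_ball])
  have d2: "norm (deriv g z - 1) \<le> 1/2" if z: "norm z < distortion_radius" for z
  proof -
    have z8: "norm z < 1/8" using z distortion_radius by simp
    have "norm (G (8 * z)) \<le> norm (8 * z)"
    proof (rule Schwarz_Lemma(1)[where f = G and \<xi> = "8 * z"])
      show "G holomorphic_on ball 0 1"
        unfolding G_def using D
        by (intro holomorphic_intros holomorphic_on_compose_gen[OF _ hd, unfolded o_def]) (auto simp: norm_divide)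
      show "G 0 = 0" by (simp add: G_def g)
      show "norm (G w) < 1" if "norm w < 1" for w
      proof -
        have "norm (deriv g (w / 8)) \<le> 8 * M" by (rule d1) (use that in \<open>simp add: norm_divide\<close>)
        then have "norm (deriv g (w / 8) - 1) < D"
          using norm_triangle_ineq4[of "deriv g (w / 8)" 1] by (simp add: D_def)
        then show ?thesis using D by (simp add: G_def norm_divide)
      qed
      show "norm (8 * z) < 1" using z8 by (simp add: norm_mult)
    qed
    then have "norm (deriv g z - 1) \<le> 8 * D * norm z"
      using D by (simp add: G_def norm_divide norm_mult field_simps)
    also have "\<dots> \<le> 8 * D * distortion_radius" using z D by (intro mult_left_mono) auto
    also have "\<dots> = 1/2" using D by (simp add: distortion_radius_def D_def M_def field_simps)
    finally show ?thesis .
  qed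
  have "norm ((\<lambda>z. g z - z) u - (\<lambda>z. g z - z) v) \<le> 1/2 * norm (u - v)"
  proof (rule field_differentiable_bound[where f = "\<lambda>z. g z - z" and S = "ball 0 distortion_radius" and f' = "\<lambda>z. deriv g z - 1"])
    fix z :: complex assume z: "z \<in> ball 0 distortion_radius"
    then have "z \<in> ball 0 1" using distortion_radius by simp
    then have "(g has_field_derivative deriv g z) (at z)" by (rule holomorphic_derivI[OF g(1) open_ball])
    then show "((\<lambda>z. g z - z) has_field_derivative deriv g z - 1) (at z within ball 0 distortion_radius)"
      by (auto intro!: derivative_eq_intros intro: has_field_derivative_at_within)
    show "norm (deriv g z - 1) \<le> 1/2" using d2 z by simp
  qed (use uv in auto)
  then show ?thesis by (simp add: algebra_simps)
qed

lemma univalent_distortion: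
  assumes \<psi>: "\<psi> holomorphic_on ball w \<rho>" "inj_on \<psi> (ball w \<rho>)" and \<rho>: "\<rho> > 0"
    and uv: "u \<in> ball w (distortion_radius * \<rho>)" "v \<in> ball w (distortion_radius * \<rho>)"
  shows "norm (deriv \<psi> w) / 2 * dist u v \<le> dist (\<psi> u) (\<psi> v)" (is ?A)
    and "dist (\<psi> u) (\<psi> v) \<le> 2 * norm (deriv \<psi> w) * dist u v" (is ?B)
    and "deriv \<psi> w \<noteq> 0"
proof -
  show d0: "deriv \<psi> w \<noteq> 0"
    using holomorphic_injective_imp_regular[OF \<psi>(1) open_ball \<psi>(2)] \<rho> by simp
  define c where "c = of_real \<rho> * deriv \<psi> w"
  have c0: "c \<noteq> 0" using d0 \<rho> by (simp add: c_def)
  define g where "g = (\<lambda>z. (\<psi> (w + of_real \<rho> * z) - \<psi> w) / c)"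
  have inb: "w + of_real \<rho> * z \<in> ball w \<rho>" if "z \<in> ball 0 1" for z
    using that \<rho> by (simp add: dist_norm norm_mult)
  have g: "g holomorphic_on ball 0 1"
    unfolding g_def using inb c0
    by (intro holomorphic_intros holomorphic_on_compose_gen[OF _ \<psi>(1), unfolded o_def]) auto
  have gi: "inj_on g (ball 0 1)"
  proof (rule inj_onI)
    fix x y assume xy: "x \<in> ball 0 1" "y \<in> ball 0 1" "g x = g y"
    then have "\<psi> (w + of_real \<rho> * x) = \<psi> (w + of_real \<rho> * y)" using c0 by (simp add: g_def)
    then have "w + of_real \<rho> * x = w + of_real \<rho> * y" using inj_onD[OF \<psi>(2)] inb xy by blast
    then show "x = y" using \<rho> by simp
  qed
  have "(\<psi> has_field_derivative deriv \<psi> w) (at (w + of_real \<rho> * 0))"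
    using holomorphic_derivI[OF \<psi>(1) open_ball, of w] \<rho> by simp
  then have "((\<lambda>z. \<psi> (w + of_real \<rho> * z)) has_field_derivative deriv \<psi> w * of_real \<rho>) (at 0)"
    by (rule DERIV_chain2) (auto intro!: derivative_eq_intros)
  then have "(g has_field_derivative (deriv \<psi> w * of_real \<rho> - 0) / c) (at 0)"
    unfolding g_def by (intro DERIV_cdivide DERIV_diff) auto
  then have g1: "deriv g 0 = 1" using c0 by (simp add: DERIV_imp_deriv c_def mult.commute)
  have g0: "g 0 = 0" by (simp add: g_def)
  define u' v' where "u' = (u - w) / of_real \<rho>" and "v' = (v - w) / of_real \<rho>"
  have uv': "u' \<in> ball 0 distortion_radius" "v' \<in> ball 0 distortion_radius"
    using uv \<rho> by (auto simp: u'_def v'_def dist_norm norm_divide norm_minus_commute field_simps)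
  have "norm (g u' - g v' - (u' - v')) \<le> norm (u' - v') / 2"
    by (rule normalized_univalent_distortion[OF g gi g0 g1 uv'])
  then have lo: "norm (u' - v') / 2 \<le> norm (g u' - g v')" and hi: "norm (g u' - g v') \<le> 2 * norm (u' - v')"
    using norm_triangle_ineq3[of "g u' - g v'" "u' - v'"] by (auto simp: abs_le_iff)
  have e1: "norm (u' - v') = dist u v / \<rho>"
  proof -
    have "u' - v' = (u - v) / of_real \<rho>" by (simp add: u'_def v'_def diff_divide_distrib)
    then show ?thesis using \<rho> by (simp add: norm_divide dist_norm)
  qed
  have e2: "norm (g u' - g v') = dist (\<psi> u) (\<psi> v) / norm c"
  proof -
    have "w + of_real \<rho> * u' = u" "w + of_real \<rho> * v' = v" using \<rho> by (auto simp: u'_def v'_def)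
    then have "g u' - g v' = (\<psi> u - \<psi> v) / c" by (simp add: g_def diff_divide_distrib)
    then show ?thesis by (simp add: norm_divide dist_norm)
  qed
  have nc: "norm c = \<rho> * norm (deriv \<psi> w)" using \<rho> by (simp add: c_def norm_mult)
  have dpos: "norm (deriv \<psi> w) > 0" using d0 by simp
  show ?A using lo \<rho> dpos unfolding e1 e2 nc by (simp add: field_simps)
  show ?B using hi \<rho> dpos unfolding e1 e2 nc by (simp add: field_simps)
qed

section \<open>Pulling back the tract along orbits\<close>

text \<open>With \<open>x = Re \<zeta>0\<close>, the disk has
  \<open>Re \<zeta> - \<kappa> \<ge> x / 2\<close>, so the derivative of \<open>L\<close> is at most
  \<open>24 * pi / x\<close> and the displacement at most \<open>6 * pi < 20\<close>. The condition
  \<open>80 \<le> Q\<close> makes the radius \<open>x / 4\<close> at least 20, so that such an image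
  fits into the disk of the next backward step.\<close>

lemma log_inverse_step:
  assumes L: "log_inverses f \<kappa>" and Q: "80 \<le> Q" "4 * \<kappa> \<le> Q" and \<zeta>0: "Q \<le> Re \<zeta>0" "f (exp \<omega>) = exp \<zeta>0"
  obtains L where "L holomorphic_on ball \<zeta>0 (Re \<zeta>0 / 4)" "inj_on L (ball \<zeta>0 (Re \<zeta>0 / 4))" "L \<zeta>0 = \<omega>"
    "\<And>\<zeta>. \<zeta> \<in> ball \<zeta>0 (Re \<zeta>0 / 4) \<Longrightarrow> f (exp (L \<zeta>)) = exp \<zeta>"
    "\<And>\<zeta>. \<zeta> \<in> ball \<zeta>0 (Re \<zeta>0 / 4) \<Longrightarrow> dist \<omega> (L \<zeta>) < 20"
proof -
  define x where "x = Re \<zeta>0"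
  have x: "80 \<le> x" "4 * \<kappa> \<le> x" using Q \<zeta>0 by (auto simp: x_def)
  have Re: "3 / 4 * x < Re \<zeta>" if "\<zeta> \<in> ball \<zeta>0 (x / 4)" for \<zeta>
  proof -
    have "Re (\<zeta>0 - \<zeta>) < x / 4"
      using that abs_Re_le_cmod[of "\<zeta>0 - \<zeta>"] by (simp add: dist_norm)
    then show ?thesis by (simp add: x_def)
  qed
  have sub: "ball \<zeta>0 (x / 4) \<subseteq> {\<zeta>. \<kappa> < Re \<zeta>}" using Re x by fastforce
  have "\<kappa> < Re \<zeta>0" using x by (simp add: x_def)
  then obtain L where L: "L holomorphic_on {\<zeta>. \<kappa> < Re \<zeta>}" "inj_on L {\<zeta>. \<kappa> < Re \<zeta>}" "L \<zeta>0 = \<omega>"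
    "\<And>\<zeta>. \<kappa> < Re \<zeta> \<Longrightarrow> f (exp (L \<zeta>)) = exp \<zeta>"
    "\<And>\<zeta>. \<kappa> < Re \<zeta> \<Longrightarrow> norm (deriv L \<zeta>) \<le> 12 * pi / (Re \<zeta> - \<kappa>)"
    using L \<zeta>0 unfolding log_inverses_def by blast
  have hol: "L holomorphic_on ball \<zeta>0 (x / 4)" using L(1) sub by (rule holomorphic_on_subset)
  have "dist \<omega> (L \<zeta>) < 20" if z: "\<zeta> \<in> ball \<zeta>0 (x / 4)" for \<zeta>
  proof -
    have "norm (L \<zeta>0 - L \<zeta>) \<le> 24 * pi / x * norm (\<zeta>0 - \<zeta>)"
    proof (rule field_differentiable_bound[where S = "ball \<zeta>0 (x / 4)" and f' = "deriv L"])
      fix \<xi> assume xi: "\<xi> \<in> ball \<zeta>0 (x / 4)"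
      show "(L has_field_derivative deriv L \<xi>) (at \<xi> within ball \<zeta>0 (x / 4))"
        using holomorphic_derivI[OF hol open_ball xi] .
      have "x / 2 \<le> Re \<xi> - \<kappa>" using Re[OF xi] x by linarith
      then have "12 * pi / (Re \<xi> - \<kappa>) \<le> 12 * pi / (x / 2)" using x by (intro divide_left_mono mult_pos_pos) auto
      then show "norm (deriv L \<xi>) \<le> 24 * pi / x" using L(5)[of \<xi>] sub xi by fastforce
    qed (use z x in auto)
    also have "\<dots> \<le> 24 * pi / x * (x / 4)" using z x by (intro mult_left_mono) (auto simp: dist_norm)
    also have "\<dots> = 6 * pi" using x by simp
    also have "\<dots> < 20" using pi_approx by simp
    finally show ?thesis by (simp add: L(3) dist_norm)
  qed
  then show thesis
    using that[of L] hol inj_on_subset[OF L(2) sub] L(3,4) sub unfolding x_def by blast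
qed

text \<open>Each backward branch maps its whole disk to within 20 of the image of the centre, so the
  bound 20 does not accumulate under composition. A shift by 20 lowers a real part of at least
  \<open>Q\<close> to no less than \<open>Q / 2\<close>, which explains the weaker threshold for
  nearby orbits.\<close>

lemma iterate_pullback:
  assumes L: "log_inverses f \<kappa>" and Q: "80 \<le> Q" "4 * \<kappa> \<le> Q"
    and orbit: "\<And>k. k \<le> Suc n \<Longrightarrow> exp Q \<le> norm ((f ^^ k) (exp \<omega>))" and \<zeta>0: "(f ^^ Suc n) (exp \<omega>) = exp \<zeta>0"
  shows "\<exists>\<psi>. \<psi> holomorphic_on ball \<zeta>0 (Re \<zeta>0 / 4) \<and> inj_on \<psi> (ball \<zeta>0 (Re \<zeta>0 / 4)) \<and> \<psi> \<zeta>0 = \<omega> \<and>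
    (\<forall>\<zeta>\<in>ball \<zeta>0 (Re \<zeta>0 / 4). dist \<omega> (\<psi> \<zeta>) < 20 \<and> (f ^^ Suc n) (exp (\<psi> \<zeta>)) = exp \<zeta> \<and>
      (\<forall>k\<le>n. exp (Q / 2) \<le> norm ((f ^^ k) (exp (\<psi> \<zeta>)))))"
  using orbit \<zeta>0
proof (induction n arbitrary: \<omega>)
  case 0
  have "exp Q \<le> norm (exp \<zeta>0)" using 0(1)[of 1] 0(2) by simp
  then have "Q \<le> Re \<zeta>0" by simp
  moreover have "f (exp \<omega>) = exp \<zeta>0" using 0(2) by simp
  ultimately obtain L1 where L1: "L1 holomorphic_on ball \<zeta>0 (Re \<zeta>0 / 4)" "inj_on L1 (ball \<zeta>0 (Re \<zeta>0 / 4))" "L1 \<zeta>0 = \<omega>"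
    "\<And>\<zeta>. \<zeta> \<in> ball \<zeta>0 (Re \<zeta>0 / 4) \<Longrightarrow> f (exp (L1 \<zeta>)) = exp \<zeta>"
    "\<And>\<zeta>. \<zeta> \<in> ball \<zeta>0 (Re \<zeta>0 / 4) \<Longrightarrow> dist \<omega> (L1 \<zeta>) < 20"
    using log_inverse_step[OF L Q] by metis
  have "Q \<le> Re \<omega>" using 0(1)[of 0] by simp
  then have "Q / 2 \<le> Re (L1 \<zeta>)" if "\<zeta> \<in> ball \<zeta>0 (Re \<zeta>0 / 4)" for \<zeta>
    using L1(5)[OF that] abs_Re_le_cmod[of "\<omega> - L1 \<zeta>"] Q by (simp add: dist_norm)
  then show ?case using L1 by (intro exI[of _ L1]) auto
next
  case (Suc n)
  have "exp Q \<le> norm (f (exp \<omega>))" using Suc.prems(1)[of 1] by simp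
  then have "f (exp \<omega>) \<noteq> 0" using exp_gt_zero[of Q] by (metis norm_zero not_le)
  then obtain \<omega>1 where \<omega>1: "exp \<omega>1 = f (exp \<omega>)" by (metis exp_Ln)
  have "Q \<le> Re \<omega>1" using \<open>exp Q \<le> norm (f (exp \<omega>))\<close> by (simp flip: \<omega>1)
  have sw: "(f ^^ Suc k) z = (f ^^ k) (f z)" for k z by (simp add: funpow_swap1)
  have "exp Q \<le> norm ((f ^^ k) (exp \<omega>1))" if "k \<le> Suc n" for k
    using Suc.prems(1)[of "Suc k"] that unfolding sw \<omega>1 by simp
  moreover have "(f ^^ Suc n) (exp \<omega>1) = exp \<zeta>0" using Suc.prems(2) unfolding sw[of "Suc n"] \<omega>1 .
  ultimately obtain \<psi>1 where \<psi>1: "\<psi>1 holomorphic_on ball \<zeta>0 (Re \<zeta>0 / 4)" "inj_on \<psi>1 (ball \<zeta>0 (Re \<zeta>0 / 4))" "\<psi>1 \<zeta>0 = \<omega>1"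
    "\<And>\<zeta>. \<zeta> \<in> ball \<zeta>0 (Re \<zeta>0 / 4) \<Longrightarrow> dist \<omega>1 (\<psi>1 \<zeta>) < 20"
    "\<And>\<zeta>. \<zeta> \<in> ball \<zeta>0 (Re \<zeta>0 / 4) \<Longrightarrow> (f ^^ Suc n) (exp (\<psi>1 \<zeta>)) = exp \<zeta>"
    "\<And>\<zeta> k. \<zeta> \<in> ball \<zeta>0 (Re \<zeta>0 / 4) \<Longrightarrow> k \<le> n \<Longrightarrow> exp (Q / 2) \<le> norm ((f ^^ k) (exp (\<psi>1 \<zeta>)))"
    using Suc.IH[of \<omega>1] by blast
  obtain L1 where L1: "L1 holomorphic_on ball \<omega>1 (Re \<omega>1 / 4)" "inj_on L1 (ball \<omega>1 (Re \<omega>1 / 4))" "L1 \<omega>1 = \<omega>"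
    "\<And>\<zeta>. \<zeta> \<in> ball \<omega>1 (Re \<omega>1 / 4) \<Longrightarrow> f (exp (L1 \<zeta>)) = exp \<zeta>"
    "\<And>\<zeta>. \<zeta> \<in> ball \<omega>1 (Re \<omega>1 / 4) \<Longrightarrow> dist \<omega> (L1 \<zeta>) < 20"
    using log_inverse_step[OF L Q \<open>Q \<le> Re \<omega>1\<close> \<omega>1[symmetric]] by metis
  have mem: "\<psi>1 \<zeta> \<in> ball \<omega>1 (Re \<omega>1 / 4)" if "\<zeta> \<in> ball \<zeta>0 (Re \<zeta>0 / 4)" for \<zeta>
    using \<psi>1(4)[OF that] \<open>Q \<le> Re \<omega>1\<close> Q by simp
  have "Q \<le> Re \<omega>" using Suc.prems(1)[of 0] by simp
  then have re: "Q / 2 \<le> Re (L1 (\<psi>1 \<zeta>))" if "\<zeta> \<in> ball \<zeta>0 (Re \<zeta>0 / 4)" for \<zeta>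
    using L1(5)[OF mem[OF that]] abs_Re_le_cmod[of "\<omega> - L1 (\<psi>1 \<zeta>)"] Q by (simp add: dist_norm)
  show ?case
  proof (intro exI[of _ "\<lambda>\<zeta>. L1 (\<psi>1 \<zeta>)"] conjI ballI allI impI)
    show "(\<lambda>\<zeta>. L1 (\<psi>1 \<zeta>)) holomorphic_on ball \<zeta>0 (Re \<zeta>0 / 4)"
      using mem by (intro holomorphic_on_compose_gen[OF \<psi>1(1) L1(1), unfolded o_def]) auto
    show "inj_on (\<lambda>\<zeta>. L1 (\<psi>1 \<zeta>)) (ball \<zeta>0 (Re \<zeta>0 / 4))"
      using mem inj_onD[OF L1(2)] inj_onD[OF \<psi>1(2)] by (intro inj_onI) blast
    show "L1 (\<psi>1 \<zeta>0) = \<omega>" using \<psi>1 L1 by simp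
    fix \<zeta> assume z: "\<zeta> \<in> ball \<zeta>0 (Re \<zeta>0 / 4)"
    show "dist \<omega> (L1 (\<psi>1 \<zeta>)) < 20" by (rule L1(5)[OF mem[OF z]])
    have e: "f (exp (L1 (\<psi>1 \<zeta>))) = exp (\<psi>1 \<zeta>)" by (rule L1(4)[OF mem[OF z]])
    show "(f ^^ Suc (Suc n)) (exp (L1 (\<psi>1 \<zeta>))) = exp \<zeta>"
      unfolding sw[of "Suc n"] e by (rule \<psi>1(5)[OF z])
    fix k assume k: "k \<le> Suc n"
    show "exp (Q / 2) \<le> norm ((f ^^ k) (exp (L1 (\<psi>1 \<zeta>))))"
    proof (cases k)
      case 0
      then show ?thesis using re[OF z] by simp
    next
      case (Suc j)
      then show ?thesis using \<psi>1(6)[OF z, of j] k unfolding Suc sw e by simp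
    qed
  qed
qed

text \<open>Strips of height 10 are stacked at distance 11, which makes them disjoint. Since
  \<open>\<eta> * x / 11\<close> is at least 1, its floor, the number of strips, is at least half of
  it; hence 22.\<close>

lemma log_strips_area:
  assumes u: "pos_harmonic u" and \<eta>: "0 < \<eta>" "\<eta> < 1" and x: "11 \<le> \<eta> * x" and m: "0 \<le> m"
    and strip: "\<And>y. m \<le> measure lebesgue (log_strip u ((1 - \<eta>) * x) x y)"
  obtains S where "S \<in> lmeasurable" "\<eta> * x / 22 * m \<le> measure lebesgue S"
    "\<And>\<zeta>. \<zeta> \<in> S \<Longrightarrow> 0 < u (exp \<zeta>) \<and> \<bar>Re \<zeta> - x\<bar> \<le> \<eta> * x \<and> \<bar>Im \<zeta> - y0\<bar> \<le> \<eta> * x"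
proof -
  define k where "k = nat \<lfloor>\<eta> * x / 11\<rfloor>"
  have k: "real k \<le> \<eta> * x / 11" "\<eta> * x / 22 \<le> real k"
  proof -
    define t where "t = \<eta> * x / 11"
    have "1 \<le> t" using x by (simp add: t_def)
    then have "1 \<le> \<lfloor>t\<rfloor>" by simp
    moreover from this have "real k = of_int \<lfloor>t\<rfloor>" by (simp add: k_def t_def)
    moreover have "t < of_int \<lfloor>t\<rfloor> + 1" "of_int \<lfloor>t\<rfloor> \<le> t" by linarith+
    ultimately have "real k \<le> t" "t / 2 \<le> real k" by linarith+
    then show "real k \<le> \<eta> * x / 11" "\<eta> * x / 22 \<le> real k" by (simp_all add: t_def)
  qed
  define I where "I = (\<lambda>j::nat. log_strip u ((1 - \<eta>) * x) x (y0 + 11 * real j))"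
  show thesis
  proof
    show "(\<Union>j\<in>{..<k}. I j) \<in> lmeasurable"
      by (intro fmeasurable.finite_UN) (auto simp: I_def log_strip_measurable[OF u])
    have "\<eta> * x / 22 * m \<le> real k * m" using k m by (intro mult_right_mono)
    also have "\<dots> = (\<Sum>j<k. m)" by simp
    also have "\<dots> \<le> (\<Sum>j<k. measure lebesgue (I j))" by (intro sum_mono) (simp add: I_def strip)
    also have "\<dots> = measure lebesgue (\<Union>j\<in>{..<k}. I j)"
    proof (rule measure_negligible_finite_Union_image[symmetric])
      show "pairwise (\<lambda>i j. negligible (I i \<inter> I j)) {..<k}"
      proof (rule pairwiseI)
        fix i j :: nat assume "i \<noteq> j"
        have "I i \<inter> I j = {}" if "i < j" for i j :: nat
        proof -
          have "real i + 1 \<le> real j" using that by simp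
          then have "y0 + 11 * real i + 10 < y0 + 11 * real j" by argo
          then show ?thesis by (auto simp: I_def log_strip_def)
        qed
        then show "negligible (I i \<inter> I j)" using \<open>i \<noteq> j\<close> by (metis Int_commute linorder_neqE_nat negligible_empty)
      qed
    qed (auto simp: I_def log_strip_measurable[OF u])
    finally show "\<eta> * x / 22 * m \<le> measure lebesgue (\<Union>j\<in>{..<k}. I j)" .
    fix \<zeta> assume "\<zeta> \<in> (\<Union>j\<in>{..<k}. I j)"
    then obtain j where j: "j < k" "\<zeta> \<in> I j" by blast
    have "real j + 1 \<le> real k" using j by simp
    then have "11 * real j + 10 \<le> \<eta> * x" using k(1) by argo
    moreover have "(1 - \<eta>) * x = x - \<eta> * x" by (simp add: algebra_simps)
    ultimately show "0 < u (exp \<zeta>) \<and> \<bar>Re \<zeta> - x\<bar> \<le> \<eta> * x \<and> \<bar>Im \<zeta> - y0\<bar> \<le> \<eta> * x"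
      using j(2) x by (auto simp: I_def log_strip_def)
  qed
qed

text \<open>\<open>\<omega>\<close> is a logarithm of the starting point, and
  \<open>ball 0 Y\<close> keeps areas finite. Step \<open>Suc n\<close> is the first at which the
  orbit falls below \<open>exp q\<close>, so different \<open>n\<close> give disjoint sets.\<close>

definition killed :: "(complex \<Rightarrow> complex) \<Rightarrow> real \<Rightarrow> real \<Rightarrow> nat \<Rightarrow> complex set" where
  "killed f q Y n = {\<omega> \<in> ball 0 Y. (\<forall>k\<le>n. exp q \<le> norm ((f ^^ k) (exp \<omega>))) \<and> norm ((f ^^ Suc n) (exp \<omega>)) < exp q}"

lemma continuous_on_funpow:
  fixes f :: "complex \<Rightarrow> complex"
  assumes "continuous_on UNIV f"
  shows "continuous_on UNIV (f ^^ n)"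
proof (induction n)
  case (Suc n)
  then show ?case using continuous_on_compose[OF Suc, of f] continuous_on_subset[OF assms] by simp
qed simp

lemma killed_measurable:
  assumes f: "continuous_on UNIV f"
  shows "killed f q Y n \<in> sets borel" "killed f q Y n \<in> lmeasurable"
proof -
  have c: "continuous_on UNIV (\<lambda>\<omega>. norm ((f ^^ k) (exp \<omega>)))" for k
    by (intro continuous_intros continuous_on_compose2[OF continuous_on_funpow[OF f]]) auto
  have eq: "killed f q Y n = (ball 0 Y \<inter> {\<omega>. norm ((f ^^ Suc n) (exp \<omega>)) < exp q}) \<inter>
      (\<Inter>k\<le>n. {\<omega>. exp q \<le> norm ((f ^^ k) (exp \<omega>))})"
    by (auto simp: killed_def)
  have "open (ball 0 Y \<inter> {\<omega>. norm ((f ^^ Suc n) (exp \<omega>)) < exp q})"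
    by (intro open_Int open_ball open_Collect_less c continuous_intros)
  moreover have "closed (\<Inter>k\<le>n. {\<omega>. exp q \<le> norm ((f ^^ k) (exp \<omega>))})"
    by (intro closed_INT ballI closed_Collect_le c continuous_intros)
  ultimately show b: "killed f q Y n \<in> sets borel"
    unfolding eq by (metis borel_open borel_closed sets.Int)
  have "bounded (killed f q Y n)" by (rule bounded_subset[OF bounded_ball[of 0 Y]]) (auto simp: killed_def)
  then show "killed f q Y n \<in> lmeasurable" using b by (intro bounded_set_imp_lmeasurable) auto
qed

lemma killed_disjoint:
  assumes "m < n" shows "killed f q Y m \<inter> killed f q Y n = {}"
proof -
  have "Suc m \<le> n" using assms by simp
  then show ?thesis unfolding killed_def by fastforce
qed

text \<open>The region of the tract inside a large disk around \<open>\<zeta>0\<close> is pulled back with bounded distortion.\<close>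
lemma killed_mass:
  assumes f: "continuous_on UNIV f" and L: "log_inverses f \<kappa>" and Q: "80 \<le> Q" "4 * \<kappa> \<le> Q"
    and orbit: "\<And>k. k \<le> Suc n \<Longrightarrow> exp Q \<le> norm ((f ^^ k) (exp \<omega>))" and \<zeta>0: "(f ^^ Suc n) (exp \<omega>) = exp \<zeta>0"
    and Y: "norm \<omega> + 20 \<le> Y"
    and S: "S \<in> lmeasurable" "S \<subseteq> ball \<zeta>0 (distortion_radius * (Re \<zeta>0 / 4))"
    and kill: "\<And>\<zeta>. \<zeta> \<in> S \<Longrightarrow> norm (f (exp \<zeta>)) < exp (Q / 2)"
  obtains s where "0 < s" "s \<le> 160"
    "s\<^sup>2 * measure lebesgue S \<le> (distortion_radius * Re \<zeta>0)\<^sup>2 * measure lebesgue (killed f (Q / 2) Y (Suc n) \<inter> ball \<omega> s)"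
proof -
  define x where "x = Re \<zeta>0"
  define \<delta> where "\<delta> = distortion_radius"
  have \<delta>: "0 < \<delta>" "\<delta> < 1/8" using distortion_radius by (auto simp: \<delta>_def)
  have "exp Q \<le> norm (exp \<zeta>0)" using orbit[of "Suc n"] \<zeta>0 by simp
  then have x: "Q \<le> x" "80 \<le> x" using Q by (auto simp: x_def)
  obtain \<psi> where \<psi>: "\<psi> holomorphic_on ball \<zeta>0 (x / 4)" "inj_on \<psi> (ball \<zeta>0 (x / 4))" "\<psi> \<zeta>0 = \<omega>"
    "\<And>\<zeta>. \<zeta> \<in> ball \<zeta>0 (x / 4) \<Longrightarrow> dist \<omega> (\<psi> \<zeta>) < 20"
    "\<And>\<zeta>. \<zeta> \<in> ball \<zeta>0 (x / 4) \<Longrightarrow> (f ^^ Suc n) (exp (\<psi> \<zeta>)) = exp \<zeta>"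
    "\<And>\<zeta> k. \<zeta> \<in> ball \<zeta>0 (x / 4) \<Longrightarrow> k \<le> n \<Longrightarrow> exp (Q / 2) \<le> norm ((f ^^ k) (exp (\<psi> \<zeta>)))"
    using iterate_pullback[OF L Q orbit \<zeta>0] unfolding x_def by blast
  have x4: "x / 4 > 0" using x by simp
  define D where "D = norm (deriv \<psi> \<zeta>0)"
  have lo: "D / 2 * dist u v \<le> dist (\<psi> u) (\<psi> v)" and hi: "dist (\<psi> u) (\<psi> v) \<le> 2 * D * dist u v"
    if "u \<in> ball \<zeta>0 (\<delta> * (x / 4))" "v \<in> ball \<zeta>0 (\<delta> * (x / 4))" for u v
    using univalent_distortion(1,2)[OF \<psi>(1,2) x4] that unfolding D_def \<delta>_def by blast+
  have D: "D > 0"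
  proof -
    have "\<zeta>0 \<in> ball \<zeta>0 (distortion_radius * (x / 4))" using \<delta> x by (simp add: \<delta>_def)
    then show ?thesis using univalent_distortion(3)[OF \<psi>(1,2) x4] unfolding D_def zero_less_norm_iff by blast
  qed
  have c0: "\<zeta>0 \<in> ball \<zeta>0 (\<delta> * (x / 4))" using \<delta> x by simp
  have sub: "ball \<zeta>0 (\<delta> * (x / 4)) \<subseteq> ball \<zeta>0 (x / 4)" using \<delta> x by (intro subset_ball) simp
  \<comment> \<open>The upper distortion bound puts the image of the disk of radius
    \<open>\<delta> * x / 4\<close> into \<open>ball \<omega> s\<close>. The lower one gives the
    area factor \<open>(2 / D)\<^sup>2\<close>, and \<open>s * (2 / D) = \<delta> * x\<close>. The
    value 160 comes from the lower bound at distance \<open>\<delta> * x / 8\<close>, where the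
    displacement is below 20.\<close>
  define s where "s = D * \<delta> * x / 2"
  have s0: "s > 0" using D \<delta> x by (simp add: s_def)
  have s160: "s \<le> 160"
  proof -
    define u where "u = \<zeta>0 + of_real (\<delta> * x / 8)"
    have d: "dist u \<zeta>0 = \<delta> * x / 8" using \<delta> x by (simp add: u_def dist_norm del: of_real_mult of_real_divide)
    have "0 < \<delta> * x" using \<delta> x by simp
    then have u: "u \<in> ball \<zeta>0 (\<delta> * (x / 4))" using d by (simp add: dist_commute)
    have "D / 2 * (\<delta> * x / 8) \<le> dist (\<psi> u) \<omega>" using lo[OF u c0] d \<psi>(3) by simp
    also have "\<dots> < 20" using \<psi>(4)[of u] u sub by (auto simp: dist_commute)
    finally show ?thesis by (simp add: s_def)
  qed
  define K where "K = killed f (Q / 2) Y (Suc n) \<inter> ball \<omega> s"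
  have inj: "inj_on \<psi> S" using \<psi>(2) S(2) sub unfolding \<delta>_def x_def by (meson inj_on_subset)
  have S2: "\<zeta> \<in> ball \<zeta>0 (\<delta> * (x / 4))" if "\<zeta> \<in> S" for \<zeta> using that S(2) by (auto simp: \<delta>_def x_def)
  have "measure lebesgue S \<le> (2 / D)\<^sup>2 * measure lebesgue K"
  proof (rule measure_le_Lipschitz_preimage[where g = "the_inv_into S \<psi>" and T = "\<psi> ` S"])
    fix a b assume "a \<in> \<psi> ` S" "b \<in> \<psi> ` S"
    then obtain u v where uv: "u \<in> S" "v \<in> S" "a = \<psi> u" "b = \<psi> v" by blast
    have "dist u v \<le> 2 / D * dist (\<psi> u) (\<psi> v)"
      using lo[OF S2[OF uv(1)] S2[OF uv(2)]] D by (simp add: field_simps)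
    then show "dist (the_inv_into S \<psi> a) (the_inv_into S \<psi> b) \<le> 2 / D * dist a b"
      using uv by (simp add: the_inv_into_f_f[OF inj])
  next
    show "\<psi> ` S \<subseteq> K"
    proof
      fix w assume "w \<in> \<psi> ` S"
      then obtain \<zeta> where z: "\<zeta> \<in> S" "w = \<psi> \<zeta>" by blast
      have zb: "\<zeta> \<in> ball \<zeta>0 (\<delta> * (x / 4))" by (rule S2[OF z(1)])
      then have zb4: "\<zeta> \<in> ball \<zeta>0 (x / 4)" using sub by blast
      have "dist \<omega> w \<le> 2 * D * dist \<zeta>0 \<zeta>" using hi[OF c0 zb] \<psi>(3) z by simp
      also have "\<dots> < 2 * D * (\<delta> * (x / 4))" using zb D by simp
      finally have "w \<in> ball \<omega> s" by (simp add: s_def)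
      moreover have "w \<in> ball 0 Y"
        using \<psi>(4)[OF zb4] Y norm_triangle_ineq2[of w \<omega>] z by (simp add: dist_norm norm_minus_commute)
      moreover have "exp (Q / 2) \<le> norm ((f ^^ k) (exp w))" if "k \<le> Suc n" for k
      proof (cases "k = Suc n")
        case True
        have "Re \<zeta>0 - Re \<zeta> \<le> x / 4" using zb4 abs_Re_le_cmod[of "\<zeta>0 - \<zeta>"] by (simp add: dist_norm)
        then have "Q / 2 \<le> Re \<zeta>" using x by (simp add: x_def)
        then show ?thesis using \<psi>(5)[OF zb4] z True by (simp del: funpow.simps)
      next
        case False
        then show ?thesis using \<psi>(6)[OF zb4, of k] z that by simp
      qed
      moreover have "norm ((f ^^ Suc (Suc n)) (exp w)) < exp (Q / 2)"
        using kill[OF z(1)] \<psi>(5)[OF zb4] z by simp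
      ultimately show "w \<in> K" by (simp add: K_def killed_def del: funpow.simps)
    qed
    show "K \<in> lmeasurable"
      unfolding K_def by (intro fmeasurable.Int killed_measurable[OF f]) auto
    show "S \<subseteq> the_inv_into S \<psi> ` \<psi> ` S" using the_inv_into_onto[OF inj] by simp
  qed (use D S(1) in auto)
  then have "s\<^sup>2 * measure lebesgue S \<le> s\<^sup>2 * ((2 / D)\<^sup>2 * measure lebesgue K)" by (intro mult_left_mono) auto
  also have "s\<^sup>2 * ((2 / D)\<^sup>2 * measure lebesgue K) = (\<delta> * x)\<^sup>2 * measure lebesgue K"
    using D by (simp add: s_def power_mult_distrib power_divide)
  finally show thesis using that[OF s0 s160] by (simp add: \<delta>_def x_def K_def)
qed

text \<open>Vitali's covering lemma with dilation 5: the selected balls are disjoint, their dilates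
  cover \<open>J\<close>, and 25 is the area factor. The covering lemma asks for the common bound
  \<open>B\<close> on the radii.\<close>

lemma measure_le_ball_masses:
  fixes J K :: "complex set"
  assumes J: "J \<in> lmeasurable" and K: "K \<in> lmeasurable" and C: "C \<ge> 0"
    and s: "\<And>\<omega>. \<omega> \<in> J \<Longrightarrow> \<exists>s. 0 < s \<and> s \<le> B \<and> s\<^sup>2 \<le> C * measure lebesgue (K \<inter> ball \<omega> s)"
  shows "measure lebesgue J \<le> 25 * pi * C * measure lebesgue K"
proof -
  obtain s where s: "\<And>\<omega>. \<omega> \<in> J \<Longrightarrow> 0 < s \<omega> \<and> s \<omega> \<le> B \<and> (s \<omega>)\<^sup>2 \<le> C * measure lebesgue (K \<inter> ball \<omega> (s \<omega>))"
    using s by metis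
  have "J \<subseteq> (\<Union>\<omega>\<in>J. ball \<omega> (s \<omega>))" using s by force
  moreover have "\<And>\<omega>. \<omega> \<in> J \<Longrightarrow> 0 < s \<omega> \<and> s \<omega> \<le> B" using s by blast
  ultimately obtain D where D: "countable D" "D \<subseteq> J"
     "pairwise (\<lambda>i j. disjnt (ball i (s i)) (ball j (s j))) D" "J \<subseteq> (\<Union>i\<in>D. ball i (5 * s i))"
    by (rule Vitali_covering_lemma_balls)
  have bound: "measure lebesgue (\<Union>i\<in>I. ball i (5 * s i)) \<le> 25 * pi * C * measure lebesgue K"
    if I: "I \<subseteq> D" "finite I" for I
  proof -
    have IJ: "i \<in> J" if "i \<in> I" for i using that I D by blast
    have "measure lebesgue (\<Union>i\<in>I. ball i (5 * s i)) \<le> (\<Sum>i\<in>I. measure lebesgue (ball i (5 * s i)))"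
      using I by (intro measure_UNION_le) auto
    also have "\<dots> \<le> (\<Sum>i\<in>I. 25 * pi * C * measure lebesgue (K \<inter> ball i (s i)))"
    proof (rule sum_mono)
      fix i assume "i \<in> I"
      then have si: "0 < s i" "(s i)\<^sup>2 \<le> C * measure lebesgue (K \<inter> ball i (s i))" using s IJ by blast+
      have "measure lebesgue (ball i (5 * s i)) = 25 * pi * (s i)\<^sup>2"
        using si by (subst measure_ball_complex) (auto simp: power_mult_distrib)
      also have "\<dots> \<le> 25 * pi * (C * measure lebesgue (K \<inter> ball i (s i)))" using si by (intro mult_left_mono) auto
      finally show "measure lebesgue (ball i (5 * s i)) \<le> 25 * pi * C * measure lebesgue (K \<inter> ball i (s i))" by simp
    qed
    also have "\<dots> = 25 * pi * C * (\<Sum>i\<in>I. measure lebesgue (K \<inter> ball i (s i)))" by (simp add: sum_distrib_left)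
    also have "(\<Sum>i\<in>I. measure lebesgue (K \<inter> ball i (s i))) = measure lebesgue (\<Union>i\<in>I. K \<inter> ball i (s i))"
    proof (rule measure_negligible_finite_Union_image[symmetric])
      show "pairwise (\<lambda>x y. negligible (K \<inter> ball x (s x) \<inter> (K \<inter> ball y (s y)))) I"
      proof (rule pairwiseI)
        fix x y assume "x \<in> I" "y \<in> I" "x \<noteq> y"
        then have "disjnt (ball x (s x)) (ball y (s y))" using D(3) I(1) unfolding pairwise_def by blast
        then have "K \<inter> ball x (s x) \<inter> (K \<inter> ball y (s y)) = {}" by (auto simp: disjnt_def)
        then show "negligible (K \<inter> ball x (s x) \<inter> (K \<inter> ball y (s y)))" by simp
      qed
    qed (use I K in \<open>auto intro: fmeasurable.Int\<close>)
    also have "25 * pi * C * measure lebesgue (\<Union>i\<in>I. K \<inter> ball i (s i)) \<le> 25 * pi * C * measure lebesgue K"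
    proof (rule mult_left_mono)
      show "measure lebesgue (\<Union>i\<in>I. K \<inter> ball i (s i)) \<le> measure lebesgue K"
        using K I by (intro measure_mono_fmeasurable sets.finite_UN) (auto intro: fmeasurableD fmeasurable.Int)
    qed (use C in simp)
    finally show ?thesis .
  qed
  have "(\<Union>i\<in>D. ball i (5 * s i)) \<in> lmeasurable"
    by (rule fmeasurable_UN_bound[OF D(1) _ bound]) auto
  then have "measure lebesgue J \<le> measure lebesgue (\<Union>i\<in>D. ball i (5 * s i))"
    using J D(4) by (intro measure_mono_fmeasurable) auto
  also have "\<dots> \<le> 25 * pi * C * measure lebesgue K"
    by (rule measure_UN_bound[OF D(1) _ bound]) auto
  finally show ?thesis .
qed

section \<open>The measure of the set of surviving points\<close>

lemma iterated_exp_ge: "real k \<le> (exp ^^ k) (0::real)"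
proof (induction k)
  case (Suc k)
  have "1 + (exp ^^ k) (0::real) \<le> exp ((exp ^^ k) 0)" by (rule exp_ge_add_one_self)
  then have "real (Suc k) \<le> exp ((exp ^^ k) 0)" using Suc by linarith
  then show ?case by simp
qed simp

text \<open>If \<open>x\<^bsub>n+1\<^esub> \<le> exp (x\<^bsub>n\<^esub>\<^sup>2)\<close>, then \<open>2 * ln x\<^bsub>n\<^esub> + 1\<close> grows no faster than the iterated exponential.\<close>
lemma orbit_growth:
  fixes x :: "nat \<Rightarrow> real"
  assumes pos: "\<And>n. 0 < x n" and step: "\<And>n. x (Suc n) \<le> exp ((x n)\<^sup>2)"
    and N: "2 \<le> N" "2 * ln (x 0) + 1 \<le> real N"
  shows "exp (2 * x n) \<le> (exp ^^ (n + N + 2)) 0"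
proof -
  define e where "e = (\<lambda>k. (exp ^^ k) (0::real))"
  have eS: "e (Suc k) = exp (e k)" for k by (simp add: e_def)
  have e2: "2 \<le> e (n + N)" for n
    using iterated_exp_ge[of "n + N"] N by (simp add: e_def)
  \<comment> \<open>The spare \<open>+ 1\<close> gains a factor \<open>exp 1 \<ge> 5/2\<close> at
    the exponentiation; as \<open>exp (?E - 1) \<ge> 2\<close>, this pays for both the doubling and
    the next \<open>+ 1\<close>.\<close>
  have T: "2 * ln (x n) + 1 \<le> e (n + N)" for n
  proof (induction n)
    case 0
    then show ?case using N iterated_exp_ge[of N] by (simp add: e_def)
  next
    case (Suc n)
    let ?E = "e (n + N)"
    have "(x n)\<^sup>2 = exp (2 * ln (x n))" using pos[of n] by (simp add: exp_double)
    also have "\<dots> \<le> exp (?E - 1)" using Suc by simp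
    finally have 1: "(x n)\<^sup>2 \<le> exp (?E - 1)" .
    have "ln (x (Suc n)) \<le> (x n)\<^sup>2"
      using step[of n] pos[of "Suc n"] by (metis exp_le_cancel_iff exp_ln)
    then have 2: "2 * ln (x (Suc n)) + 1 \<le> 2 * exp (?E - 1) + 1" using 1 by simp
    have "5/2 \<le> exp (1::real)" using exp_lower_Taylor_quadratic[of 1] by simp
    then have "exp (?E - 1) * (5/2) \<le> exp (?E - 1) * exp 1" by (intro mult_left_mono) auto
    also have "\<dots> = exp ?E" by (simp flip: exp_add)
    finally have 3: "exp (?E - 1) * (5/2) \<le> exp ?E" .
    have "2 \<le> exp (?E - 1)" using exp_ge_add_one_self[of "?E - 1"] e2[of n] by linarith
    then have "2 * exp (?E - 1) + 1 \<le> exp ?E" using 3 by argo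
    then show ?case using 2 eS[of "n + N"] by simp
  qed
  have "ln (x n) \<le> e (n + N) - 1" using T[of n] e2[of n] by argo
  then have "x n \<le> exp (e (n + N) - 1)" using pos[of n] by (metis exp_le_cancel_iff exp_ln)
  moreover have "2 * exp (e (n + N) - 1) \<le> exp (e (n + N))"
  proof -
    have "exp (e (n + N) - 1) * 2 \<le> exp (e (n + N) - 1) * exp 1"
      using exp_ge_add_one_self[of "1::real"] by (intro mult_left_mono) auto
    also have "\<dots> = exp (e (n + N))" by (simp flip: exp_add)
    finally show ?thesis by simp
  qed
  ultimately have "2 * x n \<le> e (Suc (n + N))" unfolding eS by linarith
  then have "exp (2 * x n) \<le> e (Suc (Suc (n + N)))" unfolding eS[of "Suc (n + N)"] by simp
  then show ?thesis by (simp add: e_def)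
qed

lemma measure_zero_of_divergent_masses:
  fixes J :: "complex set"
  assumes K: "\<And>n. K n \<in> lmeasurable" "\<And>m n. m < n \<Longrightarrow> K m \<inter> K n = {}" "\<And>n. K n \<subseteq> B" and B: "B \<in> lmeasurable"
    and C: "C \<ge> 0" and J: "\<And>n. b n * measure lebesgue J \<le> C * measure lebesgue (K n)"
    and div: "filterlim (\<lambda>n. \<Sum>k<n. b k) at_top sequentially"
  shows "measure lebesgue J = 0"
proof (rule ccontr)
  assume "measure lebesgue J \<noteq> 0"
  then have Jp: "measure lebesgue J > 0" by (simp add: zero_less_measure_iff)
  have bound: "(\<Sum>k<n. b k) * measure lebesgue J \<le> C * measure lebesgue B" for n
  proof -
    have "(\<Sum>k<n. b k) * measure lebesgue J = (\<Sum>k<n. b k * measure lebesgue J)" by (simp add: sum_distrib_right)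
    also have "\<dots> \<le> (\<Sum>k<n. C * measure lebesgue (K k))" by (intro sum_mono J)
    also have "\<dots> = C * (\<Sum>k<n. measure lebesgue (K k))" by (simp add: sum_distrib_left)
    also have "(\<Sum>k<n. measure lebesgue (K k)) = measure lebesgue (\<Union>k\<in>{..<n}. K k)"
    proof (rule measure_negligible_finite_Union_image[symmetric])
      show "pairwise (\<lambda>i j. negligible (K i \<inter> K j)) {..<n}"
        by (rule pairwiseI) (metis K(2) Int_commute linorder_neqE_nat negligible_empty)
    qed (use K in auto)
    also have "C * measure lebesgue (\<Union>k\<in>{..<n}. K k) \<le> C * measure lebesgue B"
      using C K(1,3) B by (intro mult_left_mono measure_mono_fmeasurable sets.finite_UN) (auto intro: fmeasurableD)
    finally show ?thesis .
  qed
  obtain n where "C * measure lebesgue B / measure lebesgue J + 1 \<le> (\<Sum>k<n. b k)"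
    using div unfolding filterlim_at_top eventually_sequentially by blast
  then have "C * measure lebesgue B / measure lebesgue J < (\<Sum>k<n. b k)" by simp
  then have "C * measure lebesgue B < (\<Sum>k<n. b k) * measure lebesgue J" using Jp by (simp add: divide_less_eq)
  then show False using bound[of n] by linarith
qed

text \<open>Away from the countable zero set of the derivative, the preimage is locally contained in
  the image of a null set under a holomorphic inverse branch.\<close>

lemma negligible_vimage_entire:
  assumes f: "f holomorphic_on UNIV" and nc: "\<not> f constant_on UNIV" and N: "negligible N"
  shows "negligible (f -` N)"
proof -
  define Z where "Z = {z \<in> UNIV. deriv f z = 0}"
  have df: "(f has_field_derivative deriv f z) (at z)" for z
    using holomorphic_derivI[OF f open_UNIV] by simp
  have "countable Z"
  proof (cases "deriv f constant_on UNIV")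
    case True
    then obtain c where c: "\<And>z. deriv f z = c" by (auto simp: constant_on_def)
    have "c \<noteq> 0"
    proof
      assume "c = 0"
      then have "(f has_field_derivative 0) (at z)" for z using df[of z] c by simp
      then have "f constant_on UNIV"
        using has_field_derivative_zero_constant[of UNIV f] by (auto simp: constant_on_def)
      then show False using nc by simp
    qed
    then show ?thesis by (simp add: Z_def c)
  next
    case False
    show ?thesis unfolding Z_def
      by (rule holomorphic_countable_zeros[OF holomorphic_deriv[OF f open_UNIV] open_UNIV connected_UNIV _ False]) auto
  qed
  then have "Z \<in> null_sets lborel" by (rule countable_imp_null_set_lborel)
  then have nZ: "negligible Z" by (simp add: negligible_iff_null_sets null_sets_completionI)
  have "negligible (f -` N - Z)"
  proof (subst locally_negligible_alt, rule ballI)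
    fix z assume z: "z \<in> f -` N - Z"
    then have "deriv f z \<noteq> 0" by (simp add: Z_def)
    then obtain r \<epsilon> h where h: "r > 0" "\<epsilon> > 0" "inverse_branch f (ball (f z) \<epsilon>) h"
      "\<And>w. w \<in> ball z r \<Longrightarrow> h (f w) = w"
      using local_inverse_branch[OF f] by metis
    define U where "U = ball z r \<inter> f -` ball (f z) \<epsilon>"
    have "open U" unfolding U_def
      using holomorphic_on_imp_continuous_on[OF f] by (intro open_Int open_ball open_vimage)
    have "(f -` N - Z) \<inter> U \<subseteq> h ` (N \<inter> ball (f z) \<epsilon>)"
      using h(4) by (force simp: U_def)
    moreover have "negligible (h ` (N \<inter> ball (f z) \<epsilon>))"
    proof (rule negligible_differentiable_image_negligible)
      show "negligible (N \<inter> ball (f z) \<epsilon>)" using N negligible_Int by blast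
      have "h differentiable_on ball (f z) \<epsilon>"
        using h(3) unfolding inverse_branch_def
        by (metis at_within_open differentiable_on_def field_differentiable_imp_differentiable holomorphic_on_def open_ball)
      then show "h differentiable_on N \<inter> ball (f z) \<epsilon>" by (rule differentiable_on_subset) auto
    qed simp
    ultimately have "negligible ((f -` N - Z) \<inter> U)" by (rule negligible_subset[rotated])
    moreover have "openin (top_of_set (f -` N - Z)) ((f -` N - Z) \<inter> U)" using \<open>open U\<close> by (rule openin_open_Int)
    moreover have "z \<in> (f -` N - Z) \<inter> U" using z h by (simp add: U_def)
    ultimately show "\<exists>U. openin (top_of_set (f -` N - Z)) U \<and> z \<in> U \<and> negligible U" by blast
  qed
  then have "negligible ((f -` N - Z) \<union> Z)" using nZ by (rule negligible_Un)
  then show ?thesis by (rule negligible_subset) auto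
qed

lemma negligible_vimage_funpow:
  assumes f: "f holomorphic_on UNIV" and nc: "\<not> f constant_on UNIV" and N: "negligible N"
  shows "negligible ((f ^^ n) -` N)"
proof (induction n)
  case (Suc n)
  have "(f ^^ Suc n) -` N = f -` ((f ^^ n) -` N)" by (auto simp: funpow_swap1)
  then show ?case using negligible_vimage_entire[OF f nc Suc] by (simp only:)
qed (use N in simp)

lemma surviving_set_negligible:
  assumes f: "f holomorphic_on UNIV" and nc: "\<not> f constant_on UNIV"
    and L: "log_inverses f \<kappa>" and t: "omitting_tract f a \<rho> V"
    and growth: "\<forall>r\<ge>r'. ln (ln (max_modulus f r)) \<le> A r * ln r" and A: "mono_on {r'..} A"
    and Aln: "eventually (\<lambda>r. A r < ln r) at_top"
    and div: "filterlim (\<lambda>n. \<Sum>k=1..n. 1 / A ((exp ^^ k) 0)) at_top sequentially"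
  obtains Q where "negligible {z. \<forall>n. exp Q \<le> norm ((f ^^ n) z)}"
proof -
  define \<delta> where "\<delta> = distortion_radius"
  have \<delta>: "0 < \<delta>" "\<delta> < 1/8" using distortion_radius by (auto simp: \<delta>_def)
  \<comment> \<open>The tract region deviates from \<open>\<zeta>0\<close> by at most
    \<open>\<eta> * x\<close> in each coordinate; \<open>2 * \<eta> * x = \<delta> * x / 8\<close>
    keeps it inside the disk of bounded distortion.\<close>
  define \<eta> where "\<eta> = \<delta> / 16"
  have \<eta>: "0 < \<eta>" "\<eta> < 1" using \<delta> by (auto simp: \<eta>_def)
  define u where "u = tract_potential f a \<rho> V"
  have u: "pos_harmonic u" unfolding u_def by (rule pos_harmonic_tract_potential[OF f t])
  obtain c x0 where c: "c > 0" "x0 > 0" "exp x0 \<ge> r'" and Apos: "\<And>x. x \<ge> x0 \<Longrightarrow> 0 < A (exp x)"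
    and area: "\<And>x y. x \<ge> x0 \<Longrightarrow> c * x / A (exp (2 * x)) \<le> measure lebesgue (log_strip u ((1 - \<eta>) * x) x y)"
    using tract_area[OF f nc t growth A \<eta>] unfolding u_def by metis
  obtain RA where RA: "\<And>r. r \<ge> RA \<Longrightarrow> A r < ln r" using Aln unfolding eventually_at_top_linorder by blast
  have cf: "continuous_on UNIV f" using f by (rule holomorphic_on_imp_continuous_on)
  define b where "b = cmod a + \<rho>"
  have b: "b > 0" using t by (simp add: b_def omitting_tract_def add_nonneg_pos)
  \<comment> \<open>80 and \<open>4 * \<kappa>\<close> serve the pullback, \<open>x0\<close> the
    area bound, \<open>11 / \<eta>\<close> ensures that at least one strip fits,
    \<open>2 * ln b\<close> that \<open>f\<close> maps the tract below \<open>exp (Q / 2)\<close>,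
    and \<open>RA\<close> that \<open>A r < ln r\<close>.\<close>
  define Q where "Q = Max {80, 4 * \<kappa>, x0, 11 / \<eta>, 2 * ln b, RA}"
  have Q: "80 \<le> Q" "4 * \<kappa> \<le> Q" "x0 \<le> Q" "11 / \<eta> \<le> Q" "2 * ln b \<le> Q" "RA \<le> Q"
    unfolding Q_def by (rule Max_ge; simp)+
  have Vsmall: "norm (f z) < exp (Q / 2)" if "0 < u z" for z
  proof -
    have "z \<in> V" using that tract_potential_pos_iff[OF t] by (simp add: u_def)
    then have "cmod (f z - a) < \<rho>" using t by (simp add: omitting_tract_def)
    then have "norm (f z) < b" using norm_triangle_ineq2[of "f z" a] by (simp add: b_def)
    also have "b = exp (ln b)" using b by simp
    also have "\<dots> \<le> exp (Q / 2)" using Q(5) by simp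
    finally show ?thesis .
  qed
  define Jz where "Jz = {z. \<forall>n. exp Q \<le> norm ((f ^^ n) z)}"
  \<comment> \<open>Cutting the logarithms to a closed disk makes \<open>J X\<close> compact and
    bounds the initial size, so that one shift \<open>N\<close> of the iterated exponential serves
    all its points.\<close>
  define J where "J = (\<lambda>X::nat. {\<omega> \<in> cball 0 (real X). exp \<omega> \<in> Jz})"
  have J0: "negligible (J X)" for X
  proof -
    have cn: "continuous_on UNIV (\<lambda>\<omega>. norm ((f ^^ k) (exp \<omega>)))" for k
      by (intro continuous_intros continuous_on_compose2[OF continuous_on_funpow[OF cf]]) auto
    have "J X = cball 0 (real X) \<inter> (\<Inter>k. {\<omega>. exp Q \<le> norm ((f ^^ k) (exp \<omega>))})"
      by (auto simp: J_def Jz_def)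
    moreover have "closed (\<Inter>k. {\<omega>. exp Q \<le> norm ((f ^^ k) (exp \<omega>))})"
      by (intro closed_INT ballI closed_Collect_le cn continuous_intros)
    ultimately have "compact (J X)" by (simp add: compact_Int_closed)
    then have JM: "J X \<in> lmeasurable" by (rule lmeasurable_compact)
    define Y where "Y = real X + 20"
    define N where "N = nat \<lceil>max 2 (2 * ln (max 1 (real X)) + 1)\<rceil>"
    have N: "2 \<le> N" "2 * ln (max 1 (real X)) + 1 \<le> real N"
      unfolding N_def by linarith+
    define B where "B = (\<lambda>n. 1 / A ((exp ^^ (Suc n + N + 2)) 0))"
    define C where "C = 25 * pi * (22 * \<delta>\<^sup>2 / (\<eta> * c))"
    have C: "C \<ge> 0" using \<eta> c by (simp add: C_def)
    have main: "B n * measure lebesgue (J X) \<le> C * measure lebesgue (killed f (Q / 2) Y (Suc n))" for n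
    \<comment> \<open>Positivity of \<open>A\<close> at the iterated exponential is read off from an
      orbit starting in \<open>J X\<close>.\<close>
    proof (cases "J X = {}")
      case True
      then show ?thesis using C by simp
    next
      case False
      have facts: "exp (2 * Re \<zeta>) \<le> (exp ^^ (Suc n + N + 2)) 0 \<and> Q \<le> Re \<zeta>"
        if w: "\<omega> \<in> J X" and z: "(f ^^ Suc n) (exp \<omega>) = exp \<zeta>" for \<omega> \<zeta>
      proof -
        define x where "x = (\<lambda>k. ln (norm ((f ^^ k) (exp \<omega>))))"
        have ge: "exp Q \<le> norm ((f ^^ k) (exp \<omega>))" for k using w by (simp add: J_def Jz_def)
        have np: "0 < norm ((f ^^ k) (exp \<omega>))" for k using ge[of k] exp_gt_zero[of Q] by linarith
        have xQ: "Q \<le> x k" for k using ge[of k] np[of k] unfolding x_def by (subst ln_ge_iff) auto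
        have xp: "0 < x k" for k using xQ[of k] Q(1) by linarith
        have xs: "x (Suc k) \<le> exp ((x k)\<^sup>2)" for k
        proof -
          define r where "r = norm ((f ^^ k) (exp \<omega>))"
          have r: "r = exp (x k)" using np[of k] by (simp add: r_def x_def)
          have "norm ((f ^^ Suc k) (exp \<omega>)) \<le> max_modulus f r"
            unfolding r_def funpow.simps o_apply by (rule norm_le_max_modulus[OF f order_refl])
          then have xM: "x (Suc k) \<le> ln (max_modulus f r)" unfolding x_def using np[of "Suc k"] by (intro ln_mono) auto
          then have lp: "0 < ln (max_modulus f r)" using xp[of "Suc k"] by linarith
          have "exp x0 \<le> exp (x k)" using xQ[of k] Q(3) by simp
          then have "r' \<le> r" using c(3) r by linarith
          then have "ln (ln (max_modulus f r)) \<le> A r * ln r" using growth by blast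
          also have "\<dots> \<le> ln r * ln r"
          proof (rule mult_right_mono)
            have "x k + 1 \<le> exp (x k)" using exp_ge_add_one_self[of "x k"] by linarith
            then have "RA \<le> r" using xQ[of k] Q(6) r by linarith
            then show "A r \<le> ln r" using RA[of r] by simp
            show "0 \<le> ln r" using xp[of k] r by simp
          qed
          also have "\<dots> = (x k)\<^sup>2" using r by (simp add: power2_eq_square)
          finally have "exp (ln (ln (max_modulus f r))) \<le> exp ((x k)\<^sup>2)" by simp
          then show ?thesis using lp xM by simp
        qed
        have "x 0 = Re \<omega>" by (simp add: x_def)
        then have "x 0 \<le> real X" using w abs_Re_le_cmod[of \<omega>] by (auto simp: J_def)
        then have "ln (x 0) \<le> ln (max 1 (real X))" using xp[of 0] by (intro ln_mono) auto
        then have "2 * ln (x 0) + 1 \<le> real N" using N by linarith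
        then have "exp (2 * x (Suc n)) \<le> (exp ^^ (Suc n + N + 2)) 0"
          by (intro orbit_growth xp xs N(1))
        moreover have "x (Suc n) = Re \<zeta>" unfolding x_def z by simp
        ultimately show ?thesis using xQ[of "Suc n"] by simp
      qed
      have logex: "\<exists>\<zeta>. (f ^^ Suc n) (exp \<omega>) = exp \<zeta>" if "\<omega> \<in> J X" for \<omega>
      proof -
        have "exp Q \<le> norm ((f ^^ Suc n) (exp \<omega>))" using that unfolding J_def Jz_def by blast
        then have "(f ^^ Suc n) (exp \<omega>) \<noteq> 0" using exp_gt_zero[of Q] by (metis norm_zero not_le)
        then show ?thesis by (metis exp_Ln)
      qed
      \<comment> \<open>By monotonicity this bounds \<open>A\<close> for all points of
        \<open>J X\<close> at the given step, which makes the constant in the covering argument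
        uniform.\<close>
      define an where "an = A ((exp ^^ (Suc n + N + 2)) 0)"
      have an: "A (exp (2 * Re \<zeta>)) \<le> an \<and> 0 < A (exp (2 * Re \<zeta>))"
        if "\<omega> \<in> J X" "(f ^^ Suc n) (exp \<omega>) = exp \<zeta>" for \<omega> \<zeta>
      proof -
        have *: "x0 \<le> 2 * Re \<zeta>" using facts[OF that] Q by linarith
        then have "exp x0 \<le> exp (2 * Re \<zeta>)" by simp
        then have r: "r' \<le> exp (2 * Re \<zeta>)" using c(3) by linarith
        have le: "exp (2 * Re \<zeta>) \<le> (exp ^^ (Suc n + N + 2)) 0" using facts[OF that] by blast
        have "r' \<le> (exp ^^ (Suc n + N + 2)) 0" using r le by (rule order_trans)
        then have "A (exp (2 * Re \<zeta>)) \<le> an"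
          unfolding an_def using r by (intro mono_onD[OF A] le) (simp_all only: atLeast_iff)
        then show ?thesis using Apos[OF *] by blast
      qed
      have anpos: "an > 0" using False logex an by (metis all_not_in_conv less_le_trans)
      have "measure lebesgue (J X) \<le> 25 * pi * (22 * \<delta>\<^sup>2 * an / (\<eta> * c)) * measure lebesgue (killed f (Q / 2) Y (Suc n))"
      proof (rule measure_le_ball_masses[OF JM killed_measurable(2)[OF cf], where B = 160])
        show "0 \<le> 22 * \<delta>\<^sup>2 * an / (\<eta> * c)" using \<eta> c anpos by simp
        fix \<omega> assume w: "\<omega> \<in> J X"
        obtain \<zeta>0 where z0: "(f ^^ Suc n) (exp \<omega>) = exp \<zeta>0" using logex[OF w] by blast
        define x where "x = Re \<zeta>0"
        have x: "Q \<le> x" using facts[OF w z0] by (simp add: x_def)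
        have x0x: "x0 \<le> x" using x Q by simp
        define q where "q = A (exp (2 * x))"
        have q: "0 < q" "q \<le> an" using an[OF w z0] by (auto simp: q_def x_def)
        have \<eta>x: "11 \<le> \<eta> * x"
        proof -
          have "11 / \<eta> \<le> x" using Q(4) x by simp
          then show ?thesis using \<eta> by (simp add: pos_divide_le_eq mult.commute)
        qed
        have "0 \<le> c * x / q" using c x Q q by simp
        then obtain S where S: "S \<in> lmeasurable" "\<eta> * x / 22 * (c * x / q) \<le> measure lebesgue S"
          "\<And>\<zeta>. \<zeta> \<in> S \<Longrightarrow> 0 < u (exp \<zeta>) \<and> \<bar>Re \<zeta> - x\<bar> \<le> \<eta> * x \<and> \<bar>Im \<zeta> - Im \<zeta>0\<bar> \<le> \<eta> * x"
          using log_strips_area[OF u \<eta> \<eta>x, of "c * x / q" "Im \<zeta>0"] area[OF x0x] unfolding q_def by metis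
        have Sb: "S \<subseteq> ball \<zeta>0 (distortion_radius * (Re \<zeta>0 / 4))"
        proof
          fix \<zeta> assume "\<zeta> \<in> S"
          then have "\<bar>Re (\<zeta> - \<zeta>0)\<bar> + \<bar>Im (\<zeta> - \<zeta>0)\<bar> \<le> \<eta> * x + \<eta> * x" using S(3)[of \<zeta>] by (simp add: x_def)
          then have "norm (\<zeta> - \<zeta>0) \<le> \<eta> * x + \<eta> * x" using cmod_le[of "\<zeta> - \<zeta>0"] by linarith
          also have "\<dots> = \<delta> * x / 8" by (simp add: \<eta>_def)
          also have "\<dots> < \<delta> * (x / 4)"
          proof -
            have "0 < \<delta> * x" using \<delta> x Q by simp
            then show ?thesis by simp
          qed
          finally show "\<zeta> \<in> ball \<zeta>0 (distortion_radius * (Re \<zeta>0 / 4))"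
            by (simp add: dist_norm norm_minus_commute \<delta>_def x_def)
        qed
        have orbit: "exp Q \<le> norm ((f ^^ k) (exp \<omega>))" for k using w by (simp add: J_def Jz_def)
        have wY: "norm \<omega> + 20 \<le> Y" using w by (simp add: J_def Y_def)
        obtain s where s: "0 < s" "s \<le> 160" "s\<^sup>2 * measure lebesgue S \<le>
            (distortion_radius * Re \<zeta>0)\<^sup>2 * measure lebesgue (killed f (Q / 2) Y (Suc n) \<inter> ball \<omega> s)"
          using killed_mass[OF cf L Q(1,2) orbit z0 wY S(1) Sb] Vsmall S(3) by metis
        define m where "m = measure lebesgue (killed f (Q / 2) Y (Suc n) \<inter> ball \<omega> s)"
        have m: "m \<ge> 0" by (simp add: m_def)
        have xp: "x > 0" using x Q by linarith
        have "s\<^sup>2 * (\<eta> * x / 22 * (c * x / q)) \<le> s\<^sup>2 * measure lebesgue S" using S(2) by (intro mult_left_mono) auto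
        also have "\<dots> \<le> (\<delta> * x)\<^sup>2 * m" using s(3) by (simp add: \<delta>_def x_def m_def)
        \<comment> \<open>Both the area of the tract region and the squared radius of its disk scale
          like \<open>x\<^sup>2\<close>; after cancellation the proportion \<open>1 / q\<close>
          remains.\<close>
        finally have "s\<^sup>2 * (\<eta> * c) * x\<^sup>2 \<le> 22 * \<delta>\<^sup>2 * q * m * x\<^sup>2"
          using q by (simp add: field_simps power2_eq_square)
        then have "s\<^sup>2 * (\<eta> * c) \<le> 22 * \<delta>\<^sup>2 * q * m" using xp by (simp add: mult_le_cancel_right)
        also have "\<dots> \<le> 22 * \<delta>\<^sup>2 * an * m" using q m by (intro mult_right_mono mult_left_mono) auto
        finally have "s\<^sup>2 \<le> 22 * \<delta>\<^sup>2 * an / (\<eta> * c) * m" using \<eta> c by (simp add: field_simps)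
        then show "\<exists>s. 0 < s \<and> s \<le> 160 \<and> s\<^sup>2 \<le> 22 * \<delta>\<^sup>2 * an / (\<eta> * c) *
            measure lebesgue (killed f (Q / 2) Y (Suc n) \<inter> ball \<omega> s)"
          using s unfolding m_def by blast
      qed
      then have "measure lebesgue (J X) \<le> an * (C * measure lebesgue (killed f (Q / 2) Y (Suc n)))"
        by (simp add: C_def mult_ac)
      then have "measure lebesgue (J X) / an \<le> C * measure lebesgue (killed f (Q / 2) Y (Suc n))"
        using anpos by (simp only: pos_divide_le_eq mult.commute)
      then show ?thesis by (simp add: B_def an_def)
    qed
    have "filterlim (\<lambda>n. \<Sum>k<n. B k) at_top sequentially"
    proof -
      \<comment> \<open>\<open>B n\<close> is the term with index \<open>n + (N + 2) + 1\<close>, so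
        the sums of \<open>B\<close> are partial sums of the given series without its first
        \<open>N + 2\<close> terms.\<close>
      define F where "F = (\<lambda>n. \<Sum>k=1..n. 1 / A ((exp ^^ k) 0))"
      have "F (n + (N + 2)) = F (N + 2) + (\<Sum>k<n. B k)" for n
      proof (induction n)
        case (Suc n)
        have "F (Suc n + (N + 2)) = F (n + (N + 2)) + B n" by (simp add: F_def B_def)
        then show ?case using Suc by simp
      qed simp
      then have eq: "(\<Sum>k<n. B k) = - F (N + 2) + F (n + (N + 2))" for n by simp
      have "filterlim F at_top sequentially" using div by (simp add: F_def)
      then have "filterlim (\<lambda>n. F (n + (N + 2))) at_top sequentially"
        by (rule filterlim_compose[OF _ filterlim_add_const_nat_at_top])
      then show ?thesis unfolding eq by (rule filterlim_tendsto_add_at_top[OF tendsto_const])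
    qed
    then have "measure lebesgue (J X) = 0"
      using C main
      by (intro measure_zero_of_divergent_masses[where K = "\<lambda>n. killed f (Q / 2) Y (Suc n)" and B = "ball 0 Y" and b = B and C = C])
        (auto simp: killed_measurable[OF cf] killed_disjoint, auto simp: killed_def)
    then show ?thesis using JM by (simp add: negligible_iff_measure)
  qed
  have "negligible (exp ` J X)" for X
  proof (rule negligible_differentiable_image_negligible[OF _ J0])
    show "exp differentiable_on J X"
      unfolding differentiable_on_def
      by (auto intro!: field_differentiable_imp_differentiable field_differentiable_within_exp)
  qed simp
  then have "negligible (\<Union>X. exp ` J X)" by (rule negligible_Union_nat)
  moreover have "Jz \<subseteq> (\<Union>X. exp ` J X)"
  proof
    fix z assume z: "z \<in> Jz"
    then have "exp Q \<le> norm ((f ^^ 0) z)" unfolding Jz_def by blast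
    then have "z \<noteq> 0" using exp_gt_zero[of Q] by (auto simp: not_le)
    then have e: "z = exp (Ln z)" by simp
    obtain X :: nat where "norm (Ln z) \<le> real X" using real_arch_simple by blast
    then have "Ln z \<in> J X" using z e by (simp add: J_def)
    then show "z \<in> (\<Union>X. exp ` J X)" using e by blast
  qed
  ultimately have "negligible Jz" by (rule negligible_subset)
  then show thesis using that[of Q] by (simp add: Jz_def)
qed

theorem theorem1p4:
  fixes f :: "complex \<Rightarrow> complex" and A :: "real \<Rightarrow> real" and r' :: real and a :: complex
  assumes "class_B f"
    and "transcendental_entire f"
    and "r' > 0"
    and "direct_singularity f a"
    and "\<forall>r\<ge>r'. ln (ln (max_modulus f r)) \<le> A r * ln r"
    and "continuous_on {r'..} A"
    and "mono_on {r'..} A"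
    and "eventually (\<lambda>r. A r < ln r) at_top"
    and "filterlim (\<lambda>n. \<Sum>k=1..n. 1 / A ((exp ^^ k) 0)) at_top sequentially"
  shows "escaping_set f \<in> null_sets lebesgue"
proof -
  have f: "f holomorphic_on UNIV" using assms(2) by (simp add: transcendental_entire_def entire_def)
  have nc: "\<not> f constant_on UNIV" by (rule transcendental_not_constant[OF assms(2)])
  obtain \<kappa> where L: "log_inverses f \<kappa>"
    using class_B_log_inverses[OF assms(1)] by blast
  obtain \<rho> V where t: "omitting_tract f a \<rho> V" using direct_singularity_tract[OF f nc assms(4)] by blast
  obtain Q where Q: "negligible {z. \<forall>n. exp Q \<le> norm ((f ^^ n) z)}"
    using surviving_set_negligible[OF f nc L t assms(5,7,8,9)] by blast
  \<comment> \<open>An escaping orbit stays above \<open>exp Q\<close> from some time on, so some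
    iterate of its starting point survives forever; preimages of null sets under iterates of
    \<open>f\<close> are null.\<close>
  have "negligible (\<Union>n. (f ^^ n) -` {z. \<forall>n. exp Q \<le> norm ((f ^^ n) z)})"
    by (rule negligible_Union_nat) (rule negligible_vimage_funpow[OF f nc Q])
  moreover have "escaping_set f \<subseteq> (\<Union>n. (f ^^ n) -` {z. \<forall>n. exp Q \<le> norm ((f ^^ n) z)})"
  proof
    fix z assume "z \<in> escaping_set f"
    then have "filterlim (\<lambda>n. (f ^^ n) z) at_infinity sequentially" by (simp add: escaping_set_def)
    then have "eventually (\<lambda>n. exp Q \<le> norm ((f ^^ n) z)) sequentially"
      unfolding filterlim_at_infinity[OF order_refl] by (simp add: less_imp_le)
    then obtain m where m: "\<And>n. n \<ge> m \<Longrightarrow> exp Q \<le> norm ((f ^^ n) z)" unfolding eventually_sequentially by blast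
    have "exp Q \<le> norm ((f ^^ n) ((f ^^ m) z))" for n
      using m[of "n + m"] by (simp add: funpow_add)
    then show "z \<in> (\<Union>n. (f ^^ n) -` {z. \<forall>n. exp Q \<le> norm ((f ^^ n) z)})" by blast
  qed
  ultimately have "negligible (escaping_set f)" by (rule negligible_subset)
  then show ?thesis by (simp add: negligible_iff_null_sets)
qed

end
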